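(* Let $\Omega\subset\mathbb{R}^2$ be a planar domain of constant width with smooth boundary. Then $\Omega$ is a bounded star-shaped domain with smooth boundary which has an admissible family of periodic billiard trajectories.
   Context: A domain of constant width $W$ is a bounded convex planar domain such that the distance between any two parallel supporting lines of it equals $W$. **Billiard ball map.** For a bounded planar domain $\Omega$ with smooth boundary let $B^*\partial\Omega=\{(q,\xi)\in T^*\partial\Omega:\ |\xi|<1\}$ be the open co-ball bundle of the boundary; the glancing set is $S^*\partial\Omega=\{|\xi|=1\}$. The map $\zeta(q,\xi)=(q,\xi+\sqrt{1-|\xi|^2}\,\nu_q^+)$, with $\nu_q^+$ the inner unit normal at $q$, identifies $B^*\partial\Omega$ with the set of inward-pointing unit (co)vectors at boundary points. The billiard ball map $\beta$ on $B^*\partial\Omega$ sends $(q,\xi)$ to $(q',\xi')$, where $q'$ is the next point at which the straight line from $q$ in the direction $\zeta(q,\xi)$ hits $\partial\Omega$, and $\xi'$ is the tangential component at $q'$ of the direction of this line. A point fixed by $\beta^k$ determines a periodic billiard trajectory, whose length (period) is the total length of its $k$ segments. A billiard trajectory is viewed as a trajectory of the billiard flow on the unit cotangent bundle $S^*\Omega$. **Clean fixed point sets.** A submanifold $Z$ of fixed points of a diffeomorphism $\Phi:M\to M$ is clean if for every $z\in Z$ the kernel of $d\Phi_z-I:T_zM\to T_zM$ equals $T_zZ$. **Admissible family.** Suppose $\beta$ possesses a smooth invariant circle $\Lambda_T\subset B^*\partial\Omega$ consisting of fixed points of $\beta^k$ for some $k\ge2$, and let $\tilde\Lambda_T\subset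 S^*\Omega$ be the corresponding family of periodic billiard trajectories of length $T$. This family is admissible if: (i) there exists $\varepsilon>0$ such that there are no periodic billiard trajectories of period $t\in[T-\varepsilon,T+\varepsilon]$ other than those in $\tilde\Lambda_T\cup\tilde\Lambda_T^{-1}$, where $\tilde\Lambda_T^{-1}$ is the family of the same trajectories traversed in the opposite direction; (ii) $\Lambda_T$ is a clean submanifold of fixed points of $\beta^k$; (iii) $\Lambda_T$ lies in the interior of $B^*\partial\Omega$, i.e. it stays away from the glancing set. *)

theory Defs
  imports "HOL-Analysis.Analysis"
begin

section \<open>Smooth curves, tangent vectors and clean fixed point sets\<close>

text \<open>Infinite differentiability on an open set \<open>I\<close> of reals; \<open>D n\<close> is the \<open>n\<close>-th derivative.\<close>

definition smooth_on :: "real set \<Rightarrow> (real \<Rightarrow> 'a::real_normed_vector) \<Rightarrow> bool" where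
  "smooth_on I c \<longleftrightarrow>
     (\<exists>D. D 0 = c \<and> (\<forall>n. \<forall>t\<in>I. (D n has_vector_derivative D (Suc n) t) (at t)))"

definition tangent_space :: "'a::real_normed_vector set \<Rightarrow> 'a \<Rightarrow> 'a set" where
  "tangent_space M z =
     {v. \<exists>c e. 0 < e \<and> smooth_on {-e<..<e} c \<and> c ` {-e<..<e} \<subseteq> M \<and> c 0 = z \<and>
           (c has_vector_derivative v) (at 0)}"

text \<open>A smoothly embedded circle, i.e. the image of an embedding of \<open>\<real> / 2 \<pi> \<int>\<close>.\<close>

definition smooth_circle :: "'a::real_normed_vector set \<Rightarrow> bool" where
  "smooth_circle Z \<longleftrightarrow>
     (\<exists>c. smooth_on UNIV c \<and> (\<forall>t. c (t + 2 * pi) = c t) \<and> inj_on c {0..<2 * pi} \<and>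
          (\<forall>t. vector_derivative c (at t) \<noteq> 0) \<and> range c = Z)"

text \<open>
  Here \<open>M\<close> is a submanifold of a normed space and \<open>\<Phi>\<close> maps \<open>M\<close> to itself near \<open>Z\<close>. A derivative
  \<open>D\<close> of \<open>\<Phi>\<close> at \<open>z\<close> within \<open>M\<close> is determined on the tangent space of \<open>M\<close> at \<open>z\<close>, where it is
  the differential of \<open>\<Phi>\<close>; only this restriction enters.
\<close>

definition clean_fixed_set ::
    "('a::real_normed_vector \<Rightarrow> 'a) \<Rightarrow> 'a set \<Rightarrow> 'a set \<Rightarrow> bool" where
  "clean_fixed_set \<Phi> M Z \<longleftrightarrow>
     Z \<subseteq> M \<and>
     (\<forall>z\<in>Z. \<Phi> z = z \<and>
        (\<exists>D. (\<Phi> has_derivative D) (at z within M) \<and>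
             {v \<in> tangent_space M z. D v - v = 0} = tangent_space Z z))"


section \<open>Planar domains\<close>

definition planar_domain :: "(real^2) set \<Rightarrow> bool" where
  "planar_domain \<Omega> \<longleftrightarrow> open \<Omega> \<and> connected \<Omega> \<and> \<Omega> \<noteq> {}"

text \<open>
  Near each of its boundary points \<open>\<Omega>\<close> is, in suitable orthonormal coordinates, the set of points
  strictly above the graph of a smooth function.
\<close>

definition smooth_boundary :: "(real^2) set \<Rightarrow> bool" where
  "smooth_boundary \<Omega> \<longleftrightarrow>
     (\<forall>p\<in>frontier \<Omega>. \<exists>r>0. \<exists>u w g.
        norm u = 1 \<and> norm w = 1 \<and> u \<bullet> w = 0 \<and> smooth_on UNIV (g :: real \<Rightarrow> real) \<and>
        (\<forall>x\<in>ball p r. x \<in> \<Omega> \<longleftrightarrow> g ((x - p) \<bullet> u) < (x - p) \<bullet> w))"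

definition supporting_line :: "(real^2) set \<Rightarrow> (real^2) set \<Rightarrow> bool" where
  "supporting_line \<Omega> L \<longleftrightarrow>
     (\<exists>a c. norm a = 1 \<and> L = {x. a \<bullet> x = c} \<and> L \<inter> closure \<Omega> \<noteq> {} \<and> (\<forall>x\<in>\<Omega>. a \<bullet> x \<le> c))"

definition constant_width_domain :: "(real^2) set \<Rightarrow> real \<Rightarrow> bool" where
  "constant_width_domain \<Omega> W \<longleftrightarrow>
     planar_domain \<Omega> \<and> bounded \<Omega> \<and> convex \<Omega> \<and>
     (\<forall>L L'. supporting_line \<Omega> L \<and> supporting_line \<Omega> L' \<and> affine_parallel L L' \<and> L \<noteq> L'
        \<longrightarrow> setdist L L' = W)"


section \<open>The billiard ball map\<close>

definition inner_normal :: "(real^2) set \<Rightarrow> real^2 \<Rightarrow> real^2" where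
  "inner_normal \<Omega> q =
     (THE \<nu>. norm \<nu> = 1 \<and> (\<forall>v\<in>tangent_space (frontier \<Omega>) q. \<nu> \<bullet> v = 0) \<and>
             (\<forall>\<^sub>F t in at_right 0. q + t *\<^sub>R \<nu> \<in> \<Omega>))"

text \<open>
  Covectors on the boundary are identified with tangent vectors by means of the Euclidean metric, so
  that the open co-ball bundle is a subset of \<open>\<real>\<^sup>2 \<times> \<real>\<^sup>2\<close>.
\<close>

definition coball_bundle :: "(real^2) set \<Rightarrow> ((real^2) \<times> (real^2)) set" where
  "coball_bundle \<Omega> =
     {(q, \<xi>). q \<in> frontier \<Omega> \<and> \<xi> \<in> tangent_space (frontier \<Omega>) q \<and> norm \<xi> < 1}"

fun direction :: "(real^2) set \<Rightarrow> (real^2) \<times> (real^2) \<Rightarrow> real^2" where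
  "direction \<Omega> (q, \<xi>) = \<xi> + sqrt (1 - (norm \<xi>)\<^sup>2) *\<^sub>R inner_normal \<Omega> q"

text \<open>
  Directions are unit vectors, so the time until the next hit is the length of the segment.
\<close>

definition segment_length :: "(real^2) set \<Rightarrow> (real^2) \<times> (real^2) \<Rightarrow> real" where
  "segment_length \<Omega> z = Inf {t. 0 < t \<and> fst z + t *\<^sub>R direction \<Omega> z \<in> frontier \<Omega>}"

definition billiard_map ::
    "(real^2) set \<Rightarrow> (real^2) \<times> (real^2) \<Rightarrow> (real^2) \<times> (real^2)" where
  "billiard_map \<Omega> z =
     (let v = direction \<Omega> z;
          q' = fst z + segment_length \<Omega> z *\<^sub>R v;
          \<nu>' = inner_normal \<Omega> q'
      in (q', v - (v \<bullet> \<nu>') *\<^sub>R \<nu>'))"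


section \<open>Periodic trajectories and admissible families\<close>

text \<open>
  For a non-convex domain the billiard ball map is only partially defined on the open co-ball bundle
  (a segment may end tangentially to the boundary), hence the condition on the iterates.
\<close>

definition billiard_periodic :: "(real^2) set \<Rightarrow> nat \<Rightarrow> (real^2) \<times> (real^2) \<Rightarrow> bool" where
  "billiard_periodic \<Omega> m z \<longleftrightarrow>
     1 \<le> m \<and> (\<forall>i\<le>m. (billiard_map \<Omega> ^^ i) z \<in> coball_bundle \<Omega>) \<and> (billiard_map \<Omega> ^^ m) z = z"

definition period_length :: "(real^2) set \<Rightarrow> nat \<Rightarrow> (real^2) \<times> (real^2) \<Rightarrow> real" where
  "period_length \<Omega> m z = (\<Sum>i<m. segment_length \<Omega> ((billiard_map \<Omega> ^^ i) z))"

text \<open>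
  The orbit of the billiard flow, as a set of pairs of a position in \<open>\<Omega>\<close> and a unit direction. The
  reflection points are left out, since two directions belong to each of them.
\<close>

definition trajectory ::
    "(real^2) set \<Rightarrow> nat \<Rightarrow> (real^2) \<times> (real^2) \<Rightarrow> ((real^2) \<times> (real^2)) set" where
  "trajectory \<Omega> m z =
     (\<Union>i<m. let y = (billiard_map \<Omega> ^^ i) z; v = direction \<Omega> y
             in (\<lambda>t. (fst y + t *\<^sub>R v, v)) ` {0<..<segment_length \<Omega> y})"

definition reverse_trajectory :: "((real^2) \<times> (real^2)) set \<Rightarrow> ((real^2) \<times> (real^2)) set" where
  "reverse_trajectory \<gamma> = (\<lambda>(x, v). (x, - v)) ` \<gamma>"

definition trajectory_family ::
    "(real^2) set \<Rightarrow> nat \<Rightarrow> ((real^2) \<times> (real^2)) set \<Rightarrow> ((real^2) \<times> (real^2)) set set" where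
  "trajectory_family \<Omega> k \<Lambda> = trajectory \<Omega> k ` \<Lambda>"

definition admissible_family ::
    "(real^2) set \<Rightarrow> nat \<Rightarrow> ((real^2) \<times> (real^2)) set \<Rightarrow> real \<Rightarrow> bool" where
  "admissible_family \<Omega> k \<Lambda> T \<longleftrightarrow>
     2 \<le> k \<and> smooth_circle \<Lambda> \<and> \<Lambda> \<subseteq> coball_bundle \<Omega> \<and> billiard_map \<Omega> ` \<Lambda> = \<Lambda> \<and>
     (\<forall>z\<in>\<Lambda>. (billiard_map \<Omega> ^^ k) z = z \<and> period_length \<Omega> k z = T) \<and>
     (\<exists>\<epsilon>>0. \<forall>m z. billiard_periodic \<Omega> m z \<and> period_length \<Omega> m z \<in> {T - \<epsilon>..T + \<epsilon>} \<longrightarrow>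
        trajectory \<Omega> m z \<in>
          trajectory_family \<Omega> k \<Lambda> \<union> reverse_trajectory ` trajectory_family \<Omega> k \<Lambda>) \<and>
     clean_fixed_set (billiard_map \<Omega> ^^ k) (coball_bundle \<Omega>) \<Lambda> \<and>
     (\<exists>r<1. \<forall>(q, \<xi>)\<in>\<Lambda>. norm \<xi> \<le> r)"

end

theory Submission
  imports Defs
begin

text \<open>
  The family consists of the double normals: in a domain of constant width \<open>W\<close> every normal chord has
  length \<open>W\<close> and is normal at both ends, so all points \<open>(q, 0)\<close> are fixed by the square of the
  billiard ball map, with period \<open>2 * W\<close>.

  The boundary is parametrised by the angle of its outer normal. Smoothness of the boundary makes all
  curvature radii positive, and since opposite radii add up to \<open>W\<close>, they lie strictly between \<open>0\<close>
  and \<open>W\<close>. The differential of the square of the billiard ball map at \<open>(q, 0)\<close> is then a nontrivial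
  shear, which is cleanness.

  For the isolation of the period, the normals at the bounce points of a periodic trajectory positively
  span the plane, hence so do three of them (Caratheodory). A triangle of boundary points with such
  normals has perimeter at least \<open>2 * W\<close>, and the perimeter can only be close to \<open>2 * W\<close> if two of the
  points are almost at distance \<open>W\<close>. Then all bounce points are near the ends of a diameter. As
  consecutive chords have comparable lengths, either all chords are short or all are long; the former
  contradicts the existence of two distant points, and the latter forces exactly two chords.
\<close>

section \<open>Iterated derivatives of curves\<close>

text \<open>Two discs carry most estimates. Constant width puts \<open>\<Omega>\<close> into the
  disc of radius \<open>W\<close> about the point opposite to any boundary point; a uniform positive
  lower bound \<open>rmin\<close> of the curvature radii puts a disc of that radius into
  \<open>\<Omega>\<close>, touching at any boundary point. The outer disc makes a boundary point a
  Lipschitz function of its normal, and this is what forbids zeros of the second derivative of a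
  local graph and thereby produces the inner disc. Both discs together make the length of a chord
  comparable to the cosine of its angle with the normal, so that consecutive chords are comparable
  even near glancing directions. The obstacle to isolating the period is that the number of bounces
  has no a priori bound, so compactness cannot be applied to orbits. It is applied to triples of
  normals with convex weights and vanishing weighted sum, which form a compact set whatever the
  orbit was. For the differential, the normal is given only along the boundary and the bundle is not
  open in the ambient space. Derivatives are therefore taken within these sets, and disc estimates
  replace an implicit function theorem for the hitting point.\<close>

text \<open>In contrast to \<open>smooth_on\<close>, this refers to the canonical derivative and is therefore visibly a
  local property.\<close>

primrec Ck :: "nat \<Rightarrow> real set \<Rightarrow> (real \<Rightarrow> 'a::real_normed_vector) \<Rightarrow> bool" where
  "Ck 0 I f \<longleftrightarrow> True"
| "Ck (Suc n) I f \<longleftrightarrow> (\<forall>t\<in>I. f differentiable (at t)) \<and> Ck n I (\<lambda>t. vector_derivative f (at t))"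

lemma Ck_cong:
  assumes "open I" "\<And>t. t \<in> I \<Longrightarrow> f t = g t" "Ck n I f"
  shows "Ck n I g"
  using assms(2,3)
proof (induction n arbitrary: f g)
  case (Suc n)
  have *: "(g has_vector_derivative vector_derivative f (at t)) (at t)" if "t \<in> I" for t
    using Suc.prems that
    by (auto simp: vector_derivative_works intro: has_vector_derivative_transform_within_open[OF _ \<open>open I\<close>])
  have "vector_derivative f (at t) = vector_derivative g (at t)" if "t \<in> I" for t
    using *[OF that] by (rule vector_derivative_at[symmetric])
  then have "Ck n I (\<lambda>t. vector_derivative g (at t))"
    using Suc.IH[of "\<lambda>t. vector_derivative f (at t)"] Suc.prems(2) by auto
  then show ?case
    using differentiableI_vector[OF *] by simp
qed simp

text \<open>Lets a derivative be supplied in closed form; the recursion itself only accepts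
  \<open>vector_derivative\<close>.\<close>

lemma Ck_SucI:
  assumes "open I" "\<And>t. t \<in> I \<Longrightarrow> (f has_vector_derivative f' t) (at t)" "Ck n I f'"
  shows "Ck (Suc n) I f"
proof -
  have "Ck n I (\<lambda>t. vector_derivative f (at t))"
    by (rule Ck_cong[OF assms(1) _ assms(3)]) (use assms(2) vector_derivative_at in fastforce)
  then show ?thesis
    using differentiableI_vector[OF assms(2)] by simp
qed

lemma Ck_SucD: "Ck (Suc n) I f \<Longrightarrow> Ck n I f"
  by (induction n arbitrary: f) auto

text \<open>Glues smoothness found in separate boundary charts into smoothness of the whole curve;
  canonical derivatives do not depend on the chart.\<close>

lemma Ck_locally: "(\<And>t. t \<in> I \<Longrightarrow> \<exists>J. t \<in> J \<and> Ck n J f) \<Longrightarrow> Ck n I f"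
proof (induction n arbitrary: f)
  case (Suc n)
  have "Ck n I (\<lambda>t. vector_derivative f (at t))"
    by (rule Suc.IH) (use Suc.prems in auto)
  with Suc.prems show ?case
    by fastforce
qed simp

lemma Ck_Suc_deriv:
  "Ck (Suc n) I f \<Longrightarrow> t \<in> I \<Longrightarrow> (f has_vector_derivative vector_derivative f (at t)) (at t)"
  by (simp add: vector_derivative_works)

lemma Ck_const: "open I \<Longrightarrow> Ck n I (\<lambda>t. c)"
  by (induction n arbitrary: c) (auto intro!: Ck_SucI[where f' = "\<lambda>_. 0"] simp del: Ck.simps(2))

lemma Ck_id: "open I \<Longrightarrow> Ck n I (\<lambda>t. t)"
  by (cases n)
    (auto intro!: Ck_SucI[where f' = "\<lambda>_. 1"] derivative_eq_intros Ck_const simp del: Ck.simps(2))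

lemma Ck_add:
  assumes "open I"
  shows "Ck n I f \<Longrightarrow> Ck n I g \<Longrightarrow> Ck n I (\<lambda>t. f t + g t)"
proof (induction n arbitrary: f g)
  case (Suc n)
  show ?case
    by (rule Ck_SucI[OF assms has_vector_derivative_add[OF Ck_Suc_deriv Ck_Suc_deriv]])
      (use Suc in auto)
qed simp

lemma Ck_scaleR:
  assumes "open I"
  shows "Ck n I f \<Longrightarrow> Ck n I g \<Longrightarrow> Ck n I (\<lambda>t. f t *\<^sub>R g t)"
proof (induction n arbitrary: f g)
  case (Suc n)
  show ?case
  proof (rule Ck_SucI[OF assms])
    fix t assume t: "t \<in> I"
    show "((\<lambda>t. f t *\<^sub>R g t) has_vector_derivative
        f t *\<^sub>R vector_derivative g (at t) + vector_derivative f (at t) *\<^sub>R g t) (at t)"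
      by (rule has_vector_derivative_scaleR[OF _ Ck_Suc_deriv[OF Suc.prems(2) t]])
        (use Ck_Suc_deriv[OF Suc.prems(1) t] in \<open>simp add: has_real_derivative_iff_has_vector_derivative\<close>)
  next
    show "Ck n I (\<lambda>t. f t *\<^sub>R vector_derivative g (at t) + vector_derivative f (at t) *\<^sub>R g t)"
      using Suc.prems by (intro Ck_add[OF assms] Suc.IH Ck_SucD[OF Suc.prems(1)] Ck_SucD[OF Suc.prems(2)]) auto
  qed
qed simp

lemma Ck_mult:
  fixes f g :: "real \<Rightarrow> real"
  assumes "open I" "Ck n I f" "Ck n I g"
  shows "Ck n I (\<lambda>t. f t * g t)"
  using Ck_scaleR[OF assms] by simp

lemma Ck_inverse:
  fixes f :: "real \<Rightarrow> real"
  assumes "open I" "\<And>t. t \<in> I \<Longrightarrow> f t \<noteq> 0"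
  shows "Ck n I f \<Longrightarrow> Ck n I (\<lambda>t. inverse (f t))"
proof (induction n)
  case (Suc n)
  have f: "Ck n I f" using Ck_SucD[OF Suc.prems] .
  show ?case
  proof (rule Ck_SucI[OF assms(1)])
    fix t assume t: "t \<in> I"
    have "(f has_real_derivative vector_derivative f (at t)) (at t)"
      using Ck_Suc_deriv[OF Suc.prems t] by (simp add: has_real_derivative_iff_has_vector_derivative)
    from DERIV_inverse_fun[OF this assms(2)[OF t]]
    show "((\<lambda>t. inverse (f t)) has_vector_derivative
        - 1 * (vector_derivative f (at t) * (inverse (f t) * inverse (f t)))) (at t)"
      by (simp add: has_real_derivative_iff_has_vector_derivative mult_ac)
  next
    show "Ck n I (\<lambda>t. - 1 * (vector_derivative f (at t) * (inverse (f t) * inverse (f t))))"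
      using Suc f by (intro Ck_mult Ck_const assms(1)) auto
  qed
qed simp

lemma Ck_compose:
  fixes g :: "real \<Rightarrow> real"
  assumes "open I" "\<And>t. t \<in> I \<Longrightarrow> g t \<in> J"
  shows "Ck n J f \<Longrightarrow> Ck n I g \<Longrightarrow> Ck n I (\<lambda>t. f (g t))"
proof (induction n arbitrary: f)
  case (Suc n)
  show ?case
  proof (rule Ck_SucI[OF assms(1)])
    fix t assume t: "t \<in> I"
    show "((\<lambda>t. f (g t)) has_vector_derivative
        vector_derivative g (at t) *\<^sub>R vector_derivative f (at (g t))) (at t)"
      using vector_diff_chain_at[OF Ck_Suc_deriv[OF Suc.prems(2) t] Ck_Suc_deriv[OF Suc.prems(1) assms(2)[OF t]]]
      by (simp add: o_def)
  next
    show "Ck n I (\<lambda>t. vector_derivative g (at t) *\<^sub>R vector_derivative f (at (g t)))"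
      using Suc.prems Suc.IH[of "\<lambda>x. vector_derivative f (at x)"] Ck_SucD[OF Suc.prems(2)]
      by (intro Ck_scaleR assms(1)) auto
  qed
qed simp

lemma Ck_cos_sin: "Ck n UNIV (cos :: real \<Rightarrow> real) \<and> Ck n UNIV (sin :: real \<Rightarrow> real)"
proof (induction n)
  case (Suc n)
  have "Ck (Suc n) UNIV (cos :: real \<Rightarrow> real)"
    by (rule Ck_SucI[where f' = "\<lambda>t. - 1 * sin t"])
      (use Suc Ck_mult[OF open_UNIV Ck_const[OF open_UNIV, of _ "-1"], of n sin] in \<open>auto intro!: DERIV_cos simp flip: has_real_derivative_iff_has_vector_derivative\<close>)
  moreover have "Ck (Suc n) UNIV (sin :: real \<Rightarrow> real)"
    by (rule Ck_SucI[where f' = cos])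
      (use Suc in \<open>auto intro!: DERIV_sin simp flip: has_real_derivative_iff_has_vector_derivative\<close>)
  ultimately show ?case by simp
qed simp

text \<open>The sequence witnessing \<open>smooth_on\<close> may be arbitrary off \<open>I\<close>,
  but on an open \<open>I\<close> it is forced to agree with the canonical derivatives.\<close>

lemma smooth_on_iff_Ck:
  assumes "open I"
  shows "smooth_on I f \<longleftrightarrow> (\<forall>n. Ck n I f)"
proof
  assume "smooth_on I f"
  then obtain D where D: "D 0 = f" "\<And>n t. t \<in> I \<Longrightarrow> (D n has_vector_derivative D (Suc n) t) (at t)"
    by (auto simp: smooth_on_def)
  have "Ck k I (D n)" for k n
    by (induction k arbitrary: n) (auto intro!: Ck_SucI[OF assms D(2)] simp del: Ck.simps(2) simp: Ck.simps(1))
  with D(1) show "\<forall>n. Ck n I f" by metis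
next
  assume f: "\<forall>n. Ck n I f"
  define D where "D n = ((\<lambda>g t. vector_derivative g (at t)) ^^ n) f" for n
  have D_Suc: "D (Suc n) = (\<lambda>t. vector_derivative (D n) (at t))" for n
    by (simp add: D_def)
  have Ck: "Ck k I (D n)" for k n
  proof (induction n arbitrary: k)
    case 0
    then show ?case using f by (simp add: D_def)
  next
    case (Suc n)
    from Suc[of "Suc k"] show ?case by (simp add: D_Suc)
  qed
  show "smooth_on I f"
    unfolding smooth_on_def
  proof (intro exI conjI allI ballI)
    show "D 0 = f" by (simp add: D_def)
    show "(D n has_vector_derivative D (Suc n) t) (at t)" if "t \<in> I" for n t
      using Ck_Suc_deriv[OF Ck[of "Suc 0" n] that] by (simp add: D_Suc)
  qed
qed

section \<open>The rotating frame\<close>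

text \<open>Together with \<open>tng\<close> this becomes the moving frame of the boundary: the
  outer normal and the counterclockwise tangent at \<open>bd \<theta>\<close>.\<close>

definition nrm :: "real \<Rightarrow> real^2" where
  "nrm \<theta> = vector [cos \<theta>, sin \<theta>]"

definition tng :: "real \<Rightarrow> real^2" where
  "tng \<theta> = vector [- sin \<theta>, cos \<theta>]"

lemma inner_frame [simp]:
  "nrm a \<bullet> nrm b = cos (a - b)" "tng a \<bullet> tng b = cos (a - b)"
  "nrm a \<bullet> tng b = sin (a - b)" "tng a \<bullet> nrm b = - sin (a - b)"
  by (simp_all add: nrm_def tng_def inner_vec_def sum_2 cos_diff sin_diff)

lemma norm_frame [simp]: "norm (nrm a) = 1" "norm (tng a) = 1"
  by (simp_all add: norm_eq_sqrt_inner)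

lemma frame_add_pi [simp]: "nrm (a + pi) = - nrm a" "tng (a + pi) = - tng a"
  by (simp_all add: nrm_def tng_def vec_eq_iff forall_2)

lemma frame_add_2pi [simp]: "nrm (a + 2 * pi) = nrm a" "tng (a + 2 * pi) = tng a"
  by (simp_all add: nrm_def tng_def)

lemma frame_expansion: "x = (x \<bullet> nrm a) *\<^sub>R nrm a + (x \<bullet> tng a) *\<^sub>R tng a"
proof -
  have *: "y = cos a * (cos a * y) + sin a * (sin a * y)" for y
    by (simp add: sin_cos_squared_add3 flip: mult.assoc distrib_right)
  show ?thesis
    by (simp add: nrm_def tng_def vec_eq_iff forall_2 inner_vec_def sum_2 algebra_simps)
      (intro conjI *)
qed

lemma frame_norm: "(norm x)\<^sup>2 = (x \<bullet> nrm a)\<^sup>2 + (x \<bullet> tng a)\<^sup>2"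
proof -
  have "x \<bullet> x = x \<bullet> ((x \<bullet> nrm a) *\<^sub>R nrm a + (x \<bullet> tng a) *\<^sub>R tng a)"
    using frame_expansion[of x a] by simp
  then show ?thesis
    unfolding power2_norm_eq_inner by (simp only: inner_add_right inner_scaleR_right power2_eq_square)
qed

lemma unit_vector_eq_nrm:
  fixes a :: "real^2"
  assumes "norm a = 1"
  obtains \<theta> where "0 \<le> \<theta>" "\<theta> < 2 * pi" "a = nrm \<theta>"
proof -
  have "(a $ 1)\<^sup>2 + (a $ 2)\<^sup>2 = 1"
    using assms by (simp add: norm_eq_sqrt_inner inner_vec_def sum_2 power2_eq_square)
  then obtain t where "0 \<le> t" "t < 2 * pi" "a $ 1 = cos t" "a $ 2 = sin t"
    using sincos_total_2pi by metis
  then show thesis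
    by (intro that[of t]) (auto simp: nrm_def vec_eq_iff forall_2)
qed

lemma nrm_eq_iff: "nrm a = nrm b \<longleftrightarrow> cos (a - b) = 1"
proof
  assume "cos (a - b) = 1"
  then have "(nrm a - nrm b) \<bullet> (nrm a - nrm b) = 0"
    by (simp add: algebra_simps inner_diff_left inner_diff_right cos_diff)
  then show "nrm a = nrm b" by simp
next
  assume "nrm a = nrm b"
  then show "cos (a - b) = 1"
    by (metis inner_frame(1) cos_zero diff_self)
qed

lemma nrm_inj: "nrm a = nrm b \<Longrightarrow> a \<in> {0..<2 * pi} \<Longrightarrow> b \<in> {0..<2 * pi} \<Longrightarrow> a = b"
proof -
  assume "nrm a = nrm b" and ab: "a \<in> {0..<2 * pi}" "b \<in> {0..<2 * pi}"
  then obtain n :: int where n: "a - b = n * (2 * pi)"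
    unfolding nrm_eq_iff cos_one_2pi_int by auto
  have "\<bar>n * (2 * pi)\<bar> < 1 * (2 * pi)"
    unfolding n[symmetric] using ab by auto
  then have "\<bar>of_int n :: real\<bar> < 1"
    by (subst (asm) abs_mult) (simp add: mult_less_cancel_right)
  then have "n = 0" by linarith
  with n show "a = b" by simp
qed

lemma unit_vectors_parallel:
  fixes a b :: "real^2"
  assumes "norm a = 1" "norm b = 1" "a \<bullet> t = 0" "b \<bullet> t = 0" "t \<noteq> 0"
  shows "a = b \<or> a = - b"
proof -
  obtain \<theta> where th: "a = nrm \<theta>" using unit_vector_eq_nrm assms(1) by metis
  have "t = (t \<bullet> tng \<theta>) *\<^sub>R tng \<theta>"
    using frame_expansion[of t \<theta>] assms(3) th by (simp add: inner_commute)
  then have "b \<bullet> tng \<theta> = 0"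
    using assms(4,5) by (metis inner_scaleR_right mult_eq_0_iff scale_zero_left)
  then have "b = (b \<bullet> nrm \<theta>) *\<^sub>R nrm \<theta>" "(b \<bullet> nrm \<theta>)\<^sup>2 = 1"
    using frame_expansion[of b \<theta>] frame_norm[of b \<theta>] assms(2) by simp_all
  then show ?thesis
    by (metis minus_minus power2_eq_1_iff scaleR_minus1_left scaleR_one th)
qed

lemma frame_alt:
  "nrm a = cos a *\<^sub>R nrm 0 + sin a *\<^sub>R tng 0" "tng a = cos a *\<^sub>R tng 0 + (- 1 * sin a) *\<^sub>R nrm 0"
  by (simp_all add: nrm_def tng_def vec_eq_iff forall_2)

lemma nrm_has_vector_derivative: "(nrm has_vector_derivative tng a) (at a)"
proof -
  have "((\<lambda>a. cos a *\<^sub>R nrm 0 + sin a *\<^sub>R tng 0) has_vector_derivative tng a) (at a)"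
    by (subst frame_alt(2)[of a]) (auto intro!: derivative_eq_intros)
  then show ?thesis
    by (simp flip: frame_alt(1))
qed

lemma tng_has_vector_derivative: "(tng has_vector_derivative - nrm a) (at a)"
proof -
  have "((\<lambda>a. cos a *\<^sub>R tng 0 + (- 1 * sin a) *\<^sub>R nrm 0) has_vector_derivative - nrm a) (at a)"
    by (subst frame_alt(1)[of a]) (auto intro!: derivative_eq_intros)
  then show ?thesis
    unfolding frame_alt(2)[symmetric] .
qed

lemma continuous_on_frame [continuous_intros]:
  assumes "continuous_on A f"
  shows "continuous_on A (\<lambda>x. nrm (f x))" "continuous_on A (\<lambda>x. tng (f x))"
  using continuous_on_compose2[OF continuous_on_vector_derivative[OF nrm_has_vector_derivative] assms]
    continuous_on_compose2[OF continuous_on_vector_derivative[OF tng_has_vector_derivative] assms]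
  by auto

section \<open>Domains of constant width\<close>

lemma nrm_neq_0 [simp]: "nrm a \<noteq> 0" "tng a \<noteq> 0"
  by (metis norm_frame norm_zero zero_neq_one)+

lemma norm_nrm_diff: "norm (nrm a - nrm b) = 2 * \<bar>sin ((a - b) / 2)\<bar>"
proof (rule power2_eq_imp_eq)
  have "cos (b - a) = cos (a - b)"
    by (metis cos_minus minus_diff_eq)
  then show "(norm (nrm a - nrm b))\<^sup>2 = (2 * \<bar>sin ((a - b) / 2)\<bar>)\<^sup>2"
    using cos_double_sin[of "(a - b) / 2", unfolded times_divide_eq_right nonzero_mult_div_cancel_left[OF zero_neq_numeral[symmetric]]]
    by (simp add: power2_norm_eq_inner inner_diff_left inner_diff_right power_mult_distrib)
qed auto

lemma norm_nrm_diff_le: "norm (nrm a - nrm b) \<le> \<bar>a - b\<bar>"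
  using abs_sin_x_le_abs_x[of "(a - b) / 2"] by (simp add: norm_nrm_diff)

locale smooth_constant_width =
  fixes \<Omega> :: "(real^2) set" and W :: real
  assumes width: "constant_width_domain \<Omega> W" and smooth: "smooth_boundary \<Omega>"
begin

lemma open_dom: "open \<Omega>" and bounded_dom: "bounded \<Omega>" and convex_dom: "convex \<Omega>" and nonempty_dom: "\<Omega> \<noteq> {}"
  using width by (auto simp: constant_width_domain_def planar_domain_def)

lemma compact_closure_dom: "compact (closure \<Omega>)" and convex_closure_dom: "convex (closure \<Omega>)"
  using bounded_dom convex_dom by (auto simp: convex_closure)

lemma frontier_eq: "frontier \<Omega> = closure \<Omega> - \<Omega>"
  using open_dom by (simp add: frontier_def interior_open)

lemma interior_closure_dom: "interior (closure \<Omega>) = \<Omega>"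
  using convex_interior_closure[OF convex_dom] open_dom by (simp add: interior_open)

lemma ex_greater_inner:
  assumes "x \<in> \<Omega>" "a \<noteq> 0"
  obtains y where "y \<in> \<Omega>" "x \<bullet> a < y \<bullet> a"
proof -
  obtain e where e: "e > 0" "ball x e \<subseteq> \<Omega>"
    using open_dom assms open_contains_ball by metis
  have "x + (e / (2 * norm a)) *\<^sub>R a \<in> ball x e"
    using e(1) assms(2) by (simp add: dist_norm)
  moreover have "x \<bullet> a < (x + (e / (2 * norm a)) *\<^sub>R a) \<bullet> a"
    using e(1) assms(2) by (simp add: inner_add_left)
  ultimately show thesis using e that by blast
qed

lemma maximiser_in_frontier:
  assumes "x \<in> closure \<Omega>" "\<And>y. y \<in> closure \<Omega> \<Longrightarrow> y \<bullet> a \<le> x \<bullet> a" "a \<noteq> 0"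
  shows "x \<in> frontier \<Omega>"
  using assms ex_greater_inner[of x a] closure_subset[of \<Omega>] unfolding frontier_eq
  by (metis DiffI not_less subsetD)

text \<open>Turns the definition by distances of supporting lines into an equation between extreme
  points, the only form in which constant width is used afterwards.\<close>

lemma width_eq:
  assumes a: "norm a = 1"
    and x: "x \<in> closure \<Omega>" "\<And>z. z \<in> closure \<Omega> \<Longrightarrow> z \<bullet> a \<le> x \<bullet> a"
    and y: "y \<in> closure \<Omega>" "\<And>z. z \<in> closure \<Omega> \<Longrightarrow> y \<bullet> a \<le> z \<bullet> a"
  shows "(x - y) \<bullet> a = W"
proof -
  \<comment> \<open>The lower line gets the normal \<open>- a\<close>, since
    \<open>supporting_line\<close> wants the domain on the side of the smaller values.\<close>
  let ?L = "{z. a \<bullet> z = x \<bullet> a}" and ?L' = "{z. (- a) \<bullet> z = - (y \<bullet> a)}"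
  define d where "d = (x - y) \<bullet> a"
  have sub: "\<Omega> \<subseteq> closure \<Omega>" by (rule closure_subset)
  have S: "supporting_line \<Omega> ?L"
    unfolding supporting_line_def
    by (intro exI[of _ a] exI[of _ "x \<bullet> a"]) (use a x sub in \<open>auto simp: inner_commute\<close>)
  have S': "supporting_line \<Omega> ?L'"
    unfolding supporting_line_def
    by (intro exI[of _ "- a"] exI[of _ "- (y \<bullet> a)"]) (use a y sub in \<open>auto simp: inner_commute\<close>)
  have aa: "a \<bullet> a = 1" using a by (simp add: norm_eq_1)
  have "?L' = (\<lambda>z. (- d) *\<^sub>R a + z) ` ?L"
  proof (intro subset_antisym subsetI)
    fix z assume "z \<in> ?L'"
    then have "z + d *\<^sub>R a \<in> ?L"
      by (auto simp: inner_add_right aa d_def inner_diff_left inner_diff_right inner_commute)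
    then show "z \<in> (\<lambda>z. (- d) *\<^sub>R a + z) ` ?L"
      by (intro image_eqI[of z _ "z + d *\<^sub>R a"]) simp_all
  qed (auto simp: inner_add_right inner_diff_right aa d_def inner_diff_left inner_commute)
  then have par: "affine_parallel ?L ?L'"
    unfolding affine_parallel_def by (rule exI)
  \<comment> \<open>An open set has positive extent in every direction, so the two lines are
    distinct, as the definition of width demands.\<close>
  obtain w where w: "w \<in> \<Omega>" using nonempty_dom by blast
  have "a \<noteq> 0" using a by auto
  from ex_greater_inner[OF w this] obtain w' where "w' \<in> \<Omega>" "w \<bullet> a < w' \<bullet> a" .
  then have d_pos: "d > 0"
    using x(2)[OF subsetD[OF sub, of w']] y(2)[OF subsetD[OF sub w]] by (simp add: d_def inner_diff_left)
  have "x \<in> ?L" "x \<notin> ?L'" using d_pos by (auto simp: inner_commute d_def inner_diff_left inner_diff_right)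
  then have "?L \<noteq> ?L'" by blast
  with width S S' par have "setdist ?L ?L' = W"
    unfolding constant_width_domain_def by blast
  moreover have "setdist ?L ?L' = d"
  proof (rule antisym)
    have "x - d *\<^sub>R a \<in> ?L'"
      by (simp add: inner_diff_right aa d_def inner_diff_left inner_commute)
    then have "setdist ?L ?L' \<le> dist x (x - d *\<^sub>R a)"
      by (intro setdist_le_dist) (auto simp: inner_commute)
    then show "setdist ?L ?L' \<le> d"
      using a d_pos by (simp add: dist_norm)
    show "d \<le> setdist ?L ?L'"
    proof (rule le_setdistI)
      fix u v assume "u \<in> ?L" "v \<in> ?L'"
      then have "d = a \<bullet> (u - v)"
        by (simp add: d_def inner_diff_left inner_diff_right)
      also have "\<dots> \<le> norm a * norm (u - v)" by (rule norm_cauchy_schwarz)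
      finally show "d \<le> dist u v" using a by (simp add: dist_norm)
    qed (use \<open>x \<in> ?L\<close> \<open>x - d *\<^sub>R a \<in> ?L'\<close> in auto)
  qed
  ultimately show ?thesis by (simp add: d_def)
qed

lemma ex_maximiser: "\<exists>x\<in>closure \<Omega>. \<forall>y\<in>closure \<Omega>. y \<bullet> a \<le> x \<bullet> a"
  by (rule continuous_attains_sup[OF compact_closure_dom])
    (use nonempty_dom in \<open>auto intro!: continuous_intros\<close>)

text \<open>The distance of two points is their extent in the direction of their difference, and the
  closure has extent \<open>W\<close> in every direction.\<close>

lemma dist_le_width:
  assumes "x \<in> closure \<Omega>" "y \<in> closure \<Omega>"
  shows "dist x y \<le> W"
proof (cases "x = y")
  \<comment> \<open>Only \<open>0 \<le> W\<close> is at stake here; the width in an arbitrary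
    direction provides it.\<close>
  case True
  obtain u where "u \<in> closure \<Omega>" "\<forall>z\<in>closure \<Omega>. z \<bullet> nrm 0 \<le> u \<bullet> nrm 0"
    using ex_maximiser by blast
  moreover obtain v where "v \<in> closure \<Omega>" "\<forall>z\<in>closure \<Omega>. z \<bullet> (- nrm 0) \<le> v \<bullet> (- nrm 0)"
    using ex_maximiser by blast
  ultimately have "(u - v) \<bullet> nrm 0 = W" "0 \<le> (u - v) \<bullet> nrm 0"
    using width_eq[of "nrm 0" u v] by (auto simp: inner_diff_left)
  then show ?thesis using True by simp
next
  case False
  define a where "a = (x - y) /\<^sub>R norm (x - y)"
  have a: "norm a = 1" using False by (simp add: a_def)
  obtain u where u: "u \<in> closure \<Omega>" "\<forall>z\<in>closure \<Omega>. z \<bullet> a \<le> u \<bullet> a"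
    using ex_maximiser by blast
  obtain v where v: "v \<in> closure \<Omega>" "\<forall>z\<in>closure \<Omega>. z \<bullet> (- a) \<le> v \<bullet> (- a)"
    using ex_maximiser by blast
  have "dist x y = (x - y) \<bullet> a"
    using False by (simp add: a_def dist_norm flip: power2_norm_eq_inner) (simp add: power2_eq_square)
  also have "\<dots> \<le> (u - v) \<bullet> a"
    using u(2) v(2) assms by (force simp: inner_diff_left)
  also have "\<dots> = W"
    using width_eq[OF a, of u v] u v by simp
  finally show ?thesis .
qed

text \<open>The inverse of the Gauss map. The choice is only provisional: by
  \<open>bd_unique\<close> there is a single candidate, so the domain is strictly convex.\<close>

definition bd :: "real \<Rightarrow> real^2" where
  "bd \<theta> = (SOME x. x \<in> closure \<Omega> \<and> (\<forall>y\<in>closure \<Omega>. y \<bullet> nrm \<theta> \<le> x \<bullet> nrm \<theta>))"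

lemma bd_closure: "bd \<theta> \<in> closure \<Omega>" and bd_max: "y \<in> closure \<Omega> \<Longrightarrow> y \<bullet> nrm \<theta> \<le> bd \<theta> \<bullet> nrm \<theta>"
proof -
  have "\<exists>x. x \<in> closure \<Omega> \<and> (\<forall>y\<in>closure \<Omega>. y \<bullet> nrm \<theta> \<le> x \<bullet> nrm \<theta>)"
    using ex_maximiser[of "nrm \<theta>"] by blast
  from someI_ex[OF this] show "bd \<theta> \<in> closure \<Omega>" "y \<in> closure \<Omega> \<Longrightarrow> y \<bullet> nrm \<theta> \<le> bd \<theta> \<bullet> nrm \<theta>"
    unfolding bd_def by auto
qed

lemma bd_frontier: "bd \<theta> \<in> frontier \<Omega>"
  by (rule maximiser_in_frontier[OF bd_closure bd_max]) simp_all

text \<open>A maximiser \<open>x\<close> lies at distance at most \<open>W\<close> from the opposite point, but its component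
  along the normal is already \<open>W\<close>.\<close>

lemma maximiser_eq:
  assumes "x \<in> closure \<Omega>" "\<And>y. y \<in> closure \<Omega> \<Longrightarrow> y \<bullet> nrm \<theta> \<le> x \<bullet> nrm \<theta>"
  shows "x = bd (\<theta> + pi) + W *\<^sub>R nrm \<theta>"
proof -
  let ?d = "x - bd (\<theta> + pi)"
  have min: "bd (\<theta> + pi) \<bullet> nrm \<theta> \<le> y \<bullet> nrm \<theta>" if "y \<in> closure \<Omega>" for y
    using bd_max[of y "\<theta> + pi"] that by simp
  have 1: "?d \<bullet> nrm \<theta> = W"
    by (rule width_eq) (use assms bd_closure min in auto)
  have "norm ?d \<le> W"
    using dist_le_width[OF assms(1) bd_closure] by (simp add: dist_norm)
  then have "(norm ?d)\<^sup>2 \<le> W\<^sup>2" by (rule power_mono) simp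
  then have "?d \<bullet> tng \<theta> = 0"
    using frame_norm[of ?d \<theta>] 1 by simp
  then show ?thesis
    using frame_expansion[of ?d \<theta>] 1 by (simp add: algebra_simps)
qed

lemma bd_add_pi: "bd (\<theta> + pi) = bd \<theta> - W *\<^sub>R nrm \<theta>"
  using maximiser_eq[OF bd_closure bd_max, of \<theta>] by simp

lemma bd_unique:
  assumes "x \<in> closure \<Omega>" "\<And>y. y \<in> closure \<Omega> \<Longrightarrow> y \<bullet> nrm \<theta> \<le> x \<bullet> nrm \<theta>"
  shows "x = bd \<theta>"
  using maximiser_eq[OF assms] bd_add_pi by simp

lemma bd_add_2pi [simp]: "bd (\<theta> + 2 * pi) = bd \<theta>"
  using bd_add_pi[of "\<theta> + pi"] bd_add_pi[of \<theta>] by (simp add: add.assoc)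

lemma bd_nrm_cong: "nrm a = nrm b \<Longrightarrow> bd a = bd b"
  by (rule bd_unique[OF bd_closure]) (metis bd_max)

lemma width_pos: "W > 0"
proof -
  obtain x where x: "x \<in> \<Omega>" using nonempty_dom by blast
  have "nrm 0 \<noteq> 0" using norm_frame(1)[of 0] by fastforce
  then obtain y where "y \<in> \<Omega>" "x \<bullet> nrm 0 < y \<bullet> nrm 0"
    using ex_greater_inner[OF x] by blast
  then have "x \<noteq> y" "dist x y \<le> W"
    using dist_le_width x closure_subset by blast+
  then show ?thesis by (metis dist_pos_lt less_le_trans)
qed

lemma range_bd: "range bd = frontier \<Omega>"
proof (intro subset_antisym subsetI)
  fix x assume x: "x \<in> frontier \<Omega>"
  obtain a where a: "a \<noteq> 0" "\<And>y. y \<in> closure \<Omega> \<Longrightarrow> a \<bullet> x \<le> a \<bullet> y"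
  proof -
    have "x \<in> closure \<Omega>" "x \<notin> rel_interior \<Omega>"
      using x open_dom by (auto simp: frontier_eq rel_interior_open)
    from supporting_hyperplane_relative_frontier[OF convex_dom this] show thesis
      using that by metis
  qed
  obtain \<theta> where th: "- a /\<^sub>R norm a = nrm \<theta>"
    using unit_vector_eq_nrm[of "- a /\<^sub>R norm a"] a(1) by auto
  have "y \<bullet> nrm \<theta> \<le> x \<bullet> nrm \<theta>" if "y \<in> closure \<Omega>" for y
    unfolding th[symmetric] using a(2)[OF that] a(1) by (simp add: inner_commute divide_right_mono field_simps)
  then have "x = bd \<theta>" using bd_unique x by (simp add: frontier_eq)
  then show "x \<in> range bd" by blast
qed (use bd_frontier in auto)

text \<open>Geometrically: \<open>\<Omega>\<close> lies in the disc of radius \<open>W\<close> about the point opposite to \<open>bd a\<close>.\<close>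

lemma outer_disc:
  assumes "x \<in> closure \<Omega>"
  shows "(norm (x - bd a))\<^sup>2 \<le> 2 * W * ((bd a - x) \<bullet> nrm a)"
proof -
  have "norm (x - bd (a + pi)) \<le> W"
    using dist_le_width[OF assms bd_closure] by (simp add: dist_norm)
  then have "(norm (x - bd (a + pi)))\<^sup>2 \<le> W\<^sup>2" by (rule power_mono) simp
  moreover have "x - bd (a + pi) = (x - bd a) + W *\<^sub>R nrm a"
    by (simp add: bd_add_pi)
  moreover have "(norm (u + W *\<^sub>R nrm a))\<^sup>2 = (norm u)\<^sup>2 + 2 * W * (u \<bullet> nrm a) + W\<^sup>2" for u
    by (simp add: power2_norm_eq_inner inner_add_left inner_add_right inner_commute)
      (simp add: power2_eq_square)
  ultimately show ?thesis
    by (simp add: inner_diff_left right_diff_distrib)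
qed

text \<open>Add \<open>outer_disc\<close> for the pair and for the exchanged pair: the right-hand
  sides combine into the inner product of the two differences.\<close>

lemma bd_lipschitz: "norm (bd a - bd b) \<le> W * norm (nrm a - nrm b)"
proof -
  have "2 * (norm (bd a - bd b))\<^sup>2 \<le> 2 * W * ((bd a - bd b) \<bullet> (nrm a - nrm b))"
    using outer_disc[OF bd_closure, of a b] outer_disc[OF bd_closure, of b a]
    by (simp add: norm_minus_commute inner_diff_left inner_diff_right algebra_simps)
  also have "\<dots> \<le> 2 * W * (norm (bd a - bd b) * norm (nrm a - nrm b))"
    using width_pos by (intro mult_left_mono norm_cauchy_schwarz) auto
  finally show ?thesis
    by (cases "bd a = bd b") (use width_pos in \<open>auto simp: power2_eq_square mult_ac\<close>)
qed

lemma bd_lipschitz_abs: "norm (bd a - bd b) \<le> W * \<bar>a - b\<bar>"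
  by (rule order_trans[OF bd_lipschitz]) (use width_pos norm_nrm_diff_le in \<open>simp add: mult_left_mono\<close>)

lemma continuous_bd: "continuous_on UNIV bd"
proof (rule lipschitz_on_continuous_on[of W], rule lipschitz_onI)
  show "dist (bd x) (bd y) \<le> W * dist x y" for x y
    using bd_lipschitz_abs[of x y] by (simp add: dist_norm)
qed (use width_pos in auto)

end

section \<open>Smoothness of the support parametrisation\<close>

text \<open>A Lipschitz solution of \<open>f (X \<phi>) = m \<phi>\<close> with \<open>m' \<noteq> 0\<close> can
  exist only where \<open>f'\<close> does not vanish. This is what makes the curvature radii positive.\<close>

lemma implicit_derivative:
  fixes f m X :: "real \<Rightarrow> real"
  assumes "open I" "\<theta> \<in> I"
    and eq: "\<And>\<phi>. \<phi> \<in> I \<Longrightarrow> f (X \<phi>) = m \<phi>"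
    and f: "(f has_real_derivative f') (at (X \<theta>))"
    and m: "(m has_real_derivative m') (at \<theta>)" "m' \<noteq> 0"
    and lip: "\<And>\<phi>. \<bar>X \<phi> - X \<theta>\<bar> \<le> L * \<bar>\<phi> - \<theta>\<bar>"
  shows "f' \<noteq> 0" "(X has_real_derivative m' / f') (at \<theta>)"
proof -
  \<comment> \<open>With the difference quotients of Caratheodory the equation reads \<open>H (X
    \<phi>) * (X \<phi> - X \<theta>) = K \<phi> * (\<phi> - \<theta>)\<close>; the Lipschitz bound
    then gives \<open>\<bar>m'\<bar> \<le> \<bar>f'\<bar> * L\<close> in the limit.\<close>
  obtain H where H: "\<And>z. f z - f (X \<theta>) = H z * (z - X \<theta>)" "isCont H (X \<theta>)" "H (X \<theta>) = f'"
    using f unfolding CARAT_DERIV by blast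
  obtain K where K: "\<And>z. m z - m \<theta> = K z * (z - \<theta>)" "isCont K \<theta>" "K \<theta> = m'"
    using m unfolding CARAT_DERIV by blast
  have "X \<midarrow>\<theta>\<rightarrow> X \<theta>"
  proof (rule LIM_zero_cancel, rule tendsto_rabs_zero_cancel, rule tendsto_sandwich[of "\<lambda>_. 0"])
    have "((\<lambda>\<phi>. L * \<bar>\<phi> - \<theta>\<bar>) \<longlongrightarrow> L * \<bar>\<theta> - \<theta>\<bar>) (at \<theta>)"
      by (intro tendsto_intros)
    then show "((\<lambda>\<phi>. L * \<bar>\<phi> - \<theta>\<bar>) \<longlongrightarrow> 0) (at \<theta>)" by simp
  qed (use lip in auto)
  then have HX: "(\<lambda>\<phi>. H (X \<phi>)) \<midarrow>\<theta>\<rightarrow> f'"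
    using isCont_tendsto_compose[OF H(2)] H(3) by fastforce
  have KK: "K \<midarrow>\<theta>\<rightarrow> m'"
    using K(2,3) by (simp add: isCont_def)
  have HK: "H (X \<phi>) * (X \<phi> - X \<theta>) = K \<phi> * (\<phi> - \<theta>)" if "\<phi> \<in> I" for \<phi>
    using H(1)[of "X \<phi>"] K(1)[of \<phi>] eq that assms(2) by simp
  have ev: "\<forall>\<^sub>F \<phi> in at \<theta>. \<phi> \<in> I \<and> \<phi> \<noteq> \<theta>"
    using eventually_at_in_open[OF assms(1,2)] by simp
  have "\<bar>m'\<bar> \<le> \<bar>f'\<bar> * L"
  proof (rule tendsto_le[OF _ tendsto_mult[OF tendsto_rabs[OF HX] tendsto_const] tendsto_rabs[OF KK]])
    show "\<forall>\<^sub>F \<phi> in at \<theta>. \<bar>K \<phi>\<bar> \<le> \<bar>H (X \<phi>)\<bar> * L"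
      using ev
    proof eventually_elim
      case (elim \<phi>)
      have "\<bar>K \<phi>\<bar> * \<bar>\<phi> - \<theta>\<bar> = \<bar>H (X \<phi>)\<bar> * \<bar>X \<phi> - X \<theta>\<bar>"
        using HK[of \<phi>] elim by (simp flip: abs_mult)
      also have "\<dots> \<le> \<bar>H (X \<phi>)\<bar> * (L * \<bar>\<phi> - \<theta>\<bar>)"
        by (intro mult_left_mono lip) auto
      finally show ?case
        using elim by (simp flip: mult.assoc)
    qed
  qed simp
  with m(2) show f': "f' \<noteq> 0" by auto
  have "(\<lambda>\<phi>. (X \<phi> - X \<theta>) / (\<phi> - \<theta>)) \<midarrow>\<theta>\<rightarrow> m' / f'"
  proof (rule Lim_transform_eventually[OF tendsto_divide[OF KK HX f']])
    show "\<forall>\<^sub>F \<phi> in at \<theta>. K \<phi> / H (X \<phi>) = (X \<phi> - X \<theta>) / (\<phi> - \<theta>)"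
      using ev tendsto_imp_eventually_ne[OF HX f']
    proof eventually_elim
      case (elim \<phi>)
      then show ?case
        using HK[of \<phi>] by (simp add: field_simps)
    qed
  qed
  then show "(X has_real_derivative m' / f') (at \<theta>)"
    by (simp add: has_field_derivative_iff)
qed

lemma periodic_int:
  fixes f :: "real \<Rightarrow> 'a"
  assumes "\<And>x. f (x + 2 * pi) = f x"
  shows "f (x + of_int k * (2 * pi)) = f x"
proof (induction k rule: int_induct[of _ 0])
  case (step1 i)
  then show ?case using assms[of "x + of_int i * (2 * pi)"] by (simp add: algebra_simps)
next
  case (step2 i)
  then show ?case using assms[of "x + of_int (i - 1) * (2 * pi)"] by (simp add: algebra_simps)
qed simp

lemma angle_reduction: "\<exists>\<phi>\<in>{0..<2 * pi}. \<exists>k::int. \<theta> = \<phi> + of_int k * (2 * pi)"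
proof (intro bexI exI)
  let ?k = "\<lfloor>\<theta> / (2 * pi)\<rfloor>"
  show "\<theta> = (\<theta> - of_int ?k * (2 * pi)) + of_int ?k * (2 * pi)" by simp
  have "of_int ?k * (2 * pi) \<le> \<theta>" "\<theta> < (of_int ?k + 1) * (2 * pi)"
    by (rule floor_divide_lower floor_divide_upper; simp)+
  then show "\<theta> - of_int ?k * (2 * pi) \<in> {0..<2 * pi}" by (simp add: algebra_simps)
qed

context smooth_constant_width
begin

text \<open>In a chart, the boundary point with normal angle \<open>\<theta>\<close> maximises a
  linear functional along the graph of \<open>g\<close>, so the slope at its abscissa
  \<open>X \<theta>\<close> is, up to sign, a cotangent. This has a nonvanishing derivative and
  \<open>X\<close> is Lipschitz, so \<open>implicit_derivative\<close> excludes zeros of the second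
  derivative of \<open>g\<close> and differentiates \<open>X\<close>.\<close>

lemma bd_locally_smooth:
  "\<exists>I. open I \<and> \<theta>0 \<in> I \<and> (\<forall>n. Ck n I bd) \<and> vector_derivative bd (at \<theta>0) \<noteq> 0"
proof -
  let ?p = "bd \<theta>0"
  obtain r u w g where r: "r > 0" and uw: "norm u = 1" "norm w = 1" "u \<bullet> w = 0"
    and g: "smooth_on UNIV (g :: real \<Rightarrow> real)"
    and graph: "\<And>x. x \<in> ball ?p r \<Longrightarrow> x \<in> \<Omega> \<longleftrightarrow> g ((x - ?p) \<bullet> u) < (x - ?p) \<bullet> w"
    using smooth bd_frontier[of \<theta>0] unfolding smooth_boundary_def by blast
  have gCk: "Ck n UNIV g" for n using g by (simp add: smooth_on_iff_Ck)
  define g1 where "g1 = (\<lambda>t. vector_derivative g (at t))"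
  define g2 where "g2 = (\<lambda>t. vector_derivative g1 (at t))"
  have g1: "(g has_real_derivative g1 x) (at x)" for x
    using Ck_Suc_deriv[OF gCk[of "Suc 0"], of x]
    by (simp add: g1_def has_real_derivative_iff_has_vector_derivative)
  have g1Ck: "Ck n UNIV g1" for n using gCk[of "Suc n"] by (simp add: g1_def)
  have g2: "(g1 has_real_derivative g2 x) (at x)" for x
    using Ck_Suc_deriv[OF g1Ck[of "Suc 0"], of x]
    by (simp add: g2_def has_real_derivative_iff_has_vector_derivative)
  have g2Ck: "Ck n UNIV g2" for n using g1Ck[of "Suc n"] by (simp add: g2_def)
  have g_cont: "continuous_on A g" for A
    by (rule continuous_on_subset[OF DERIV_continuous_on[of UNIV g g1]]) (use g1 in auto)
  obtain \<alpha> where u: "u = nrm \<alpha>" using unit_vector_eq_nrm uw(1) by metis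
  have "w = tng \<alpha> \<or> w = - tng \<alpha>"
    by (rule unit_vectors_parallel[of _ _ u]) (use uw u in \<open>auto simp: inner_commute\<close>)
  \<comment> \<open>The chart may have either orientation; \<open>\<sigma>\<close> records
    which.\<close>
  then obtain \<sigma> :: real where \<sigma>: "\<sigma> * \<sigma> = 1" "w = \<sigma> *\<^sub>R tng \<alpha>"
    by (metis mult_1 mult_minus1 minus_minus scaleR_one scaleR_minus1_left)
  have expand: "x = (x \<bullet> u) *\<^sub>R u + (x \<bullet> w) *\<^sub>R w" for x
  proof -
    have "\<sigma> * c * \<sigma> = c" for c
      using \<sigma>(1) by (metis mult.assoc mult.commute mult.right_neutral)
    then show ?thesis
      unfolding u \<sigma>(2) inner_scaleR_right scaleR_scaleR by (simp only:) (rule frame_expansion)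
  qed
  have ww: "w \<bullet> w = 1" "u \<bullet> u = 1" "w \<bullet> u = 0" using uw by (auto simp: norm_eq_1 inner_commute)
  define P where "P = (\<lambda>x. ?p + x *\<^sub>R u + g x *\<^sub>R w)"
  have P_coord: "(P x - ?p) \<bullet> u = x" "(P x - ?p) \<bullet> w = g x" for x
    using uw ww by (simp_all add: P_def inner_add_left)
  have P_closure: "P x \<in> closure \<Omega>" if x: "P x \<in> ball ?p r" for x
    unfolding closure_approachable
  proof (intro allI impI)
    fix e :: real assume e: "e > 0"
    define t where "t = min e (r - dist ?p (P x)) / 2"
    have t: "t > 0" "t < e" "t < r - dist ?p (P x)" using e x by (auto simp: t_def)
    let ?y = "P x + t *\<^sub>R w"
    have y: "dist (P x) ?y = t" using t uw by (simp add: dist_norm)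
    have "?y \<in> ball ?p r"
      using dist_triangle[of ?p ?y "P x"] y t by simp
    moreover have "(?y - ?p) \<bullet> u = x" "(?y - ?p) \<bullet> w = g x + t"
      using P_coord[of x] uw ww by (simp_all add: inner_add_left inner_diff_left)
    ultimately have "?y \<in> \<Omega>" using graph[of ?y] t(1) by simp
    then show "\<exists>y\<in>\<Omega>. dist y (P x) < e" using y t(2) by (intro bexI[of _ ?y]) (simp_all add: dist_commute)
  qed
  define X where "X = (\<lambda>\<theta>. (bd \<theta> - ?p) \<bullet> u)"
  have bd_P: "bd \<theta> = P (X \<theta>)" if \<theta>: "bd \<theta> \<in> ball ?p r" for \<theta>
  proof -
    let ?x = "bd \<theta>"
    have "(?x - ?p) \<bullet> w = g ((?x - ?p) \<bullet> u)"
    proof (rule ccontr)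
      assume "(?x - ?p) \<bullet> w \<noteq> g ((?x - ?p) \<bullet> u)"
      moreover have "?x \<notin> \<Omega>" using bd_frontier by (simp add: frontier_eq)
      ultimately have less: "(?x - ?p) \<bullet> w < g ((?x - ?p) \<bullet> u)" using graph[OF \<theta>] by simp
      \<comment> \<open>Lying strictly below the graph is an open condition that excludes
        \<open>\<Omega>\<close>, so no point of the closure satisfies it.\<close>
      let ?U = "ball ?p r \<inter> {x. (x - ?p) \<bullet> w < g ((x - ?p) \<bullet> u)}"
      have "open ?U"
        by (intro open_Int open_ball open_Collect_less continuous_intros continuous_on_compose2[OF g_cont[of UNIV]]) auto
      moreover have "?x \<in> ?U" using less \<theta> by simp
      ultimately have "?U \<inter> \<Omega> \<noteq> {}"
        using bd_closure open_Int_closure_eq_empty by blast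
      then show False using graph by fastforce
    qed
    then show ?thesis
      using expand[of "?x - ?p"] by (simp add: P_def X_def algebra_simps)
  qed
  define A where "A = bd -` ball ?p r"
  have A: "open A" "\<theta>0 \<in> A"
    using continuous_bd r by (auto simp: A_def intro: open_vimage)
  \<comment> \<open>The first-order condition for the maximum of
    \<open>P x \<bullet> nrm \<theta>\<close> at \<open>x = X \<theta>\<close>.\<close>
  have critical: "cos (\<theta> - \<alpha>) + \<sigma> * sin (\<theta> - \<alpha>) * g1 (X \<theta>) = 0" if "\<theta> \<in> A" for \<theta>
  proof -
    have "continuous_on UNIV P"
      unfolding P_def by (intro continuous_intros g_cont)
    then have "open (P -` ball ?p r)" by (intro open_vimage) auto
    moreover have "X \<theta> \<in> P -` ball ?p r" using that bd_P[of \<theta>] by (simp add: A_def)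
    ultimately obtain d where d: "d > 0" "ball (X \<theta>) d \<subseteq> P -` ball ?p r"
      using open_contains_ball by metis
    have 1: "((\<lambda>x. P x \<bullet> nrm \<theta>) has_real_derivative u \<bullet> nrm \<theta> + g1 (X \<theta>) * (w \<bullet> nrm \<theta>)) (at (X \<theta>))"
      unfolding P_def inner_add_left inner_scaleR_left
      by (auto intro!: derivative_eq_intros g1)
    have "P y \<bullet> nrm \<theta> \<le> P (X \<theta>) \<bullet> nrm \<theta>" if "\<bar>X \<theta> - y\<bar> < d" for y
    proof -
      have "P y \<in> closure \<Omega>" using that d by (intro P_closure) (auto simp: dist_real_def subset_iff)
      then show ?thesis using bd_max[of "P y" \<theta>] bd_P[of \<theta>] \<open>\<theta> \<in> A\<close> by (simp add: A_def)
    qed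
    with DERIV_local_max[OF 1 d(1)] have "u \<bullet> nrm \<theta> + g1 (X \<theta>) * (w \<bullet> nrm \<theta>) = 0" by blast
    moreover have "cos (\<alpha> - \<theta>) = cos (\<theta> - \<alpha>)" "sin (\<alpha> - \<theta>) = - sin (\<theta> - \<alpha>)"
      by (metis cos_minus minus_diff_eq, metis sin_minus minus_diff_eq)
    ultimately show ?thesis
      by (simp add: u \<sigma>(2) mult_ac)
  qed
  \<comment> \<open>The tangent of a graph is never parallel to \<open>w\<close>; hence near
    \<open>\<theta>0\<close> one may divide by the sine.\<close>
  have X0: "sin (\<theta>0 - \<alpha>) \<noteq> 0"
    using critical[OF A(2)] sin_zero_abs_cos_one[of "\<theta>0 - \<alpha>"] by auto
  define I where "I = A \<inter> {\<theta>. sin (\<theta> - \<alpha>) \<noteq> 0}"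
  have I: "open I" "\<theta>0 \<in> I"
    using A X0 by (auto simp: I_def intro!: open_Int open_Collect_neq continuous_intros)
  define m where "m = (\<lambda>\<theta>. - \<sigma> * (cos (\<theta> - \<alpha>) / sin (\<theta> - \<alpha>)))"
  have g1_X: "g1 (X \<theta>) = m \<theta>" if "\<theta> \<in> I" for \<theta>
  proof -
    have s: "sin (\<theta> - \<alpha>) \<noteq> 0" and c: "cos (\<theta> - \<alpha>) = - (\<sigma> * sin (\<theta> - \<alpha>) * g1 (X \<theta>))"
      using that critical[of \<theta>] by (auto simp: I_def)
    show ?thesis
      unfolding m_def c using s \<sigma>(1) by simp
  qed
  define m1 where "m1 = (\<lambda>\<theta>. \<sigma> * (inverse (sin (\<theta> - \<alpha>)) * inverse (sin (\<theta> - \<alpha>))))"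
  have m1: "(m has_real_derivative m1 \<theta>) (at \<theta>)" "m1 \<theta> \<noteq> 0" if "\<theta> \<in> I" for \<theta>
  proof -
    have s: "sin (\<theta> - \<alpha>) \<noteq> 0" using that by (simp add: I_def)
    have "- (sin (\<theta> - \<alpha>) * sin (\<theta> - \<alpha>)) - cos (\<theta> - \<alpha>) * cos (\<theta> - \<alpha>) = - 1"
      using sin_cos_squared_add3[of "\<theta> - \<alpha>"] by linarith
    then have "((\<lambda>\<theta>. cos (\<theta> - \<alpha>) / sin (\<theta> - \<alpha>)) has_real_derivative
        - (inverse (sin (\<theta> - \<alpha>)) * inverse (sin (\<theta> - \<alpha>)))) (at \<theta>)"
      using s
      by (auto intro!: derivative_eq_intros simp: divide_simps)
    from DERIV_cmult[OF this, of "- \<sigma>"] show "(m has_real_derivative m1 \<theta>) (at \<theta>)"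
      by (simp add: m_def m1_def)
    show "m1 \<theta> \<noteq> 0" using s \<sigma>(1) by (auto simp: m1_def)
  qed
  have X_lip: "\<bar>X \<phi> - X \<theta>\<bar> \<le> W * \<bar>\<phi> - \<theta>\<bar>" for \<phi> \<theta>
  proof -
    have "\<bar>X \<phi> - X \<theta>\<bar> = \<bar>(bd \<phi> - bd \<theta>) \<bullet> u\<bar>" by (simp add: X_def inner_diff_left)
    also have "\<dots> \<le> norm (bd \<phi> - bd \<theta>) * norm u" by (rule Cauchy_Schwarz_ineq2)
    also have "\<dots> \<le> W * \<bar>\<phi> - \<theta>\<bar>" using bd_lipschitz_abs uw by simp
    finally show ?thesis .
  qed
  have X1: "g2 (X \<theta>) \<noteq> 0" "(X has_real_derivative m1 \<theta> / g2 (X \<theta>)) (at \<theta>)" if "\<theta> \<in> I" for \<theta>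
    using implicit_derivative[where f = g1 and X = X and m = m, OF I(1) that g1_X g2 m1[OF that] X_lip]
    by simp_all
  have sCk: "Ck n I (\<lambda>\<theta>. inverse (sin (\<theta> + (- \<alpha>))))" for n
  proof (rule Ck_inverse[OF I(1)])
    have "Ck n I (\<lambda>\<theta>. \<theta> + (- \<alpha>))"
      by (intro Ck_add Ck_id Ck_const I(1))
    then show "Ck n I (\<lambda>\<theta>. sin (\<theta> + (- \<alpha>)))"
      by (rule Ck_compose[OF I(1) UNIV_I conjunct2[OF Ck_cos_sin]])
  qed (simp add: I_def)
  \<comment> \<open>Bootstrap: the derivative of \<open>X\<close> is a smooth expression in
    \<open>X\<close> itself, so every step gains one order.\<close>
  have XCk: "Ck n I X" for n
  proof (induction n)
    case (Suc n)
    show ?case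
    proof (rule Ck_SucI[OF I(1)])
      fix \<theta> assume \<theta>: "\<theta> \<in> I"
      show "(X has_vector_derivative m1 \<theta> * inverse (g2 (X \<theta>))) (at \<theta>)"
        using X1(2)[OF \<theta>] by (simp add: has_real_derivative_iff_has_vector_derivative field_simps)
    next
      have "Ck n I m1"
        using Ck_mult[OF I(1) Ck_const Ck_mult[OF I(1) sCk sCk], of n \<sigma>] I(1) by (simp add: m1_def)
      then show "Ck n I (\<lambda>\<theta>. m1 \<theta> * inverse (g2 (X \<theta>)))"
        by (intro Ck_mult Ck_inverse Ck_compose[OF I(1) UNIV_I g2Ck Suc] I(1)) (use X1(1) in auto)
    qed
  qed simp
  have bdCk: "Ck n I bd" for n
  proof (rule Ck_cong[OF I(1)])
    show "P (X \<theta>) = bd \<theta>" if "\<theta> \<in> I" for \<theta>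
      using bd_P[of \<theta>] that by (simp add: I_def A_def)
    show "Ck n I (\<lambda>\<theta>. P (X \<theta>))"
      unfolding P_def
      by (intro Ck_add Ck_scaleR Ck_const Ck_compose[OF I(1) UNIV_I gCk XCk] XCk I(1))
  qed
  have "vector_derivative bd (at \<theta>0) \<noteq> 0"
  proof
    assume 0: "vector_derivative bd (at \<theta>0) = 0"
    have "(bd has_vector_derivative 0) (at \<theta>0)"
      using Ck_Suc_deriv[OF bdCk[of "Suc 0"] I(2)] 0 by simp
    then have "(X has_real_derivative 0) (at \<theta>0)"
      unfolding X_def has_vector_derivative_def has_field_derivative_def
      by (auto intro!: derivative_eq_intros)
    from DERIV_unique[OF this X1(2)[OF I(2)]] m1(2)[OF I(2)] X1(1)[OF I(2)] show False by simp
  qed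
  with I bdCk show ?thesis by blast
qed

text \<open>The radius of curvature: the signed speed of a curve parametrised by the angle of its
  normal.\<close>

definition rad :: "real \<Rightarrow> real" where
  "rad \<theta> = vector_derivative bd (at \<theta>) \<bullet> tng \<theta>"

lemma Ck_bd: "Ck n UNIV bd"
  by (rule Ck_locally) (use bd_locally_smooth in blast)

text \<open>Along the curve, the fixed functional \<open>nrm \<theta>\<close> is maximal at
  parameter \<open>\<theta>\<close>, so the velocity has no normal component there.\<close>

lemma bd_has_vector_derivative: "(bd has_vector_derivative rad \<theta> *\<^sub>R tng \<theta>) (at \<theta>)"
proof -
  let ?D = "vector_derivative bd (at \<theta>)"
  have D: "(bd has_vector_derivative ?D) (at \<theta>)"
    using Ck_Suc_deriv[OF Ck_bd[of "Suc 0"]] by simp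
  then have "((\<lambda>t. bd t \<bullet> nrm \<theta>) has_real_derivative ?D \<bullet> nrm \<theta>) (at \<theta>)"
    unfolding has_vector_derivative_def has_field_derivative_def
    by (auto intro!: derivative_eq_intros)
  from DERIV_local_max[OF this zero_less_one] have "?D \<bullet> nrm \<theta> = 0"
    using bd_max bd_closure by blast
  then have "?D = rad \<theta> *\<^sub>R tng \<theta>"
    using frame_expansion[of ?D \<theta>] by (simp add: rad_def)
  with D show ?thesis by simp
qed

lemma rad_neq_0: "rad \<theta> \<noteq> 0"
proof
  assume "rad \<theta> = 0"
  then have "vector_derivative bd (at \<theta>) = 0"
    using vector_derivative_at[OF bd_has_vector_derivative[of \<theta>]] by simp
  then show False using bd_locally_smooth by blast
qed

text \<open>The derivative of \<open>bd_add_pi\<close>; the sign of \<open>rad\<close> on the right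
  comes from \<open>tng\<close> being reversed by a half-turn.\<close>

lemma rad_add_pi: "rad (\<theta> + pi) = W - rad \<theta>"
proof -
  have "((\<lambda>t. t + pi) has_vector_derivative 1) (at \<theta>)"
    by (auto intro!: derivative_eq_intros)
  then have "((\<lambda>t. bd (t + pi)) has_vector_derivative 1 *\<^sub>R (rad (\<theta> + pi) *\<^sub>R tng (\<theta> + pi))) (at \<theta>)"
    using vector_diff_chain_at[of "\<lambda>t. t + pi" 1 \<theta> bd, OF _ bd_has_vector_derivative]
    by (simp add: o_def)
  moreover have "((\<lambda>t. bd (t + pi)) has_vector_derivative (rad \<theta> *\<^sub>R tng \<theta> - W *\<^sub>R tng \<theta>)) (at \<theta>)"
    unfolding bd_add_pi
    by (auto intro!: derivative_eq_intros bd_has_vector_derivative nrm_has_vector_derivative)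
  ultimately have "1 *\<^sub>R (rad (\<theta> + pi) *\<^sub>R tng (\<theta> + pi)) = rad \<theta> *\<^sub>R tng \<theta> - W *\<^sub>R tng \<theta>"
    by (rule vector_derivative_unique_at)
  then have "- rad (\<theta> + pi) *\<^sub>R tng \<theta> = (rad \<theta> - W) *\<^sub>R tng \<theta>"
    by (simp add: scaleR_diff_left)
  then have "- rad (\<theta> + pi) = rad \<theta> - W"
    by (metis nrm_neq_0(2) scaleR_cancel_right)
  then show ?thesis by simp
qed

lemma rad_le: "rad \<theta> \<le> W"
proof -
  have "((\<lambda>t. bd t \<bullet> tng \<theta>) has_real_derivative rad \<theta>) (at \<theta>)"
    using bd_has_vector_derivative[of \<theta>]
    unfolding has_vector_derivative_def has_field_derivative_def
    by (auto intro!: derivative_eq_intros)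
  then have "(\<lambda>t. (bd t \<bullet> tng \<theta> - bd \<theta> \<bullet> tng \<theta>) / (t - \<theta>)) \<midarrow>\<theta>\<rightarrow> rad \<theta>"
    by (simp add: has_field_derivative_iff)
  moreover have "(bd t \<bullet> tng \<theta> - bd \<theta> \<bullet> tng \<theta>) / (t - \<theta>) \<le> W" if "t \<noteq> \<theta>" for t
  proof -
    have "\<bar>(bd t - bd \<theta>) \<bullet> tng \<theta>\<bar> \<le> W * \<bar>t - \<theta>\<bar>"
      using Cauchy_Schwarz_ineq2[of "bd t - bd \<theta>" "tng \<theta>"] bd_lipschitz_abs[of t \<theta>] by simp
    then have "\<bar>(bd t \<bullet> tng \<theta> - bd \<theta> \<bullet> tng \<theta>) / (t - \<theta>)\<bar> \<le> W"
      using that by (simp add: inner_diff_left abs_divide pos_divide_le_eq)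
    then show ?thesis by (rule abs_le_D1)
  qed
  ultimately show ?thesis
    by (intro tendsto_upperbound[of _ "rad \<theta>" "at \<theta>" W]) (auto simp: eventually_at_filter)
qed

text \<open>The bound \<open>W\<close> at the opposite point gives nonnegativity here, and
  smoothness of the boundary excludes zero.\<close>

lemma rad_pos: "rad \<theta> > 0"
  using rad_le[of "\<theta> + pi"] rad_neq_0[of \<theta>] by (simp add: rad_add_pi)

lemma continuous_rad: "continuous_on UNIV rad"
proof -
  have "(\<lambda>t. vector_derivative bd (at t)) differentiable (at t)" for t
    using Ck_bd[of "Suc (Suc 0)"] by simp
  then have "continuous_on UNIV (\<lambda>t. vector_derivative bd (at t))"
    by (simp add: continuous_at_imp_continuous_on differentiable_imp_continuous_within)
  then show ?thesis
    unfolding rad_def[abs_def] by (intro continuous_intros)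
qed

lemma rad_add_2pi: "rad (\<theta> + 2 * pi) = rad \<theta>"
  using rad_add_pi[of "\<theta> + pi"] rad_add_pi[of \<theta>] by (simp add: add.assoc)

lemma ex_rad_bound: "\<exists>\<delta>>0. \<forall>\<theta>. \<delta> \<le> rad \<theta>"
proof -
  have "\<exists>x\<in>{0..2 * pi}. \<forall>y\<in>{0..2 * pi}. rad x \<le> rad y"
    by (rule continuous_attains_inf) (auto intro: continuous_on_subset[OF continuous_rad])
  then obtain \<theta>0 where th: "\<And>\<theta>. \<theta> \<in> {0..2 * pi} \<Longrightarrow> rad \<theta>0 \<le> rad \<theta>"
    by blast
  have "rad \<theta>0 \<le> rad \<theta>" for \<theta>
  proof -
    obtain \<phi> k where "\<phi> \<in> {0..<2 * pi}" "\<theta> = \<phi> + of_int k * (2 * pi)"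
      using angle_reduction[of \<theta>] by blast
    then show ?thesis
      using periodic_int[of rad \<phi> k] th[of \<phi>] by (simp add: rad_add_2pi)
  qed
  then show ?thesis using rad_pos by blast
qed

end

section \<open>The billiard ball map of a constant width domain\<close>

lemma unit_add_norm:
  fixes u n :: "'a::real_inner"
  assumes "norm n = 1"
  shows "(norm (u + c *\<^sub>R n))\<^sup>2 = (norm u)\<^sup>2 + 2 * c * (u \<bullet> n) + c\<^sup>2"
proof -
  have "n \<bullet> n = 1" using assms by (simp add: norm_eq_1)
  then show ?thesis
    by (simp add: power2_norm_eq_inner inner_add_left inner_add_right inner_commute)
      (simp add: power2_eq_square)
qed

context smooth_constant_width
begin

definition rmin :: real where
  "rmin = (SOME \<delta>. \<delta> > 0 \<and> (\<forall>\<theta>. \<delta> \<le> rad \<theta>))"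

lemma rmin_pos: "rmin > 0" and rmin_le: "rmin \<le> rad \<theta>"
  using someI_ex[of "\<lambda>\<delta>. \<delta> > 0 \<and> (\<forall>\<theta>. \<delta> \<le> rad \<theta>)"] ex_rad_bound unfolding rmin_def by auto

text \<open>The curve \<open>bd - rmin * nrm\<close> has nonnegative curvature radii, hence still bounds a convex set.\<close>

lemma support_gap: "rmin * (1 - cos (b - a)) \<le> (bd b - bd a) \<bullet> nrm b"
proof -
  \<comment> \<open>As a function of \<open>a\<close> this vanishes at \<open>b\<close>, and the
    sign of its derivative makes it grow away from \<open>b\<close> on both sides up to the opposite
    angle. Periodicity covers all other angles.\<close>
  define f where "f = (\<lambda>a. (bd b - bd a) \<bullet> nrm b - rmin * (1 - cos (b - a)))"
  have D: "(f has_real_derivative (rad a - rmin) * sin (a - b)) (at a)" for a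
  proof -
    have "((\<lambda>a. bd a \<bullet> nrm b) has_real_derivative (rad a *\<^sub>R tng a) \<bullet> nrm b) (at a)"
      using bd_has_vector_derivative[of a]
      unfolding has_vector_derivative_def has_field_derivative_def
      by (auto intro!: derivative_eq_intros)
    moreover have "sin (b - a) = - sin (a - b)"
      by (metis minus_diff_eq sin_minus)
    ultimately show ?thesis
      unfolding f_def inner_diff_left
      by (auto intro!: derivative_eq_intros simp: algebra_simps)
  qed
  have f_b: "f b = 0" by (simp add: f_def)
  have right: "f a \<ge> 0" if "b \<le> a" "a \<le> b + pi" for a
  proof -
    have "f b \<le> f a"
    proof (rule DERIV_nonneg_imp_nondecreasing[OF that(1)])
      fix x assume "b \<le> x" "x \<le> a"
      then have "0 \<le> (rad x - rmin) * sin (x - b)"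
        using that rmin_le[of x] by (intro mult_nonneg_nonneg sin_ge_zero) auto
      with D[of x] show "\<exists>y. (f has_real_derivative y) (at x) \<and> 0 \<le> y" by blast
    qed
    with f_b show ?thesis by simp
  qed
  have left: "f a \<ge> 0" if "a \<le> b" "b - pi \<le> a" for a
  proof -
    have "f b \<le> f a"
    proof (rule DERIV_nonpos_imp_nonincreasing[OF that(1)])
      fix x assume "a \<le> x" "x \<le> b"
      then have "0 \<le> (rad x - rmin) * sin (b - x)"
        using that rmin_le[of x] by (intro mult_nonneg_nonneg sin_ge_zero) auto
      moreover have "sin (b - x) = - sin (x - b)"
        by (metis minus_diff_eq sin_minus)
      ultimately show "\<exists>y. (f has_real_derivative y) (at x) \<and> y \<le> 0" using D[of x] by auto
    qed
    with f_b show ?thesis by simp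
  qed
  obtain \<psi> k where \<psi>: "\<psi> \<in> {0..<2 * pi}" "a - b = \<psi> + of_int k * (2 * pi)"
    using angle_reduction[of "a - b"] by blast
  have per: "f (x + 2 * pi) = f x" for x
    using cos_periodic[of "b - (x + 2 * pi)"] by (simp add: f_def)
  have "a = (b + \<psi>) + of_int k * (2 * pi)" using \<psi>(2) by simp
  then have a: "f a = f (b + \<psi>)"
    using periodic_int[of f "b + \<psi>" k] per by simp
  have "f (b + \<psi>) \<ge> 0"
  proof (cases "\<psi> \<le> pi")
    case True
    then show ?thesis using \<psi> by (intro right) auto
  next
    case False
    then have "f (b + \<psi> - 2 * pi) \<ge> 0" using \<psi> by (intro left) auto
    then show ?thesis using per[of "b + \<psi> - 2 * pi"] by simp
  qed
  with a show ?thesis by (simp add: f_def)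
qed

text \<open>Geometrically: no boundary point enters the open disc of radius \<open>rmin\<close>
  touching at \<open>bd a\<close> from inside. The distance of \<open>bd b\<close> from the centre
  is bounded below by its component along \<open>nrm b\<close>.\<close>

lemma inner_disc: "2 * rmin * ((bd a - bd b) \<bullet> nrm a) \<le> (norm (bd b - bd a))\<^sup>2"
proof -
  have "cos (b - a) = nrm a \<bullet> nrm b" by (simp add: cos_diff)
  then have "rmin \<le> ((bd b - bd a) + rmin *\<^sub>R nrm a) \<bullet> nrm b"
    using support_gap[of b a] by (simp add: inner_add_left algebra_simps)
  also have "\<dots> \<le> norm ((bd b - bd a) + rmin *\<^sub>R nrm a)"
    using norm_cauchy_schwarz[of _ "nrm b"] by simp
  finally have "rmin\<^sup>2 \<le> (norm ((bd b - bd a) + rmin *\<^sub>R nrm a))\<^sup>2"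
    using rmin_pos by (intro power_mono) auto
  then show ?thesis
    by (simp add: unit_add_norm inner_diff_left right_diff_distrib)
qed

text \<open>Symmetrised \<open>support_gap\<close>. It makes the normal a Lipschitz function of the
  boundary point, the counterpart of \<open>bd_lipschitz\<close>.\<close>

lemma bd_lower_lipschitz: "rmin * norm (nrm a - nrm b) \<le> norm (bd a - bd b)"
proof (cases "nrm a = nrm b")
  case False
  have "cos (a - b) = cos (b - a)" by (metis cos_minus minus_diff_eq)
  then have "rmin * (norm (nrm a - nrm b))\<^sup>2 \<le> (bd a - bd b) \<bullet> (nrm a - nrm b)"
    using support_gap[of a b] support_gap[of b a]
    by (simp add: power2_norm_eq_inner inner_diff_left inner_diff_right algebra_simps)
  also have "\<dots> \<le> norm (bd a - bd b) * norm (nrm a - nrm b)"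
    by (rule norm_cauchy_schwarz)
  finally show ?thesis using False by (simp add: power2_eq_square)
qed simp

lemma bd_eq_iff: "bd a = bd b \<longleftrightarrow> nrm a = nrm b"
proof
  assume "bd a = bd b"
  then show "nrm a = nrm b"
    using bd_lower_lipschitz[of a b] rmin_pos by (simp add: mult_le_0_iff)
qed (rule bd_nrm_cong)

lemma in_closure_iff: "x \<in> closure \<Omega> \<longleftrightarrow> (\<forall>\<phi>. x \<bullet> nrm \<phi> \<le> bd \<phi> \<bullet> nrm \<phi>)"
proof (intro iffI allI)
  assume x: "\<forall>\<phi>. x \<bullet> nrm \<phi> \<le> bd \<phi> \<bullet> nrm \<phi>"
  show "x \<in> closure \<Omega>"
  proof (rule ccontr)
    assume "x \<notin> closure \<Omega>"
    then obtain a b where ab: "a \<bullet> x < b" "\<And>y. y \<in> closure \<Omega> \<Longrightarrow> a \<bullet> y > b"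
      using separating_hyperplane_closed_point[OF convex_closure_dom closed_closure] by blast
    have "a \<noteq> 0" using ab(1) ab(2)[OF bd_closure] by auto
    then have "norm (- a /\<^sub>R norm a) = 1" by simp
    then obtain \<phi> where \<phi>: "- a /\<^sub>R norm a = nrm \<phi>"
      using unit_vector_eq_nrm by metis
    have "a \<bullet> y = - norm a * (y \<bullet> nrm \<phi>)" for y
      unfolding \<phi>[symmetric] using \<open>a \<noteq> 0\<close> by (simp add: inner_commute)
    then have "a \<bullet> bd \<phi> \<le> a \<bullet> x"
      using x by (simp add: mult_left_mono)
    with ab(1) ab(2)[OF bd_closure[of \<phi>]] show False by simp
  qed
qed (rule bd_max)

text \<open>By \<open>support_gap\<close> the support function of the disc lies below that of
  \<open>\<Omega>\<close>, so the disc is in the closure; being open, it is in the interior of the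
  closure, which is \<open>\<Omega>\<close> by convexity.\<close>

lemma inner_ball: "ball (bd a - rmin *\<^sub>R nrm a) rmin \<subseteq> \<Omega>"
proof -
  have "x \<in> closure \<Omega>" if x: "x \<in> ball (bd a - rmin *\<^sub>R nrm a) rmin" for x
    unfolding in_closure_iff
  proof
    fix \<phi>
    have "(x - (bd a - rmin *\<^sub>R nrm a)) \<bullet> nrm \<phi> \<le> norm (x - (bd a - rmin *\<^sub>R nrm a))"
      using norm_cauchy_schwarz[of _ "nrm \<phi>"] by simp
    also have "\<dots> \<le> rmin" using x by (simp add: dist_norm norm_minus_commute)
    finally have "x \<bullet> nrm \<phi> - bd a \<bullet> nrm \<phi> + rmin * cos (a - \<phi>) \<le> rmin"
      by (simp add: inner_diff_left)
    moreover have "cos (a - \<phi>) = cos (\<phi> - a)" by (metis cos_minus minus_diff_eq)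
    ultimately show "x \<bullet> nrm \<phi> \<le> bd \<phi> \<bullet> nrm \<phi>"
      using support_gap[of \<phi> a] by (simp add: inner_diff_left algebra_simps)
  qed
  then have "ball (bd a - rmin *\<^sub>R nrm a) rmin \<subseteq> interior (closure \<Omega>)"
    by (intro interior_maximal) auto
  then show ?thesis by (simp add: interior_closure_dom)
qed

text \<open>The bound on \<open>t\<close> is the length of the chord that the inner disc cuts out of
  the ray.\<close>

lemma inward_ray:
  assumes "norm v = 1" "0 < t" "t < - 2 * rmin * (v \<bullet> nrm a)"
  shows "bd a + t *\<^sub>R v \<in> \<Omega>"
proof -
  have "(norm (t *\<^sub>R v + rmin *\<^sub>R nrm a))\<^sup>2 = t * (t + 2 * rmin * (v \<bullet> nrm a)) + rmin\<^sup>2"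
    unfolding unit_add_norm[OF norm_frame(1)]
    using assms(1,2) by (simp add: algebra_simps power2_eq_square)
  also have "\<dots> < rmin\<^sup>2"
    using assms by (simp add: mult_less_0_iff)
  finally have "norm (t *\<^sub>R v + rmin *\<^sub>R nrm a) < rmin"
    by (rule power2_less_imp_less) (use rmin_pos in simp)
  moreover have "bd a - rmin *\<^sub>R nrm a - (bd a + t *\<^sub>R v) = - (t *\<^sub>R v + rmin *\<^sub>R nrm a)"
    by simp
  ultimately have "bd a + t *\<^sub>R v \<in> ball (bd a - rmin *\<^sub>R nrm a) rmin"
    by (simp only: mem_ball dist_norm norm_minus_cancel)
  then show ?thesis using inner_ball by blast
qed

lemma ray_interior:
  assumes v: "norm v = 1" "v \<bullet> nrm a < 0" and t: "0 < t" "t < t'" and y: "bd a + t' *\<^sub>R v \<in> closure \<Omega>"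
  shows "bd a + t *\<^sub>R v \<in> \<Omega>"
proof -
  \<comment> \<open>A parameter before \<open>t\<close> at which the ray is still in the inner disc;
    from this interior point convexity takes over.\<close>
  define s where "s = min (t / 2) (- rmin * (v \<bullet> nrm a))"
  have "0 < - (rmin * (v \<bullet> nrm a))" using v rmin_pos by (simp add: mult_pos_neg)
  then have s: "0 < s" "s < t" "s < - 2 * rmin * (v \<bullet> nrm a)"
    using t by (auto simp: s_def min_def)
  have "bd a + s *\<^sub>R v \<in> interior \<Omega>"
    using inward_ray[OF v(1) s(1,3)] open_dom by (simp add: interior_open)
  from in_interior_closure_convex_segment[OF convex_dom this y]
  have "open_segment (bd a + s *\<^sub>R v) (bd a + t' *\<^sub>R v) \<subseteq> \<Omega>"
    using open_dom by (simp add: interior_open)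
  moreover have "bd a + t *\<^sub>R v \<in> open_segment (bd a + s *\<^sub>R v) (bd a + t' *\<^sub>R v)"
    unfolding in_segment
  proof (intro conjI exI[of _ "(t - s) / (t' - s)"])
    show "bd a + s *\<^sub>R v \<noteq> bd a + t' *\<^sub>R v" using v s t by auto
    define u where "u = (t - s) / (t' - s)"
    have "u * (t' - s) = t - s" using s t by (simp add: u_def)
    then have t_eq: "t = (1 - u) * s + u * t'" by (simp add: algebra_simps)
    have "(1 - u) *\<^sub>R (bd a + s *\<^sub>R v) + u *\<^sub>R (bd a + t' *\<^sub>R v) = bd a + ((1 - u) * s + u * t') *\<^sub>R v"
      by (simp add: algebra_simps)
    then show "bd a + t *\<^sub>R v = (1 - (t - s) / (t' - s)) *\<^sub>R (bd a + s *\<^sub>R v) + ((t - s) / (t' - s)) *\<^sub>R (bd a + t' *\<^sub>R v)"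
      unfolding u_def[symmetric] t_eq[symmetric] by simp
  qed (use s t in auto)
  ultimately show ?thesis by blast
qed

text \<open>The singleton form evaluates the infimum in \<open>segment_length\<close> and makes the
  next hit unique.\<close>

lemma ex_chord:
  assumes v: "norm v = 1" "v \<bullet> nrm a < 0"
  shows "\<exists>l>0. {t. 0 < t \<and> bd a + t *\<^sub>R v \<in> frontier \<Omega>} = {l}"
proof -
  define s where "s = - rmin * (v \<bullet> nrm a)"
  have s: "0 < s" "s < - 2 * rmin * (v \<bullet> nrm a)"
    using v rmin_pos by (auto simp: s_def mult_pos_neg)
  have "bd a + s *\<^sub>R v \<in> interior \<Omega>" "v \<noteq> 0"
    using inward_ray[OF v(1) s] open_dom v by (auto simp: interior_open)
  then obtain d where d: "d > 0" "bd a + s *\<^sub>R v + d *\<^sub>R v \<in> frontier \<Omega>"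
    by (rule ray_to_frontier[OF bounded_dom])
  have fr: "bd a + (s + d) *\<^sub>R v \<in> frontier \<Omega>" using d(2) by (simp add: algebra_simps)
  have "t = s + d" if "0 < t" "bd a + t *\<^sub>R v \<in> frontier \<Omega>" for t
    using ray_interior[OF v, of t "s + d"] ray_interior[OF v, of "s + d" t] that fr s(1) d(1)
    by (metis DiffE add_pos_pos frontier_eq linorder_neqE_linordered_idom)
  with fr s(1) d(1) show ?thesis by (intro exI[of _ "s + d"]) auto
qed

section \<open>Tangent lines, inner normals and the co-ball bundle along the boundary\<close>

lemma tangent_space_frontier: "tangent_space (frontier \<Omega>) (bd \<theta>) = {v. v \<bullet> nrm \<theta> = 0}"
proof (intro subset_antisym subsetI)
  fix v assume "v \<in> tangent_space (frontier \<Omega>) (bd \<theta>)"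
  then obtain c e where c: "0 < e" "c ` {-e<..<e} \<subseteq> frontier \<Omega>" "c 0 = bd \<theta>"
      "(c has_vector_derivative v) (at 0)"
    by (auto simp: tangent_space_def)
  have D: "((\<lambda>t. c t \<bullet> nrm \<theta>) has_real_derivative v \<bullet> nrm \<theta>) (at 0)"
    using c(4) unfolding has_vector_derivative_def has_field_derivative_def
    by (auto intro!: derivative_eq_intros)
  have "c t \<bullet> nrm \<theta> \<le> c 0 \<bullet> nrm \<theta>" if "\<bar>0 - t\<bar> < e" for t
  proof -
    have "c t \<in> frontier \<Omega>" using c(2) that by (auto simp: abs_less_iff)
    then show ?thesis using bd_max c(3) by (simp add: frontier_eq)
  qed
  with DERIV_local_max[OF D c(1)] show "v \<in> {v. v \<bullet> nrm \<theta> = 0}" by simp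
next
  fix v assume "v \<in> {v. v \<bullet> nrm \<theta> = 0}"
  then obtain s where v: "v = s *\<^sub>R tng \<theta>"
    using frame_expansion[of v \<theta>] by auto
  \<comment> \<open>Running through the angle at speed \<open>s / rad \<theta>\<close> gives the
    boundary point the velocity \<open>s *\<^sub>R tng \<theta>\<close>.\<close>
  define h where "h = (\<lambda>t. \<theta> + (s / rad \<theta>) * t)"
  have "Ck n {-1<..<1} (\<lambda>t. bd (h t))" for n
    unfolding h_def
    by (rule Ck_compose[OF _ UNIV_I Ck_bd], simp, intro Ck_add Ck_mult Ck_const Ck_id, simp_all)
  then have "smooth_on {-1<..<1} (\<lambda>t. bd (h t))"
    by (simp add: smooth_on_iff_Ck)
  moreover have "((\<lambda>t. bd (h t)) has_vector_derivative v) (at 0)"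
  proof -
    have "(h has_vector_derivative s / rad \<theta>) (at 0)"
      unfolding h_def by (auto intro!: derivative_eq_intros)
    from vector_diff_chain_at[OF this bd_has_vector_derivative]
    show ?thesis using rad_pos[of \<theta>] by (simp add: o_def h_def v)
  qed
  ultimately show "v \<in> tangent_space (frontier \<Omega>) (bd \<theta>)"
    unfolding tangent_space_def
    by (intro CollectI exI[of _ "\<lambda>t. bd (h t)"] exI[of _ "1::real"])
      (use bd_frontier in \<open>auto simp: h_def\<close>)
qed

lemma inner_normal_bd: "inner_normal \<Omega> (bd \<theta>) = - nrm \<theta>"
  unfolding inner_normal_def
proof (rule the_equality)
  have "bd \<theta> + t *\<^sub>R (- nrm \<theta>) \<in> \<Omega>" if "0 < t" "t < 2 * rmin" for t
    using that by (intro inward_ray) auto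
  then have "\<forall>\<^sub>F t in at_right 0. bd \<theta> + t *\<^sub>R (- nrm \<theta>) \<in> \<Omega>"
    unfolding eventually_at_right_field using rmin_pos
    by (intro exI[of _ "2 * rmin"]) auto
  then show "norm (- nrm \<theta>) = 1 \<and> (\<forall>v\<in>tangent_space (frontier \<Omega>) (bd \<theta>). - nrm \<theta> \<bullet> v = 0) \<and>
      (\<forall>\<^sub>F t in at_right 0. bd \<theta> + t *\<^sub>R (- nrm \<theta>) \<in> \<Omega>)"
    by (simp add: tangent_space_frontier inner_commute)
next
  fix \<nu> assume \<nu>: "norm \<nu> = 1 \<and> (\<forall>v\<in>tangent_space (frontier \<Omega>) (bd \<theta>). \<nu> \<bullet> v = 0) \<and>
      (\<forall>\<^sub>F t in at_right 0. bd \<theta> + t *\<^sub>R \<nu> \<in> \<Omega>)"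
  then have "\<nu> \<bullet> tng \<theta> = 0" by (simp add: tangent_space_frontier)
  then have "\<nu> = nrm \<theta> \<or> \<nu> = - nrm \<theta>"
    using \<nu> by (intro unit_vectors_parallel[of _ _ "tng \<theta>"]) auto
  moreover have "\<nu> \<noteq> nrm \<theta>"
  proof
    assume "\<nu> = nrm \<theta>"
    with \<nu> obtain b where b: "b > 0" "\<And>t. 0 < t \<Longrightarrow> t < b \<Longrightarrow> bd \<theta> + t *\<^sub>R nrm \<theta> \<in> \<Omega>"
      unfolding eventually_at_right_field by blast
    then have "bd \<theta> + (b / 2) *\<^sub>R nrm \<theta> \<in> \<Omega>" by simp
    then have "bd \<theta> + (b / 2) *\<^sub>R nrm \<theta> \<in> closure \<Omega>"
      using closure_subset by blast
    from bd_max[OF this, of \<theta>] b(1) show False by (simp add: inner_add_left)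
  qed
  ultimately show "\<nu> = - nrm \<theta>" by blast
qed

lemma coball_iff: "z \<in> coball_bundle \<Omega> \<longleftrightarrow> (\<exists>\<theta>. fst z = bd \<theta> \<and> snd z \<bullet> nrm \<theta> = 0 \<and> norm (snd z) < 1)"
proof (cases z)
  case (Pair q \<xi>)
  have "q \<in> frontier \<Omega> \<longleftrightarrow> (\<exists>\<theta>. q = bd \<theta>)"
    using range_bd by blast
  then show ?thesis
    unfolding Pair coball_bundle_def by (auto simp: tangent_space_frontier)
qed

lemma direction_bd:
  assumes "fst z = bd a"
  shows "direction \<Omega> z = snd z - sqrt (1 - (norm (snd z))\<^sup>2) *\<^sub>R nrm a"
  using assms by (cases z) (simp add: inner_normal_bd)

lemma direction_props:
  assumes "fst z = bd a" "snd z \<bullet> nrm a = 0" "norm (snd z) < 1"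
  shows "norm (direction \<Omega> z) = 1" "direction \<Omega> z \<bullet> nrm a = - sqrt (1 - (norm (snd z))\<^sup>2)"
    "direction \<Omega> z \<bullet> nrm a < 0"
proof -
  have less: "(norm (snd z))\<^sup>2 < 1" using assms(3) by (simp add: power_less_one_iff abs_square_less_1)
  have "(norm (direction \<Omega> z))\<^sup>2 = 1"
    unfolding direction_bd[OF assms(1)]
    using unit_add_norm[OF norm_frame(1), of "snd z" "- sqrt (1 - (norm (snd z))\<^sup>2)" a] assms(2) less by simp
  then show "norm (direction \<Omega> z) = 1" using norm_ge_zero[of "direction \<Omega> z"] unfolding power2_eq_1_iff by linarith
  show *: "direction \<Omega> z \<bullet> nrm a = - sqrt (1 - (norm (snd z))\<^sup>2)"
    unfolding direction_bd[OF assms(1)] using assms(2) by (simp add: inner_diff_left)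
  show "direction \<Omega> z \<bullet> nrm a < 0"
    unfolding * using less by simp
qed

section \<open>One step of the billiard ball map\<close>

lemma segment_length_props:
  assumes "z \<in> coball_bundle \<Omega>"
  shows "segment_length \<Omega> z > 0" "fst z + segment_length \<Omega> z *\<^sub>R direction \<Omega> z \<in> frontier \<Omega>"
    "\<And>t. 0 < t \<Longrightarrow> fst z + t *\<^sub>R direction \<Omega> z \<in> frontier \<Omega> \<Longrightarrow> segment_length \<Omega> z = t"
proof -
  obtain a where a: "fst z = bd a" "snd z \<bullet> nrm a = 0" "norm (snd z) < 1"
    using assms coball_iff by blast
  obtain l where l: "l > 0" "{t. 0 < t \<and> fst z + t *\<^sub>R direction \<Omega> z \<in> frontier \<Omega>} = {l}"
    using ex_chord[OF direction_props(1,3)[OF a]] a(1) by auto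
  have sl: "segment_length \<Omega> z = l" unfolding segment_length_def l(2) by simp
  show "segment_length \<Omega> z > 0" using sl l(1) by simp
  have "l \<in> {t. 0 < t \<and> fst z + t *\<^sub>R direction \<Omega> z \<in> frontier \<Omega>}"
    unfolding l(2) by (rule singletonI)
  then show "fst z + segment_length \<Omega> z *\<^sub>R direction \<Omega> z \<in> frontier \<Omega>"
    unfolding sl by simp
  fix t assume "0 < t" "fst z + t *\<^sub>R direction \<Omega> z \<in> frontier \<Omega>"
  then have "t \<in> {t. 0 < t \<and> fst z + t *\<^sub>R direction \<Omega> z \<in> frontier \<Omega>}"
    by (intro CollectI conjI)
  then show "segment_length \<Omega> z = t"
    unfolding l(2) sl by (rule singletonD[symmetric])
qed

text \<open>Arrival is transversal: by the outer disc the squared length of the chord is at most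
  \<open>2 * W\<close> times its component along the normal of arrival. This keeps the image inside
  the open bundle, and the sign fixes the square root in the reflected direction.\<close>

lemma billiard_step:
  assumes "z \<in> coball_bundle \<Omega>" "fst (billiard_map \<Omega> z) = bd b"
  defines "v \<equiv> direction \<Omega> z"
  shows "bd b = fst z + segment_length \<Omega> z *\<^sub>R v" "v \<bullet> nrm b > 0"
    "snd (billiard_map \<Omega> z) = v - (v \<bullet> nrm b) *\<^sub>R nrm b"
    "billiard_map \<Omega> z \<in> coball_bundle \<Omega>"
    "direction \<Omega> (billiard_map \<Omega> z) = v - (2 * (v \<bullet> nrm b)) *\<^sub>R nrm b"
proof -
  let ?l = "segment_length \<Omega> z"
  obtain a where a: "fst z = bd a" "snd z \<bullet> nrm a = 0" "norm (snd z) < 1"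
    using assms(1) coball_iff by blast
  have v1: "norm v = 1" using direction_props[OF a] by (simp add: v_def)
  show b: "bd b = fst z + ?l *\<^sub>R v"
    using assms(2) by (simp add: billiard_map_def Let_def v_def)
  show snd: "snd (billiard_map \<Omega> z) = v - (v \<bullet> nrm b) *\<^sub>R nrm b"
    unfolding billiard_map_def Let_def v_def[symmetric] b[symmetric] by (simp add: inner_normal_bd)
  have l: "?l > 0" using segment_length_props(1)[OF assms(1)] .
  have "(norm (bd a - bd b))\<^sup>2 \<le> 2 * W * ((bd b - bd a) \<bullet> nrm b)"
    by (rule outer_disc[OF bd_closure])
  then have "?l\<^sup>2 \<le> 2 * W * (?l * (v \<bullet> nrm b))"
    using b a(1) v1 by simp
  moreover have "0 < ?l\<^sup>2" using l by simp
  ultimately have "0 < 2 * W * (?l * (v \<bullet> nrm b))" by linarith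
  then show pos: "v \<bullet> nrm b > 0"
    using l width_pos by (simp add: zero_less_mult_iff)
  have n: "(norm (v - (v \<bullet> nrm b) *\<^sub>R nrm b))\<^sup>2 = 1 - (v \<bullet> nrm b)\<^sup>2"
    using unit_add_norm[OF norm_frame(1), of v "- (v \<bullet> nrm b)" b] v1 by (simp add: power2_eq_square)
  have "(norm (v - (v \<bullet> nrm b) *\<^sub>R nrm b))\<^sup>2 < 1\<^sup>2"
    unfolding n using pos by simp
  then have "norm (v - (v \<bullet> nrm b) *\<^sub>R nrm b) < 1"
    by (rule power2_less_imp_less) simp
  then show "billiard_map \<Omega> z \<in> coball_bundle \<Omega>"
    unfolding coball_iff snd using assms(2) by (intro exI[of _ b]) (simp add: inner_diff_left)
  show "direction \<Omega> (billiard_map \<Omega> z) = v - (2 * (v \<bullet> nrm b)) *\<^sub>R nrm b"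
    unfolding direction_bd[OF assms(2)] snd n mult_2 scaleR_add_left using pos by simp
qed

lemma billiard_map_bd:
  assumes "z \<in> coball_bundle \<Omega>"
  obtains b where "fst (billiard_map \<Omega> z) = bd b"
proof -
  have "fst (billiard_map \<Omega> z) \<in> range bd"
    unfolding range_bd using segment_length_props(2)[OF assms] by (simp add: billiard_map_def Let_def)
  then show thesis using that by blast
qed

lemma billiard_map_coball: "z \<in> coball_bundle \<Omega> \<Longrightarrow> billiard_map \<Omega> z \<in> coball_bundle \<Omega>"
  using billiard_map_bd billiard_step(4) by metis

lemma normal_chord:
  "(bd \<theta>, 0) \<in> coball_bundle \<Omega>" "direction \<Omega> (bd \<theta>, 0) = - nrm \<theta>"
  "segment_length \<Omega> (bd \<theta>, 0) = W" "billiard_map \<Omega> (bd \<theta>, 0) = (bd (\<theta> + pi), 0)"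
proof -
  show M: "(bd \<theta>, 0) \<in> coball_bundle \<Omega>"
    unfolding coball_iff by (intro exI[of _ \<theta>]) simp
  show d: "direction \<Omega> (bd \<theta>, 0) = - nrm \<theta>"
    by (simp add: inner_normal_bd)
  have eq: "bd (\<theta> + pi) = bd \<theta> + W *\<^sub>R direction \<Omega> (bd \<theta>, 0)"
    unfolding d by (simp add: bd_add_pi)
  show l: "segment_length \<Omega> (bd \<theta>, 0) = W"
    by (rule segment_length_props(3)[OF M width_pos]) (metis bd_frontier eq fst_conv)
  have "fst (billiard_map \<Omega> (bd \<theta>, 0)) = bd (\<theta> + pi)"
    by (simp only: billiard_map_def Let_def fst_conv l eq)
  with billiard_step(3)[OF M this] show "billiard_map \<Omega> (bd \<theta>, 0) = (bd (\<theta> + pi), 0)"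
    unfolding d by (intro prod_eqI) simp_all
qed

end

section \<open>Perimeters of triangles with positively spanning normals\<close>

text \<open>With \<open>t\<^sub>i = tan (\<pi>/4 - A\<^sub>i/2)\<close> the excess over \<open>1\<close> is \<open>c1 * c2 * (1 - t1 - t2 - t1 * t2)\<close>, and the
  last hypothesis is \<open>(1 - t1 * t2)\<^sup>2 > (t1 + t2)\<^sup>2\<close> up to a positive factor.\<close>

lemma acute_sin_cos_sum:
  fixes s1 s2 c1 c2 :: real
  assumes pos: "s1 > 0" "s2 > 0" "c1 > 0" "c2 > 0"
    and circ: "s1\<^sup>2 + c1\<^sup>2 = 1" "s2\<^sup>2 + c2\<^sup>2 = 1" and acute: "s1 * s2 - c1 * c2 > 0"
  shows "s1 + s2 + (s1 * c2 + c1 * s2) - (c1 + c2 + (s1 * s2 - c1 * c2)) > 1"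
proof -
  define t1 where "t1 = c1 / (1 + s1)"
  define t2 where "t2 = c2 / (1 + s2)"
  have t_pos: "t1 > 0" "t2 > 0" using pos by (auto simp: t1_def t2_def)
  \<comment> \<open>The rational parametrisation of the circle by half angles: \<open>t\<close> is
    the tangent of half the complementary angle.\<close>
  have half: "s = 1 - t * c \<and> s * (1 + t\<^sup>2) = 1 - t\<^sup>2 \<and> c * (1 + t\<^sup>2) = 2 * t \<and> t < 1"
    if "s > 0" "c > 0" "s\<^sup>2 + c\<^sup>2 = 1" "t = c / (1 + s)" for s c t :: real
  proof -
    have c: "c = t * (1 + s)" using that by simp
    have "c * c = (1 - s) * (1 + s)" using that(3) by (simp add: algebra_simps power2_eq_square)
    then have "t * c * (1 + s) = (1 - s) * (1 + s)" by (metis c mult.assoc mult.commute)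
    then have s: "s = 1 - t * c" using that(1) by simp
    have "c\<^sup>2 \<le> 1" using that(3) zero_le_power2[of s] by linarith
    then have "c \<le> 1" using power2_le_imp_le[of c 1] by simp
    then have t1: "t < 1" using that by simp
    have "c = t * (1 + (1 - t * c))" using c s by simp
    then have c2: "c * (1 + t\<^sup>2) = 2 * t" by (simp add: algebra_simps power2_eq_square)
    have "s * (1 + t\<^sup>2) = (1 + t\<^sup>2) - t * (c * (1 + t\<^sup>2))"
      by (subst s) (simp add: algebra_simps)
    then show ?thesis using s c2 t1 by (simp add: power2_eq_square)
  qed
  note h1 = half[OF pos(1,3) circ(1) t1_def] and h2 = half[OF pos(2,4) circ(2) t2_def]
  have "0 < (s1 * s2 - c1 * c2) * ((1 + t1\<^sup>2) * (1 + t2\<^sup>2))"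
    using acute by (intro mult_pos_pos) (auto simp: add_pos_nonneg)
  also have "\<dots> = (s1 * (1 + t1\<^sup>2)) * (s2 * (1 + t2\<^sup>2)) - (c1 * (1 + t1\<^sup>2)) * (c2 * (1 + t2\<^sup>2))"
    by (simp add: algebra_simps)
  also have "\<dots> = (1 - t1\<^sup>2) * (1 - t2\<^sup>2) - (2 * t1) * (2 * t2)"
    using h1 h2 by metis
  also have "\<dots> = (1 - t1 * t2)\<^sup>2 - (t1 + t2)\<^sup>2"
    by (simp add: power2_eq_square algebra_simps)
  finally have sq: "(t1 + t2)\<^sup>2 < (1 - t1 * t2)\<^sup>2" by simp
  have "t1 * t2 < 1" using h1 h2 t_pos mult_strict_mono[of t1 1 t2 1] by simp
  then have "t1 + t2 < 1 - t1 * t2" using power2_less_imp_less[OF sq] by simp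
  then have "0 < c1 * c2 * (1 - t1 * t2 - t1 - t2)" using pos by simp
  also have "c1 * c2 * (1 - t1 * t2 - t1 - t2) =
      c1 * c2 - (t1 * c1) * (t2 * c2) - c2 * (t1 * c1) - c1 * (t2 * c2)"
    by (simp add: algebra_simps)
  also have "\<dots> = c1 * c2 - (1 - s1) * (1 - s2) - c2 * (1 - s1) - c1 * (1 - s2)"
    using h1 h2 by simp
  finally show ?thesis by (simp add: algebra_simps)
qed

lemma tng_diff: "tng (x + y) - tng (x - y) = (- 2 * sin y) *\<^sub>R nrm x"
  by (simp add: tng_def nrm_def vec_eq_iff forall_2 sin_add sin_diff cos_add cos_diff)

lemma sin_scaleR_nrm:
  "sin (c - b) *\<^sub>R nrm a = cos (a - c) *\<^sub>R tng b - cos (a - b) *\<^sub>R tng c"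
proof -
  have "x = x * (cos a * cos a) + x * (sin a * sin a)" for x :: real
    using sin_cos_squared_add3[of a] by (metis distrib_left mult.right_neutral)
  then show ?thesis
    by (simp add: tng_def nrm_def vec_eq_iff forall_2 sin_diff cos_diff algebra_simps)
qed

lemma inner_le_norm: "norm u \<le> 1 \<Longrightarrow> x \<bullet> u \<le> norm x" for x u :: "'a::real_inner"
  by (rule order_trans[OF norm_cauchy_schwarz]) (simp add: mult_left_le)

context smooth_constant_width
begin

definition perim :: "real \<Rightarrow> real \<Rightarrow> real \<Rightarrow> real" where
  "perim a b c = norm (bd a - bd b) + norm (bd b - bd c) + norm (bd a - bd c)"

lemma opposite_dist:
  assumes "nrm a = - nrm b"
  shows "norm (bd a - bd b) = W"
proof -
  have "bd a = bd (b + pi)" using assms by (intro bd_nrm_cong) simp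
  then show ?thesis using width_pos by (simp add: bd_add_pi)
qed

text \<open>The two sides at \<open>bd \<alpha>\<close> are tested against
  \<open>nrm \<alpha>\<close>, the third against \<open>u\<close>. Seen from the point
  \<open>q\<close> opposite to \<open>bd \<alpha>\<close> the mixed terms cancel, leaving
  \<open>2 * W\<close> plus twice the weighted nonnegative gaps between \<open>q\<close> and the
  supporting lines at \<open>bd \<beta>\<close> and \<open>bd \<gamma>\<close>. In the equality case
  one gap vanishes, and \<open>q\<close> is the point of contact.\<close>

lemma perim_nonacute:
  assumes n: "nrm \<alpha> = - (a *\<^sub>R nrm \<beta> + b *\<^sub>R nrm \<gamma>)" and ab: "a \<ge> 0" "b \<ge> 0"
    and cos: "cos (\<beta> - \<gamma>) \<ge> 0" and P: "perim \<alpha> \<beta> \<gamma> \<le> 2 * W"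
  shows "norm (bd \<alpha> - bd \<beta>) = W \<or> norm (bd \<alpha> - bd \<gamma>) = W"
proof -
  define q where "q = bd (\<alpha> + pi)"
  define x where "x = bd \<beta> - q"
  define y where "y = bd \<gamma> - q"
  have p: "bd \<alpha> = q + W *\<^sub>R nrm \<alpha>" by (simp add: q_def bd_add_pi)
  have bd_bc: "bd \<beta> = q + x" "bd \<gamma> = q + y" by (simp_all add: x_def y_def)
  have 0: "x \<bullet> nrm \<beta> \<ge> 0" "y \<bullet> nrm \<gamma> \<ge> 0"
    using bd_max[OF bd_closure] by (simp_all add: x_def y_def q_def inner_diff_left)
  \<comment> \<open>Changing the sign of one summand cannot lengthen the vector, because the two
    normals form no obtuse angle.\<close>
  define u where "u = a *\<^sub>R nrm \<beta> - b *\<^sub>R nrm \<gamma>"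
  have cs: "cos (\<gamma> - \<beta>) = cos (\<beta> - \<gamma>)" by (simp add: cos_diff)
  have "(norm u)\<^sup>2 \<le> (norm (nrm \<alpha>))\<^sup>2"
    unfolding n u_def power2_norm_eq_inner using ab cos
    by (simp add: inner_diff_left inner_diff_right inner_add_left inner_add_right cs algebra_simps)
  then have "norm u \<le> norm (nrm \<alpha>)" by (rule power2_le_imp_le) simp
  then have u: "norm u \<le> 1" by simp
  have nn: "nrm \<alpha> \<bullet> nrm \<alpha> = 1" by simp
  have "norm (bd \<alpha> - bd \<beta>) \<ge> W + a * (x \<bullet> nrm \<beta>) + b * (x \<bullet> nrm \<gamma>)"
  proof -
    have "(bd \<alpha> - bd \<beta>) \<bullet> nrm \<alpha> = W - x \<bullet> nrm \<alpha>"
      by (simp add: p bd_bc inner_diff_left inner_add_left)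
    also have "x \<bullet> nrm \<alpha> = - (a * (x \<bullet> nrm \<beta>) + b * (x \<bullet> nrm \<gamma>))"
      unfolding n by (simp add: inner_diff_right inner_add_right)
    finally show ?thesis using inner_le_norm[of "nrm \<alpha>" "bd \<alpha> - bd \<beta>"] by simp
  qed
  moreover have "norm (bd \<alpha> - bd \<gamma>) \<ge> W + a * (y \<bullet> nrm \<beta>) + b * (y \<bullet> nrm \<gamma>)"
  proof -
    have "(bd \<alpha> - bd \<gamma>) \<bullet> nrm \<alpha> = W - y \<bullet> nrm \<alpha>"
      by (simp add: p bd_bc inner_diff_left inner_add_left)
    also have "y \<bullet> nrm \<alpha> = - (a * (y \<bullet> nrm \<beta>) + b * (y \<bullet> nrm \<gamma>))"
      unfolding n by (simp add: inner_diff_right inner_add_right)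
    finally show ?thesis using inner_le_norm[of "nrm \<alpha>" "bd \<alpha> - bd \<gamma>"] by simp
  qed
  moreover have "norm (bd \<beta> - bd \<gamma>) \<ge> a * (x \<bullet> nrm \<beta>) - b * (x \<bullet> nrm \<gamma>) - a * (y \<bullet> nrm \<beta>) + b * (y \<bullet> nrm \<gamma>)"
  proof -
    have "(bd \<beta> - bd \<gamma>) \<bullet> u = a * (x \<bullet> nrm \<beta>) - b * (x \<bullet> nrm \<gamma>) - a * (y \<bullet> nrm \<beta>) + b * (y \<bullet> nrm \<gamma>)"
      by (simp add: bd_bc u_def inner_diff_left inner_diff_right right_diff_distrib)
    then show ?thesis using inner_le_norm[OF u, of "bd \<beta> - bd \<gamma>"] by simp
  qed
  ultimately have "a * (x \<bullet> nrm \<beta>) + b * (y \<bullet> nrm \<gamma>) \<le> 0"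
    using P by (simp add: perim_def)
  moreover have "a * (x \<bullet> nrm \<beta>) \<ge> 0" "b * (y \<bullet> nrm \<gamma>) \<ge> 0"
    using 0 ab by simp_all
  ultimately have z: "a * (x \<bullet> nrm \<beta>) = 0" "b * (y \<bullet> nrm \<gamma>) = 0" by linarith+
  have dist: "norm (bd \<alpha> - bd t) = W" if "(bd t - q) \<bullet> nrm t = 0" for t
  proof -
    have "q = bd t"
    proof (rule bd_unique)
      show "y \<bullet> nrm t \<le> q \<bullet> nrm t" if "y \<in> closure \<Omega>" for y
        using bd_max[OF that, of t] \<open>(bd t - q) \<bullet> nrm t = 0\<close> by (simp add: inner_diff_left)
    qed (simp add: q_def bd_closure)
    then show ?thesis using p width_pos by simp
  qed
  have "a \<noteq> 0 \<or> b \<noteq> 0" using n by auto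
  with z dist[of \<beta>] dist[of \<gamma>] show ?thesis by (auto simp: x_def y_def)
qed

text \<open>The test vectors \<open>u\<close> are the vertices, seen from the circumcentre, of a triangle with sides
  parallel to the three tangents. After the substitution \<open>bd t = q t + W * nrm t\<close> the contribution of
  \<open>q\<close> is regrouped with the orthocentre as base point, which turns the weights into cosines; the
  distances between the points \<open>q t\<close> are at most \<open>W\<close>.\<close>

lemma perim_acute:
  assumes \<sigma>: "\<sigma> = 1 \<or> \<sigma> = - 1"
    and s: "\<sigma> * sin (c - b) > 0" "\<sigma> * sin (a - c) > 0" "\<sigma> * sin (b - a) > 0"
    and acute: "cos (b - c) < 0" "cos (a - c) < 0" "cos (a - b) < 0"
  shows "perim a b c > 2 * W"
proof -
  \<comment> \<open>Up to the orientation \<open>\<sigma>\<close>, the sines and cosines of the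
    angles of the triangle bounded by the three tangents.\<close>
  define s1 s2 s3 where "s1 = sin (c - b)" and "s2 = sin (a - c)" and "s3 = sin (b - a)"
  define c1 c2 c3 where "c1 = - cos (b - c)" and "c2 = - cos (a - c)" and "c3 = - cos (a - b)"
  have cc: "cos (c - b) = - c1" "cos (c - a) = - c2" "cos (b - a) = - c3"
    by (simp_all add: c1_def c2_def c3_def cos_diff)
  have c_pos: "c1 > 0" "c2 > 0" "c3 > 0" using acute by (simp_all add: c1_def c2_def c3_def)
  have s3: "s3 = s1 * c2 + c1 * s2"
  proof -
    have "sin (a - b) = sin ((c - b) + (a - c))" by simp
    also have "\<dots> = - (s1 * c2 + c1 * s2)" unfolding sin_add by (simp add: cc s1_def s2_def c2_def)
    finally show ?thesis unfolding s3_def by (metis minus_diff_eq minus_minus sin_minus)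
  qed
  have c3: "c3 = s1 * s2 - c1 * c2"
  proof -
    have "cos (a - b) = cos ((c - b) + (a - c))" by simp
    also have "\<dots> = c1 * c2 - s1 * s2" unfolding cos_add by (simp add: cc s1_def s2_def c2_def)
    finally show ?thesis unfolding c3_def by simp
  qed
  define q where "q = (\<lambda>t. bd (t + pi))"
  have p: "bd t = q t + W *\<^sub>R nrm t" for t by (simp add: q_def bd_add_pi)
  have qd: "\<bar>(q x - q y) \<bullet> tng t\<bar> \<le> W" for x y t
  proof -
    have "\<bar>(q x - q y) \<bullet> tng t\<bar> \<le> norm (q x - q y)"
      using Cauchy_Schwarz_ineq2[of _ "tng t"] by simp
    also have "\<dots> \<le> W" using dist_le_width[OF bd_closure bd_closure] by (simp add: q_def dist_norm)
    finally show ?thesis .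
  qed
  define u where "u = (\<lambda>t. \<sigma> *\<^sub>R tng t)"
  have u: "norm (u t) \<le> 1" for t using \<sigma> by (auto simp: u_def)
  let ?u1 = "u (b + c - a)" and ?u2 = "u (a + c - b)" and ?u3 = "u (a + b - c)"
  have d: "?u3 - ?u2 = (2 * \<sigma> * s1) *\<^sub>R nrm a" "?u1 - ?u3 = (2 * \<sigma> * s2) *\<^sub>R nrm b"
    "?u2 - ?u1 = (2 * \<sigma> * s3) *\<^sub>R nrm c"
  proof -
    have *: "u (x + y - z) - u (x + z - y) = (2 * \<sigma> * sin (z - y)) *\<^sub>R nrm x" for x y z
    proof -
      have "u (x + y - z) - u (x + z - y) = \<sigma> *\<^sub>R (tng (x + (y - z)) - tng (x - (y - z)))"
        by (simp add: u_def scaleR_diff_right algebra_simps)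
      also have "\<dots> = (2 * \<sigma> * - sin (y - z)) *\<^sub>R nrm x" unfolding tng_diff by simp
      also have "- sin (y - z) = sin (z - y)" by (metis minus_diff_eq sin_minus)
      finally show ?thesis .
    qed
    show "?u3 - ?u2 = (2 * \<sigma> * s1) *\<^sub>R nrm a" "?u1 - ?u3 = (2 * \<sigma> * s2) *\<^sub>R nrm b"
      "?u2 - ?u1 = (2 * \<sigma> * s3) *\<^sub>R nrm c"
      using *[of a b c] *[of b c a] *[of c a b] by (simp_all add: s1_def s2_def s3_def add.commute)
  qed
  have sn: "s1 *\<^sub>R nrm a = c3 *\<^sub>R tng c - c2 *\<^sub>R tng b" "s2 *\<^sub>R nrm b = c1 *\<^sub>R tng a - c3 *\<^sub>R tng c"
    "s3 *\<^sub>R nrm c = c2 *\<^sub>R tng b - c1 *\<^sub>R tng a"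
    unfolding s1_def s2_def s3_def sin_scaleR_nrm cc by (simp_all add: c1_def c2_def c3_def)
  have "perim a b c \<ge> (bd a - bd b) \<bullet> ?u3 + (bd b - bd c) \<bullet> ?u1 + (bd c - bd a) \<bullet> ?u2"
    unfolding perim_def norm_minus_commute[of "bd a" "bd c"] by (intro add_mono inner_le_norm u)
  also have "(bd a - bd b) \<bullet> ?u3 + (bd b - bd c) \<bullet> ?u1 + (bd c - bd a) \<bullet> ?u2 =
      bd a \<bullet> (?u3 - ?u2) + bd b \<bullet> (?u1 - ?u3) + bd c \<bullet> (?u2 - ?u1)"
    by (simp add: inner_diff_left inner_diff_right)
  also have "\<dots> = 2 * \<sigma> * (bd a \<bullet> (s1 *\<^sub>R nrm a) + bd b \<bullet> (s2 *\<^sub>R nrm b) + bd c \<bullet> (s3 *\<^sub>R nrm c))"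
    unfolding d by (simp add: algebra_simps)
  also have "\<dots> = 2 * \<sigma> * W * (s1 + s2 + s3) + 2 * \<sigma> * (q a \<bullet> (s1 *\<^sub>R nrm a) + q b \<bullet> (s2 *\<^sub>R nrm b) + q c \<bullet> (s3 *\<^sub>R nrm c))"
    unfolding p by (simp add: inner_add_left algebra_simps)
  also have "q a \<bullet> (s1 *\<^sub>R nrm a) + q b \<bullet> (s2 *\<^sub>R nrm b) + q c \<bullet> (s3 *\<^sub>R nrm c) =
      c1 * ((q b - q c) \<bullet> tng a) + c2 * ((q c - q a) \<bullet> tng b) + c3 * ((q a - q b) \<bullet> tng c)" (is "_ = ?Q")
    unfolding sn by (simp add: inner_diff_left inner_diff_right algebra_simps)
  finally have P: "2 * \<sigma> * W * (s1 + s2 + s3) + 2 * \<sigma> * ?Q \<le> perim a b c" .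
  have "\<bar>?Q\<bar> \<le> \<bar>c1 * ((q b - q c) \<bullet> tng a)\<bar> + \<bar>c2 * ((q c - q a) \<bullet> tng b)\<bar> + \<bar>c3 * ((q a - q b) \<bullet> tng c)\<bar>"
    by linarith
  also have "\<dots> \<le> c1 * W + c2 * W + c3 * W"
    unfolding abs_mult using c_pos by (intro add_mono mult_mono qd) auto
  finally have "\<bar>?Q\<bar> \<le> W * (c1 + c2 + c3)" by (simp add: algebra_simps)
  moreover have "\<bar>2 * \<sigma> * ?Q\<bar> = 2 * \<bar>?Q\<bar>" using \<sigma> by (auto simp: abs_mult)
  moreover have "- (2 * B) \<le> A" if "\<bar>Q\<bar> \<le> B" "\<bar>A\<bar> = 2 * \<bar>Q\<bar>" for A B Q :: real
    using that by linarith
  ultimately have "- (2 * (W * (c1 + c2 + c3))) \<le> 2 * \<sigma> * ?Q" by blast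
  with P have "2 * \<sigma> * W * (s1 + s2 + s3) - 2 * (W * (c1 + c2 + c3)) \<le> perim a b c" by linarith
  moreover have "2 * \<sigma> * W * (s1 + s2 + s3) - 2 * (W * (c1 + c2 + c3)) =
      2 * W * (\<sigma> * s1 + \<sigma> * s2 + \<sigma> * s3 - (c1 + c2 + c3))"
    by (simp add: algebra_simps)
  moreover have "\<sigma> * s1 + \<sigma> * s2 + \<sigma> * s3 - (c1 + c2 + c3) > 1"
  proof -
    have ss: "\<sigma> * \<sigma> = 1" using \<sigma> by auto
    have "c3 = (\<sigma> * s1) * (\<sigma> * s2) - c1 * c2"
      unfolding c3 using ss by (metis mult.left_commute mult.assoc mult_1)
    moreover have "\<sigma> * s3 = \<sigma> * s1 * c2 + c1 * (\<sigma> * s2)"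
      unfolding s3 by (simp add: algebra_simps)
    moreover have "(\<sigma> * x)\<^sup>2 = x\<^sup>2" for x using \<sigma> by auto
    then have "(\<sigma> * s1)\<^sup>2 + c1\<^sup>2 = 1" "(\<sigma> * s2)\<^sup>2 + c2\<^sup>2 = 1"
      using sin_cos_squared_add[of "c - b"] sin_cos_squared_add[of "a - c"]
      by (simp_all add: s1_def s2_def cc c2_def)
    ultimately show ?thesis
      using acute_sin_cos_sum[of "\<sigma> * s1" "\<sigma> * s2" c1 c2] s c_pos
      by (simp add: s1_def s2_def)
  qed
  then have "2 * W * 1 < 2 * W * (\<sigma> * s1 + \<sigma> * s2 + \<sigma> * s3 - (c1 + c2 + c3))"
    using width_pos by (intro mult_strict_left_mono) auto
  ultimately show ?thesis by linarith
qed

text \<open>If no side has length \<open>W\<close>, then \<open>perim_nonacute\<close> at each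
  vertex makes all pairs of normals obtuse; the balance of the weights gives the three sines a
  common sign, and \<open>perim_acute\<close> contradicts the bound.\<close>

lemma perim_eq_width:
  assumes l: "l \<ge> 0" "m \<ge> 0" "k \<ge> 0" "l + m + k = 1"
    and sum: "l *\<^sub>R nrm a + m *\<^sub>R nrm b + k *\<^sub>R nrm c = 0" and P: "perim a b c \<le> 2 * W"
  shows "norm (bd a - bd b) = W \<or> norm (bd b - bd c) = W \<or> norm (bd a - bd c) = W"
proof (rule ccontr)
  assume neg: "\<not> ?thesis"
  \<comment> \<open>Each vertex takes the role of \<open>x\<close> in turn. A vanishing weight
    \<open>l'\<close> leaves two opposite normals, hence a side of length \<open>W\<close>.\<close>
  have obtuse: "cos (y - z) < 0"
    if "l' \<ge> 0" "m' \<ge> 0" "k' \<ge> 0" "l' + m' + k' = 1" "l' *\<^sub>R nrm x + m' *\<^sub>R nrm y + k' *\<^sub>R nrm z = 0"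
      "perim x y z \<le> 2 * W" "norm (bd x - bd y) \<noteq> W" "norm (bd x - bd z) \<noteq> W" "norm (bd y - bd z) \<noteq> W"
    for l' m' k' x y z
  proof (rule ccontr)
    assume c: "\<not> ?thesis"
    show False
    proof (cases "l' = 0")
      case True
      then have "m' *\<^sub>R nrm y = - k' *\<^sub>R nrm z" using that(5) by (simp add: add_eq_0_iff)
      moreover from this have "m' = k'"
        using that(2,3) by (metis abs_of_nonneg norm_frame(1) mult.right_neutral norm_minus_cancel norm_scaleR scaleR_minus_left)
      moreover from this have "k' \<noteq> 0" using that(4) True by auto
      ultimately have "nrm y = - nrm z" using scaleR_left_imp_eq[of k' "nrm y" "- nrm z"] by simp
      then show False using opposite_dist that(9) by blast
    next
      case False
      have "l' *\<^sub>R nrm x = - (m' *\<^sub>R nrm y + k' *\<^sub>R nrm z)"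
        using that(5) by (simp add: add.assoc add_eq_0_iff)
      then have "nrm x = inverse l' *\<^sub>R - (m' *\<^sub>R nrm y + k' *\<^sub>R nrm z)"
        using False by (metis scaleR_scaleR left_inverse scaleR_one)
      then have "nrm x = - ((m' / l') *\<^sub>R nrm y + (k' / l') *\<^sub>R nrm z)"
        by (simp add: scaleR_diff_right divide_inverse_commute)
      from perim_nonacute[OF this] c that show False by simp
    qed
  qed
  have perm: "perim b a c = perim a b c" "perim c a b = perim a b c"
    by (simp_all add: perim_def norm_minus_commute)
  have nc: "norm (bd y - bd x) = norm (bd x - bd y)" for x y by (rule norm_minus_commute)
  have cos: "cos (b - c) < 0" "cos (a - c) < 0" "cos (a - b) < 0"
    using obtuse[of l m k a b c] obtuse[of m l k b a c] obtuse[of k l m c a b] l sum P neg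
    by (simp_all add: perm nc add_ac)
  have z: "sin (x - y) \<noteq> 0" if "cos (x - y) < 0" "norm (bd x - bd y) \<noteq> W" for x y
  proof
    assume "sin (x - y) = 0"
    then have "cos (x - y) = - 1" using sin_zero_abs_cos_one[of "x - y"] that by auto
    moreover from this have "cos (y - x) = - 1" by (metis cos_minus minus_diff_eq)
    ultimately have "(nrm x + nrm y) \<bullet> (nrm x + nrm y) = 0"
      by (simp add: inner_add_left inner_add_right)
    then have "nrm x = - nrm y" by (simp add: eq_neg_iff_add_eq_0)
    then show False using opposite_dist that(2) by blast
  qed
  have sc: "sin (x - y) = - sin (y - x)" for x y :: real by (simp add: sin_diff)
  have s: "sin (c - b) \<noteq> 0" "sin (a - c) \<noteq> 0" "sin (b - a) \<noteq> 0"
    using z[OF cos(1)] z[OF cos(2)] z[OF cos(3)] neg sc[of c b] sc[of b a] by auto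
  have "(l *\<^sub>R nrm a + m *\<^sub>R nrm b + k *\<^sub>R nrm c) \<bullet> tng x = 0" for x using sum by simp
  then have lin: "l * sin (a - x) + m * sin (b - x) + k * sin (c - x) = 0" for x
    by (simp add: inner_add_left)
  \<comment> \<open>The law of sines: each weight is proportional to the sine of the angle between
    the other two normals.\<close>
  have rel: "m * sin (b - a) = k * sin (a - c)" "l * sin (b - a) = k * sin (c - b)"
      "l * sin (a - c) = m * sin (c - b)"
    using lin[of a] lin[of b] lin[of c] sc[of c a] sc[of a b] sc[of b c] by auto
  have pos: "l > 0" "m > 0" "k > 0"
    using rel s l by (auto simp: less_le) 
  define \<sigma> where "\<sigma> = sgn (sin (c - b))"
  have \<sigma>: "\<sigma> = 1 \<or> \<sigma> = - 1" using s by (auto simp: \<sigma>_def sgn_if)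
  have 1: "\<sigma> * sin (c - b) > 0" using s by (auto simp: \<sigma>_def sgn_if)
  have "l * (\<sigma> * sin (a - c)) = m * (\<sigma> * sin (c - b))" "l * (\<sigma> * sin (b - a)) = k * (\<sigma> * sin (c - b))"
    using rel(2,3) by (metis mult.left_commute)+
  then have "l * (\<sigma> * sin (a - c)) > 0" "l * (\<sigma> * sin (b - a)) > 0"
    using mult_pos_pos[OF pos(2) 1] mult_pos_pos[OF pos(3) 1] by metis+
  then have "\<sigma> * sin (a - c) > 0" "\<sigma> * sin (b - a) > 0"
    using pos by (simp_all add: zero_less_mult_iff)
  from perim_acute[OF \<sigma> 1 this cos] P show False by simp
qed

lemma continuous_on_bd [continuous_intros]:
  "continuous_on A f \<Longrightarrow> continuous_on A (\<lambda>x. bd (f x))"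
  by (rule continuous_on_compose2[OF continuous_bd]) auto

text \<open>Compactness makes \<open>perim_eq_width\<close> quantitative: configurations with all
  sides at most \<open>W - \<eta>\<close> form a compact set on which the perimeter exceeds
  \<open>2 * W\<close>. Including the weights as coordinates keeps the balance condition
  closed.\<close>

lemma perim_gap:
  assumes "\<eta> > 0"
  shows "\<exists>\<epsilon>>0. \<forall>a b c l m k. l \<ge> 0 \<and> m \<ge> 0 \<and> k \<ge> 0 \<and> l + m + k = 1 \<and>
      l *\<^sub>R nrm a + m *\<^sub>R nrm b + k *\<^sub>R nrm c = 0 \<and> perim a b c \<le> 2 * W + \<epsilon> \<longrightarrow>
      norm (bd a - bd b) > W - \<eta> \<or> norm (bd b - bd c) > W - \<eta> \<or> norm (bd a - bd c) > W - \<eta>"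
proof -
  define good where "good = (\<lambda>(a, b, c, l, m, k). l \<ge> 0 \<and> m \<ge> 0 \<and> k \<ge> 0 \<and> l + m + k = 1 \<and>
      l *\<^sub>R nrm a + m *\<^sub>R nrm b + k *\<^sub>R nrm c = 0 \<and>
      norm (bd a - bd b) \<le> W - \<eta> \<and> norm (bd b - bd c) \<le> W - \<eta> \<and> norm (bd a - bd c) \<le> W - \<eta>)"
  define F where "F = (\<lambda>(a, b, c, l :: real, m :: real, k :: real). perim a b c)"
  let ?I = "{0..2 * pi}" and ?J = "{0..1::real}"
  define K where "K = (?I \<times> ?I \<times> ?I \<times> ?J \<times> ?J \<times> ?J) \<inter> Collect good"
  have "closed (Collect good)"
    unfolding good_def case_prod_beta
    by (intro closed_Collect_conj closed_Collect_le closed_Collect_eq continuous_intros)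
  then have "compact K"
    unfolding K_def by (intro compact_Int_closed compact_Times compact_Icc)
  moreover have "continuous_on K F"
    unfolding F_def perim_def case_prod_beta by (intro continuous_intros)
  ultimately have min: "K = {} \<or> (\<exists>x\<in>K. \<forall>y\<in>K. F x \<le> F y)"
    using continuous_attains_inf by blast
  have gt: "F x > 2 * W" if "x \<in> K" for x
  proof (rule ccontr)
    assume "\<not> ?thesis"
    moreover obtain a b c l m k where "x = (a, b, c, l, m, k)" by (metis prod_cases6)
    ultimately show False
      using that perim_eq_width[of l m k a b c] assms by (auto simp: K_def good_def F_def)
  qed
  obtain \<epsilon> where \<epsilon>: "\<epsilon> > 0" "\<And>x. x \<in> K \<Longrightarrow> F x > 2 * W + \<epsilon>"
  proof (cases "K = {}")
    case True
    then show ?thesis using that[of 1] by simp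
  next
    case False
    with min obtain x where x: "x \<in> K" "\<And>y. y \<in> K \<Longrightarrow> F x \<le> F y" by blast
    show ?thesis
      by (rule that[of "(F x - 2 * W) / 2"]) (use gt[OF x(1)] x(2) in \<open>force simp: field_simps\<close>)+
  qed
  \<comment> \<open>Angles enter only through \<open>nrm\<close> and \<open>bd\<close>, so one
    closed period represents all of them.\<close>
  have red: "\<exists>\<phi>\<in>?I. nrm \<phi> = nrm \<theta> \<and> bd \<phi> = bd \<theta>" for \<theta>
  proof -
    obtain \<phi> k where "\<phi> \<in> {0..<2 * pi}" "\<theta> = \<phi> + of_int k * (2 * pi)"
      using angle_reduction by blast
    then show ?thesis
      using periodic_int[of nrm \<phi> k] periodic_int[of bd \<phi> k] by (intro bexI[of _ \<phi>]) auto
  qed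
  show ?thesis
  proof (intro exI[of _ \<epsilon>] conjI allI impI \<epsilon>(1), elim conjE, rule ccontr)
    fix a b c l m k
    assume *: "l \<ge> 0" "m \<ge> 0" "k \<ge> 0" "l + m + k = 1" "l *\<^sub>R nrm a + m *\<^sub>R nrm b + k *\<^sub>R nrm c = 0"
      "perim a b c \<le> 2 * W + \<epsilon>" and **: "\<not> (norm (bd a - bd b) > W - \<eta> \<or> norm (bd b - bd c) > W - \<eta> \<or> norm (bd a - bd c) > W - \<eta>)"
    obtain a' where a': "a' \<in> ?I" "nrm a' = nrm a" "bd a' = bd a" using red by blast
    obtain b' where b': "b' \<in> ?I" "nrm b' = nrm b" "bd b' = bd b" using red by blast
    obtain c' where c': "c' \<in> ?I" "nrm c' = nrm c" "bd c' = bd c" using red by blast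
    have "(a', b', c', l, m, k) \<in> K"
      using * ** a' b' c' by (simp add: K_def good_def)
    from \<epsilon>(2)[OF this] *(6) show False by (simp add: F_def perim_def a' b' c')
  qed
qed

end

section \<open>Short periodic trajectories are double normals\<close>

text \<open>Caratheodory in the plane. The three indices may coincide, so supports of one or two
  vectors are covered by zero weights.\<close>

lemma three_vectors:
  fixes x :: "'i \<Rightarrow> real^2"
  assumes I: "finite I" "I \<noteq> {}" "\<And>i. i \<in> I \<Longrightarrow> c i > 0" and sum: "(\<Sum>i\<in>I. c i *\<^sub>R x i) = 0"
  obtains a b d l m k where "a \<in> I" "b \<in> I" "d \<in> I" "0 \<le> (l::real)" "0 \<le> m" "0 \<le> k" "l + m + k = 1"
    "l *\<^sub>R x a + m *\<^sub>R x b + k *\<^sub>R x d = 0"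
proof -
  define C where "C = sum c I"
  have C: "C > 0" unfolding C_def using I by (intro sum_pos) auto
  have "(\<Sum>i\<in>I. (c i / C) *\<^sub>R x i) \<in> convex hull (x ` I)"
  proof (rule convex_sum)
    show "(\<Sum>i\<in>I. c i / C) = 1" using C by (simp add: C_def flip: sum_divide_distrib)
  qed (use I C in \<open>auto simp: hull_inc intro: less_imp_le\<close>)
  also have "(\<Sum>i\<in>I. (c i / C) *\<^sub>R x i) = inverse C *\<^sub>R (\<Sum>i\<in>I. c i *\<^sub>R x i)"
    by (simp add: scaleR_sum_right divide_inverse_commute)
  finally have "0 \<in> convex hull (x ` I)" using sum by simp
  then have "\<exists>S u. finite S \<and> S \<subseteq> x ` I \<and> card S \<le> DIM(real^2) + 1 \<and>
      (\<forall>y\<in>S. 0 \<le> u y) \<and> sum u S = 1 \<and> (\<Sum>y\<in>S. u y *\<^sub>R y) = 0"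
    unfolding convex_hull_caratheodory by (rule CollectD)
  then obtain S u where S: "finite S" "S \<subseteq> x ` I" "card S \<le> DIM(real^2) + 1" "\<forall>y\<in>S. 0 \<le> u y"
      "sum u S = 1" "(\<Sum>y\<in>S. u y *\<^sub>R y) = 0"
    by (elim exE conjE) (rule that)
  have "S \<noteq> {}" using S(5) by auto
  then have "card S \<noteq> 0" "card S \<le> 3" using S(1,3) by simp_all
  then have "card S = 1 \<or> card S = 2 \<or> card S = 3" by arith
  then obtain p q r l m k where pqr: "p \<in> S" "q \<in> S" "r \<in> S" "0 \<le> l" "0 \<le> m" "0 \<le> k" "l + m + k = 1"
    "l *\<^sub>R p + m *\<^sub>R q + k *\<^sub>R r = 0"
  proof (elim disjE)
    assume "card S = 1"
    then obtain p where "S = {p}" by (rule card_1_singletonE)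
    then show thesis using S that[of p p p 1 0 0] by simp
  next
    assume "card S = 2"
    then obtain p q where "S = {p, q}" "p \<noteq> q" by (auto simp: card_2_iff)
    then show thesis using S that[of p q q "u p" "u q" 0] by simp
  next
    assume "card S = 3"
    then obtain p q r where "S = {p, q, r}" "p \<noteq> q" "q \<noteq> r" "p \<noteq> r" by (auto simp: card_3_iff)
    then show thesis using S that[of p q r "u p" "u q" "u r"] by (simp add: add.assoc)
  qed
  obtain a b d where "a \<in> I" "b \<in> I" "d \<in> I" "p = x a" "q = x b" "r = x d"
    using subsetD[OF S(2) pqr(1)] subsetD[OF S(2) pqr(2)] subsetD[OF S(2) pqr(3)] by (elim imageE) (rule that)
  with pqr show thesis using that[of a b d l m k] by simp
qed

lemma dist_le_path:
  fixes p :: "nat \<Rightarrow> 'a::metric_space"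
  shows "i \<le> j \<Longrightarrow> dist (p i) (p j) \<le> (\<Sum>t\<in>{i..<j}. dist (p t) (p (Suc t)))"
proof (induction rule: dec_induct)
  case (step n)
  then show ?case using dist_triangle[of "p i" "p (Suc n)" "p n"] by (simp add: add.commute)
qed simp

lemma triangle_le_closed_path:
  fixes p :: "nat \<Rightarrow> 'a::metric_space"
  assumes "p m = p 0" "i \<le> m" "j \<le> m" "k \<le> m"
  shows "dist (p i) (p j) + dist (p j) (p k) + dist (p i) (p k) \<le> (\<Sum>t<m. dist (p t) (p (Suc t)))"
proof -
  let ?d = "\<lambda>t. dist (p t) (p (Suc t))"
  have sorted: "dist (p i) (p j) + dist (p j) (p k) + dist (p i) (p k) \<le> sum ?d {..<m}"
    if "i \<le> j" "j \<le> k" "k \<le> m" for i j k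
  proof -
    have "sum ?d {..<m} = sum ?d {0..<i} + sum ?d {i..<j} + sum ?d {j..<k} + sum ?d {k..<m}"
      using that by (simp add: sum.atLeastLessThan_concat lessThan_atLeast0)
    moreover have "dist (p i) (p k) \<le> dist (p 0) (p i) + dist (p k) (p m)"
      unfolding assms(1) using dist_triangle[of "p i" "p k" "p 0"] by (simp add: dist_commute)
    ultimately show ?thesis
      using dist_le_path[of 0 i p] dist_le_path[of i j p] dist_le_path[of j k p] dist_le_path[of k m p] that
      by linarith
  qed
  consider "i \<le> j" "j \<le> k" | "i \<le> k" "k \<le> j" | "j \<le> i" "i \<le> k" | "j \<le> k" "k \<le> i" | "k \<le> i" "i \<le> j" | "k \<le> j" "j \<le> i"
    by linarith
  then show ?thesis
    using sorted[of i j k] sorted[of i k j] sorted[of j i k] sorted[of j k i] sorted[of k i j] sorted[of k j i] assms(2-4)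
    by cases (simp_all add: dist_commute)
qed

context smooth_constant_width
begin

text \<open>A boundary point near a diameter is near one of its ends: the two ends lie in the disc of radius
  \<open>W\<close> tangent at \<open>bd t\<close>, so they are seen from \<open>bd t\<close> under an angle bounded away from \<open>\<pi>\<close>.\<close>

lemma near_end:
  assumes p: "p \<in> closure \<Omega>" "p' \<in> closure \<Omega>" "norm (p - p') \<ge> W / 2"
    and \<kappa>: "norm (p - bd t) + norm (p' - bd t) \<le> norm (p - p') + \<kappa>" "0 \<le> \<kappa>" "\<kappa> \<le> W"
  shows "norm (p - bd t) \<le> 192 * \<kappa> \<or> norm (p' - bd t) \<le> 192 * \<kappa>"
proof -
  define a where "a = p - bd t"
  define b where "b = p' - bd t"
  define A where "A = norm a"
  define B where "B = norm b"
  have aa: "a \<bullet> a = A * A" and bb: "b \<bullet> b = B * B"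
    by (simp_all add: A_def B_def flip: power2_norm_eq_inner power2_eq_square)
  have AB0: "A \<ge> 0" "B \<ge> 0" by (simp_all add: A_def B_def)
  have diff: "p - p' = a - b" by (simp add: a_def b_def)
  have AB: "A + B \<ge> W / 2"
    using p(3) norm_triangle_ineq4[of a b] by (simp add: diff A_def B_def)
  have "A\<^sup>2 \<le> - 2 * W * (a \<bullet> nrm t)" "B\<^sup>2 \<le> - 2 * W * (b \<bullet> nrm t)"
    using outer_disc[OF p(1), of t] outer_disc[OF p(2), of t]
    by (simp_all add: A_def B_def a_def b_def inner_diff_left algebra_simps)
  \<comment> \<open>The weights \<open>B\<close> and \<open>A\<close> rescale \<open>a\<close> and
    \<open>b\<close> to equal length; their sum is small only if \<open>a\<close> and
    \<open>b\<close> are nearly opposite.\<close>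
  then have "B * A\<^sup>2 + A * B\<^sup>2 \<le> B * (- 2 * W * (a \<bullet> nrm t)) + A * (- 2 * W * (b \<bullet> nrm t))"
    using AB0 by (intro add_mono mult_left_mono)
  also have "\<dots> = 2 * W * ((- (B *\<^sub>R a + A *\<^sub>R b)) \<bullet> nrm t)"
    by (simp add: inner_add_left inner_diff_left algebra_simps)
  also have "\<dots> \<le> 2 * W * norm (B *\<^sub>R a + A *\<^sub>R b)"
  proof (intro mult_left_mono)
    have "- (B *\<^sub>R a + A *\<^sub>R b) \<bullet> nrm t \<le> norm (- (B *\<^sub>R a + A *\<^sub>R b))"
      by (rule inner_le_norm) simp
    then show "- (B *\<^sub>R a + A *\<^sub>R b) \<bullet> nrm t \<le> norm (B *\<^sub>R a + A *\<^sub>R b)"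
      unfolding norm_minus_cancel .
  qed (use width_pos in simp)
  finally have "A * B * (A + B) \<le> 2 * W * norm (B *\<^sub>R a + A *\<^sub>R b)"
    by (simp add: power2_eq_square algebra_simps)
  moreover have "A * B * (W / 2) \<le> A * B * (A + B)"
    using AB AB0 by (intro mult_left_mono) auto
  ultimately have "2 * W * (A * B / 4) \<le> 2 * W * norm (B *\<^sub>R a + A *\<^sub>R b)"
    by (simp add: algebra_simps)
  then have "A * B / 4 \<le> norm (B *\<^sub>R a + A *\<^sub>R b)"
    using width_pos by simp
  then have "(A * B / 4)\<^sup>2 \<le> (norm (B *\<^sub>R a + A *\<^sub>R b))\<^sup>2"
    using AB0 by (intro power_mono) auto
  also have "\<dots> = 2 * (A * B) * (A * B + a \<bullet> b)"
    unfolding power2_norm_eq_inner inner_add_left inner_add_right inner_scaleR_left inner_scaleR_right aa bb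
    by (simp add: inner_commute algebra_simps)
  finally have 1: "A * B * (A * B) \<le> A * B * (32 * (A * B + a \<bullet> b))"
    by (simp add: power2_eq_square algebra_simps)
  \<comment> \<open>Near equality in the triangle inequality bounds
    \<open>A * B + a \<bullet> b\<close>, which measures the deviation of \<open>a\<close> and
    \<open>b\<close> from being opposite.\<close>
  have "A + B \<le> norm (a - b) + \<kappa>"
    using \<kappa>(1) unfolding A_def B_def diff[symmetric] by (simp add: a_def b_def)
  then have "(A + B)\<^sup>2 \<le> (norm (a - b) + \<kappa>)\<^sup>2"
    using AB0 by (intro power_mono) auto
  also have "\<dots> = (norm (a - b))\<^sup>2 + (2 * norm (a - b) + \<kappa>) * \<kappa>"
    by (simp add: power2_eq_square algebra_simps)
  also have "(norm (a - b))\<^sup>2 = A\<^sup>2 + B\<^sup>2 - 2 * (a \<bullet> b)"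
    by (simp add: A_def B_def power2_norm_eq_inner inner_diff_left inner_diff_right inner_commute)
  finally have "2 * (A * B + a \<bullet> b) \<le> (2 * norm (a - b) + \<kappa>) * \<kappa>"
    by (simp add: power2_eq_square algebra_simps)
  also have "\<dots> \<le> (3 * W) * \<kappa>"
    using \<kappa>(2,3) dist_le_width[OF p(1,2)] by (intro mult_right_mono) (auto simp: dist_norm diff)
  finally have 2: "32 * (A * B + a \<bullet> b) \<le> 48 * W * \<kappa>" by simp
  have 3: "A * B \<le> 48 * W * \<kappa>"
  proof (cases "A * B = 0")
    case False
    then have "A * B > 0" using AB0 by (simp add: less_le)
    with 1 2 show ?thesis by (meson mult_le_cancel_left_pos order_trans)
  qed (use \<kappa> width_pos in auto)
  \<comment> \<open>One of the two distances is at least \<open>W / 4\<close>, and dividing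
    \<open>48 * W * \<kappa>\<close> by it gives the factor \<open>192\<close>.\<close>
  show ?thesis
  proof (rule ccontr)
    assume "\<not> ?thesis"
    then have gt: "A > 192 * \<kappa>" "B > 192 * \<kappa>" by (auto simp: A_def B_def a_def b_def)
    have "A \<ge> W / 4 \<or> B \<ge> W / 4" using AB by linarith
    then show False
    proof
      assume "A \<ge> W / 4"
      then have "W / 4 * B \<le> A * B" using AB0 by (intro mult_right_mono)
      moreover have "W / 4 * (192 * \<kappa>) < W / 4 * B" using gt width_pos by (intro mult_strict_left_mono) auto
      ultimately show False using 3 by simp
    next
      assume "B \<ge> W / 4"
      then have "A * (W / 4) \<le> A * B" using AB0 by (intro mult_left_mono)
      moreover have "(192 * \<kappa>) * (W / 4) < A * (W / 4)" using gt width_pos by (intro mult_strict_right_mono) auto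
      ultimately show False using 3 by (simp add: mult_ac)
    qed
  qed
qed

section \<open>Isolation of the period\<close>

lemma billiard_orbit:
  assumes "z \<in> coball_bundle \<Omega>"
  obtains \<theta> where
    "\<And>i. fst ((billiard_map \<Omega> ^^ i) z) = bd (\<theta> i)"
    "\<And>i. (billiard_map \<Omega> ^^ i) z \<in> coball_bundle \<Omega>"
proof -
  have M: "(billiard_map \<Omega> ^^ i) z \<in> coball_bundle \<Omega>" for i
    by (induction i) (use assms billiard_map_coball in auto)
  then have "\<forall>i. \<exists>t. fst ((billiard_map \<Omega> ^^ i) z) = bd t"
    using coball_iff by blast
  then obtain \<theta> where "\<And>i. fst ((billiard_map \<Omega> ^^ i) z) = bd (\<theta> i)" by metis
  with M show thesis using that by blast
qed

text \<open>Repeated traversals of a double normal are too long to satisfy the bound, which is why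
  \<open>m\<close> can be determined exactly.\<close>

lemma periodic_trajectory_gap:
  "\<exists>\<epsilon>>0. \<forall>m z. billiard_periodic \<Omega> m z \<and> period_length \<Omega> m z \<le> 2 * W + \<epsilon> \<longrightarrow>
      m = 2 \<and> (\<exists>t. z = (bd t, 0))"
proof -
  \<comment> \<open>Chords of lengths at most \<open>2 * \<tau>\<close> and at least
    \<open>W - 3 * \<tau>\<close> differ by more than the factor \<open>W / rmin\<close> allowed for
    neighbours. The slack \<open>\<tau> / 1000\<close> below is used three times and multiplied by
    \<open>192\<close> in \<open>near_end\<close>, which still stays below
    \<open>\<tau>\<close>.\<close>
  define \<tau> where "\<tau> = rmin / 100"
  have rW: "rmin \<le> W" using rmin_le rad_le order_trans by blast
  have \<tau>: "0 < \<tau>" "100 * \<tau> \<le> W" using rmin_pos rW by (simp_all add: \<tau>_def)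
  obtain \<epsilon>0 where \<epsilon>0: "\<epsilon>0 > 0" "\<And>a b c l m k. 0 \<le> l \<Longrightarrow> 0 \<le> m \<Longrightarrow> 0 \<le> k \<Longrightarrow> l + m + k = 1 \<Longrightarrow>
      l *\<^sub>R nrm a + m *\<^sub>R nrm b + k *\<^sub>R nrm c = 0 \<Longrightarrow> perim a b c \<le> 2 * W + \<epsilon>0 \<Longrightarrow>
      norm (bd a - bd b) > W - \<tau> / 1000 \<or> norm (bd b - bd c) > W - \<tau> / 1000 \<or> norm (bd a - bd c) > W - \<tau> / 1000"
  proof -
    have "\<tau> / 1000 > 0" using \<tau> by simp
    from perim_gap[OF this] show thesis
      by (elim exE conjE) (rule that, assumption, blast)
  qed
  define \<epsilon> where "\<epsilon> = min \<epsilon>0 (\<tau> / 1000)"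
  have \<epsilon>: "0 < \<epsilon>" "\<epsilon> \<le> \<epsilon>0" "\<epsilon> \<le> \<tau> / 1000" using \<epsilon>0(1) \<tau> by (auto simp: \<epsilon>_def)
  have "m = 2 \<and> (\<exists>t. z = (bd t, 0))"
    if per: "billiard_periodic \<Omega> m z" and len: "period_length \<Omega> m z \<le> 2 * W + \<epsilon>" for m z
  proof -
    define Z where "Z = (\<lambda>i. (billiard_map \<Omega> ^^ i) z)"
    have m: "m \<ge> 1" and zM: "z \<in> coball_bundle \<Omega>" and Zm: "Z m = Z 0"
      using per by (auto simp: billiard_periodic_def Z_def)
    obtain \<theta> where \<theta>: "\<And>i. fst (Z i) = bd (\<theta> i)" and ZM: "\<And>i. Z i \<in> coball_bundle \<Omega>"
      using billiard_orbit[OF zM] unfolding Z_def by metis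
    define v where "v = (\<lambda>i. direction \<Omega> (Z i))"
    define l where "l = (\<lambda>i. segment_length \<Omega> (Z i))"
    define c where "c = (\<lambda>i. v i \<bullet> nrm (\<theta> (Suc i)))"
    have ZSuc: "Z (Suc i) = billiard_map \<Omega> (Z i)" for i by (simp add: Z_def)
    have Zmod: "Z (i mod m) = Z i" for i
      using Zm unfolding Z_def by (intro funpow_mod_eq) simp
    have \<theta>Suc: "fst (billiard_map \<Omega> (Z i)) = bd (\<theta> (Suc i))" for i using \<theta>[of "Suc i"] by (simp add: ZSuc)
    note step = billiard_step[OF ZM \<theta>Suc]
    have P: "bd (\<theta> (Suc i)) = bd (\<theta> i) + l i *\<^sub>R v i" for i
      using step(1)[of i] by (simp add: l_def v_def \<theta>)
    have c_pos: "c i > 0" for i using step(2)[of i] by (simp add: c_def v_def)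
    have vSuc: "v (Suc i) = v i - (2 * c i) *\<^sub>R nrm (\<theta> (Suc i))" for i
      using step(5)[of i] by (simp add: c_def v_def ZSuc)
    have l_pos: "l i > 0" for i using segment_length_props(1)[OF ZM] by (simp add: l_def)
    have Zi: "\<exists>t. bd (\<theta> i) = bd t \<and> snd (Z i) \<bullet> nrm t = 0 \<and> norm (snd (Z i)) < 1" for i
      using ZM[of i] unfolding coball_iff \<theta> .
    have v1: "norm (v i) = 1" for i
      using Zi[of i] direction_props(1)[of "Z i"] \<theta>[of i] unfolding v_def by metis
    have dist_l: "dist (bd (\<theta> i)) (bd (\<theta> (Suc i))) = l i" for i
      using l_pos[of i] v1[of i] by (simp add: dist_norm P)
    have vv: "v (Suc i) \<bullet> nrm (\<theta> (Suc i)) = - c i" for i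
      by (simp add: vSuc inner_diff_left) (simp add: c_def)
    \<comment> \<open>The two discs at the common reflection point bound the chords before and after
      it by the same \<open>c i\<close>; this is what makes them comparable.\<close>
    have out1: "l i \<le> 2 * W * c i" and in1: "2 * rmin * c i \<le> l i" for i
    proof -
      have eq: "(bd (\<theta> (Suc i)) - bd (\<theta> i)) \<bullet> nrm (\<theta> (Suc i)) = l i * c i" "norm (bd (\<theta> i) - bd (\<theta> (Suc i))) = l i"
        using dist_l[of i] by (simp_all add: P c_def dist_norm)
      show "l i \<le> 2 * W * c i" "2 * rmin * c i \<le> l i"
        using outer_disc[OF bd_closure, of "\<theta> i" "\<theta> (Suc i)"] inner_disc[of "\<theta> (Suc i)" "\<theta> i"] l_pos[of i]
        unfolding eq by (simp_all add: power2_eq_square mult_ac)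
    qed
    have out2: "l (Suc i) \<le> 2 * W * c i" and in2: "2 * rmin * c i \<le> l (Suc i)" for i
    proof -
      have eq: "(bd (\<theta> (Suc i)) - bd (\<theta> (Suc (Suc i)))) \<bullet> nrm (\<theta> (Suc i)) = l (Suc i) * c i"
        "norm (bd (\<theta> (Suc (Suc i))) - bd (\<theta> (Suc i))) = l (Suc i)"
        using dist_l[of "Suc i"] vv[of i] by (simp_all add: P[of "Suc i"] dist_norm norm_minus_commute)
      show "l (Suc i) \<le> 2 * W * c i" "2 * rmin * c i \<le> l (Suc i)"
        using outer_disc[OF bd_closure, of "\<theta> (Suc (Suc i))" "\<theta> (Suc i)"] inner_disc[of "\<theta> (Suc i)" "\<theta> (Suc (Suc i))"] l_pos[of "Suc i"]
        unfolding eq by (simp_all add: power2_eq_square mult_ac)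
    qed
    have ratio: "rmin * l i \<le> W * l (Suc i)" "rmin * l (Suc i) \<le> W * l i" for i
    proof -
      have "rmin * l i \<le> rmin * (2 * W * c i)" "W * (2 * rmin * c i) \<le> W * l (Suc i)"
        using out1[of i] in2[of i] rmin_pos width_pos by (auto intro!: mult_left_mono)
      then show "rmin * l i \<le> W * l (Suc i)" by (simp add: mult_ac)
      have "rmin * l (Suc i) \<le> rmin * (2 * W * c i)" "W * (2 * rmin * c i) \<le> W * l i"
        using out2[of i] in1[of i] rmin_pos width_pos by (auto intro!: mult_left_mono)
      then show "rmin * l (Suc i) \<le> W * l i" by (simp add: mult_ac)
    qed
    have L: "(\<Sum>i<m. l i) \<le> 2 * W + \<epsilon>" using len by (simp add: period_length_def l_def Z_def)
    have Pm: "bd (\<theta> (i mod m)) = bd (\<theta> i)" for i using Zmod[of i] \<theta>[of i] \<theta>[of "i mod m"] by simp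
    have tri: "norm (bd (\<theta> i) - bd (\<theta> j)) + norm (bd (\<theta> j) - bd (\<theta> k)) + norm (bd (\<theta> i) - bd (\<theta> k)) \<le> 2 * W + \<epsilon>" for i j k
    proof -
      have lt: "x mod m \<le> m" for x using m by (simp add: less_imp_le)
      have "bd (\<theta> m) = bd (\<theta> 0)" using Pm[of m] by simp
      from triangle_le_closed_path[where p = "\<lambda>i. bd (\<theta> i)", OF this lt lt lt, of i j k]
      show ?thesis using L unfolding Pm dist_l by (simp add: dist_norm)
    qed
    \<comment> \<open>Every bounce changes the direction by a multiple of the normal, and over one
      period the changes cancel.\<close>
    have sum0: "(\<Sum>i<m. (2 * c i) *\<^sub>R nrm (\<theta> (Suc i))) = 0"
    proof -
      have "(\<Sum>i<m. (2 * c i) *\<^sub>R nrm (\<theta> (Suc i))) = (\<Sum>i<m. v i - v (Suc i))"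
        by (simp add: vSuc)
      also have "\<dots> = v 0 - v m" by (rule sum_lessThan_telescope')
      also have "\<dots> = 0" using Zm by (simp add: v_def)
      finally show ?thesis .
    qed
    have ne: "{..<m} \<noteq> {}" and c2_pos: "\<And>i. i \<in> {..<m} \<Longrightarrow> 2 * c i > 0"
      using m c_pos by (auto simp: lessThan_empty_iff)
    obtain i0 j0 k0 r s t where "0 \<le> (r::real)" "0 \<le> s" "0 \<le> t" "r + s + t = 1"
        "r *\<^sub>R nrm (\<theta> (Suc i0)) + s *\<^sub>R nrm (\<theta> (Suc j0)) + t *\<^sub>R nrm (\<theta> (Suc k0)) = 0"
      by (rule three_vectors[OF finite_lessThan ne _ sum0], erule c2_pos, rule that)
    moreover have "perim (\<theta> (Suc i0)) (\<theta> (Suc j0)) (\<theta> (Suc k0)) \<le> 2 * W + \<epsilon>0"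
      unfolding perim_def using tri[of "Suc i0" "Suc j0" "Suc k0"] \<epsilon>(2) by simp
    ultimately obtain i j where ij: "norm (bd (\<theta> i) - bd (\<theta> j)) > W - \<tau> / 1000"
      using \<epsilon>0(2) by metis
    let ?p = "bd (\<theta> i)" and ?p' = "bd (\<theta> j)"
    have near: "norm (?p - bd (\<theta> k)) \<le> \<tau> \<or> norm (?p' - bd (\<theta> k)) \<le> \<tau>" for k
    proof -
      have "norm (?p - bd (\<theta> k)) + norm (?p' - bd (\<theta> k)) \<le> norm (?p - ?p') + 3 * \<tau> / 1000"
        using tri[of i j k] ij \<epsilon>(3) by linarith
      from near_end[OF bd_closure bd_closure _ this] show ?thesis
        using ij \<tau> by auto
    qed
    have short_or_long: "l k \<le> 2 * \<tau> \<or> l k \<ge> W - 3 * \<tau>" for k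
    proof -
      have l: "l k = norm (bd (\<theta> k) - bd (\<theta> (Suc k)))" using dist_l[of k] by (simp add: dist_norm)
      have t1: "l k \<le> norm (x - bd (\<theta> k)) + norm (x - bd (\<theta> (Suc k)))" for x
        unfolding l using norm_triangle_ineq4[of "x - bd (\<theta> (Suc k))" "x - bd (\<theta> k)"] by simp
      have t2: "norm (x - y) \<le> norm (x - bd (\<theta> k)) + l k + norm (y - bd (\<theta> (Suc k)))" for x y
      proof -
        have "x - y = (x - bd (\<theta> k)) + (bd (\<theta> k) - bd (\<theta> (Suc k))) - (y - bd (\<theta> (Suc k)))" by simp
        then show ?thesis unfolding l by (metis norm_triangle_le_diff norm_triangle_ineq add_right_mono order_refl)
      qed
      show ?thesis
        using near[of k] near[of "Suc k"] t1[of ?p] t1[of ?p'] t2[of ?p ?p'] t2[of ?p' ?p] ij \<tau>(1)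
        by (auto simp: norm_minus_commute[of ?p' ?p])
    qed
    have same: "l (Suc k) \<le> 2 * \<tau> \<longleftrightarrow> l k \<le> 2 * \<tau>" for k
    proof -
      have no: "\<not> rmin * y \<le> W * x" if "x \<le> 2 * \<tau>" "y \<ge> W - 3 * \<tau>" for x y
      proof -
        have "W * x \<le> W * (2 * \<tau>)" using that width_pos by (intro mult_left_mono) auto
        also have "\<dots> = rmin * (W / 50)" by (simp add: \<tau>_def)
        also have "\<dots> < rmin * y" using that \<tau> width_pos rmin_pos by (intro mult_strict_left_mono) auto
        finally show ?thesis by simp
      qed
      show ?thesis
        using no[of "l k" "l (Suc k)"] no[of "l (Suc k)" "l k"] ratio[of k] short_or_long by blast
    qed
    have all: "l k \<le> 2 * \<tau> \<longleftrightarrow> l 0 \<le> 2 * \<tau>" for k by (induction k) (simp_all add: same)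
    \<comment> \<open>Steps of length at most \<open>2 * \<tau>\<close> cannot lead from the
      neighbourhood of one end to that of the other, although the orbit visits both ends.\<close>
    have "\<not> l 0 \<le> 2 * \<tau>"
    proof
      assume "l 0 \<le> 2 * \<tau>"
      with all have short: "l k \<le> 2 * \<tau>" for k by simp
      have "norm (?p - bd (\<theta> (i + k))) \<le> \<tau>" for k
      proof (induction k)
        case (Suc k)
        have "norm (?p - bd (\<theta> (Suc (i + k)))) \<le> norm (?p - bd (\<theta> (i + k))) + l (i + k)"
          using dist_triangle[of ?p "bd (\<theta> (Suc (i + k)))" "bd (\<theta> (i + k))"] dist_l[of "i + k"] by (simp add: dist_norm)
        then have 3: "norm (?p - bd (\<theta> (Suc (i + k)))) \<le> 3 * \<tau>" using Suc short[of "i + k"] by simp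
        have "norm (?p - ?p') \<le> norm (?p - bd (\<theta> (Suc (i + k)))) + norm (?p' - bd (\<theta> (Suc (i + k))))"
          using dist_triangle2[of ?p ?p' "bd (\<theta> (Suc (i + k)))"] by (simp add: dist_norm)
        then have "\<not> norm (?p' - bd (\<theta> (Suc (i + k)))) \<le> \<tau>"
          using 3 ij \<tau> by linarith
        with near[of "Suc (i + k)"] show ?case by simp
      qed (use \<tau> in simp)
      \<comment> \<open>This number of steps from \<open>i\<close> leads to
        \<open>j + i * m\<close>, the same point as \<open>j\<close>, without comparing
        \<open>i\<close> and \<open>j\<close>.\<close>
      from this[of "j + i * (m - 1)"] have "norm (?p - bd (\<theta> ((i + (j + i * (m - 1))) mod m))) \<le> \<tau>"
        unfolding Pm .
      also have "i + (j + i * (m - 1)) = j + i * m"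
        using m by (cases m) simp_all
      finally show False using ij \<tau> by (simp add: Pm)
    qed
    then have long: "l k \<ge> W - 3 * \<tau>" for k using all short_or_long by blast
    have "real m * (W - 3 * \<tau>) \<le> (\<Sum>i<m. l i)"
      using sum_bounded_below[of "{..<m}" "W - 3 * \<tau>" l] long by simp
    then have mW: "real m * (W - 3 * \<tau>) \<le> 2 * W + \<epsilon>" using L by linarith
    have "m < 3"
    proof (rule ccontr)
      assume "\<not> m < 3"
      then have "3 * (W - 3 * \<tau>) \<le> real m * (W - 3 * \<tau>)" using \<tau> by (intro mult_right_mono) auto
      then have "3 * (W - 3 * \<tau>) \<le> 2 * W + \<epsilon>" using mW by (rule order_trans)
      then show False using \<epsilon>(3) \<tau> by (simp add: field_simps)
    qed
    moreover have "m \<noteq> 1"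
    proof
      assume "m = 1"
      then have "bd (\<theta> (Suc 0)) = bd (\<theta> 0)" using Pm[of "Suc 0"] by simp
      then show False using dist_l[of 0] l_pos[of 0] by simp
    qed
    ultimately have m2: "m = 2" using m by linarith
    have Z2: "Z 2 = Z 0" using Zm m2 by simp
    have P2: "bd (\<theta> 2) = bd (\<theta> 0)" using Z2 \<theta>[of 2] \<theta>[of 0] by simp
    have "l 0 *\<^sub>R v 0 = - (l 1 *\<^sub>R v 1)"
      using P[of 0] P[of 1] P2 by (simp add: numeral_2_eq_2 eq_neg_iff_add_eq_0)
    moreover from this have "l 0 = l 1"
      using v1 l_pos by (metis abs_of_pos mult.right_neutral norm_minus_cancel norm_scaleR)
    ultimately have v10: "v 1 = - v 0"
      using l_pos[of 1] by (metis neg_equal_iff_equal less_irrefl minus_minus scaleR_cancel_left scaleR_minus_right)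
    have "v 2 = v 0" using Z2 by (simp add: v_def)
    \<comment> \<open>The reflection on returning to the starting point reverses the direction, so
      the direction is normal there.\<close>
    then have "v 0 = - c 1 *\<^sub>R nrm (\<theta> 2)"
    proof -
      have "v 2 = v 1 - (2 * c 1) *\<^sub>R nrm (\<theta> 2)" using vSuc[of 1] by (simp add: numeral_2_eq_2)
      then have e: "v 0 = - v 0 - (2 * c 1) *\<^sub>R nrm (\<theta> 2)"
        unfolding \<open>v 2 = v 0\<close> v10 .
      have "2 *\<^sub>R v 0 = v 0 + v 0" by (rule scaleR_2)
      also have "\<dots> = v 0 + (- v 0 - (2 * c 1) *\<^sub>R nrm (\<theta> 2))" by (rule arg_cong[OF e])
      also have "\<dots> = 2 *\<^sub>R (- c 1 *\<^sub>R nrm (\<theta> 2))" by simp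
      finally have "2 *\<^sub>R v 0 = 2 *\<^sub>R (- c 1 *\<^sub>R nrm (\<theta> 2))" .
      then show ?thesis by (metis scaleR_cancel_left zero_neq_numeral)
    qed
    moreover have "nrm (\<theta> 2) = nrm (\<theta> 0)" using P2 bd_eq_iff by blast
    ultimately have v0: "v 0 = - c 1 *\<^sub>R nrm (\<theta> 0)" by simp
    then have "c 1 = 1" using v1[of 0] c_pos[of 1] by simp
    with v0 have v0: "v 0 = - nrm (\<theta> 0)" by simp
    obtain t where t: "bd (\<theta> 0) = bd t" "snd (Z 0) \<bullet> nrm t = 0" "norm (snd (Z 0)) < 1" using Zi by blast
    then have t0: "snd (Z 0) \<bullet> nrm (\<theta> 0) = 0" using bd_eq_iff by metis
    have eq: "- nrm (\<theta> 0) = snd (Z 0) - sqrt (1 - (norm (snd (Z 0)))\<^sup>2) *\<^sub>R nrm (\<theta> 0)"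
      using direction_bd[OF \<theta>, of 0] v0 by (simp add: v_def)
    then have "(- nrm (\<theta> 0)) \<bullet> nrm (\<theta> 0) = (snd (Z 0) - sqrt (1 - (norm (snd (Z 0)))\<^sup>2) *\<^sub>R nrm (\<theta> 0)) \<bullet> nrm (\<theta> 0)"
      by simp
    then have "sqrt (1 - (norm (snd (Z 0)))\<^sup>2) = 1" using t0 by (simp add: inner_diff_left)
    then have "snd (Z 0) = 0" by simp
    then have "z = (bd (\<theta> 0), 0)" using \<theta>[of 0] by (intro prod_eqI) (simp_all add: Z_def)
    with m2 show ?thesis by blast
  qed
  with \<epsilon>(1) show ?thesis by blast
qed

end

section \<open>The differential of the billiard ball map along double normals\<close>

text \<open>\<open>N\<close> is of smaller order than \<open>T\<close>, and \<open>T\<close> is at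
  most linear in \<open>z - x\<close>. This handles products with a factor of which only the limit
  is known.\<close>

lemma has_derivative_zero_squeeze:
  fixes f :: "'a::real_normed_vector \<Rightarrow> real"
  assumes T: "(T has_derivative T') (at x within S)" "T x = 0" and N: "N x = 0"
    and le: "\<forall>\<^sub>F z in at x within S. norm (N z) \<le> f z * norm (T z)"
    and f: "(f \<longlongrightarrow> 0) (at x within S)"
  shows "(N has_derivative (\<lambda>_. 0)) (at x within S)"
proof -
  obtain K where K: "\<And>h. norm (T' h) \<le> norm h * K"
    using bounded_linear.bounded[OF has_derivative_bounded_linear[OF T(1)]] by blast
  have "\<forall>\<^sub>F z in at x within S. norm (T z - T x - T' (z - x)) \<le> 1 * norm (z - x)"
    using T(1) unfolding has_derivative_within_alt2 by (metis zero_less_one)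
  then have T_le: "\<forall>\<^sub>F z in at x within S. norm (T z) \<le> (1 + K) * norm (z - x)"
  proof eventually_elim
    case (elim z)
    have "norm (T z) \<le> norm (T z - T' (z - x)) + norm (T' (z - x))"
      using norm_triangle_ineq[of "T z - T' (z - x)" "T' (z - x)"] by simp
    also have "\<dots> \<le> 1 * norm (z - x) + norm (z - x) * K"
      using elim K[of "z - x"] T(2) by simp
    finally show ?case by (simp add: algebra_simps)
  qed
  show ?thesis
    unfolding has_derivative_iff_norm
  proof (intro conjI bounded_linear_zero, rule tendsto_sandwich[of "\<lambda>_. 0"])
    show "((\<lambda>z. \<bar>f z\<bar> * (1 + K)) \<longlongrightarrow> 0) (at x within S)"
      using tendsto_mult[OF tendsto_rabs[OF f] tendsto_const[of "1 + K"]] by simp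
    show "\<forall>\<^sub>F z in at x within S. norm (N z - N x - 0) / norm (z - x) \<le> \<bar>f z\<bar> * (1 + K)"
      using le T_le eventually_neq_at_within[of x x S]
    proof eventually_elim
      case (elim z)
      have "norm (N z) \<le> \<bar>f z\<bar> * norm (T z)"
        using elim(1) by (rule order_trans) (simp add: mult_right_mono)
      also have "\<dots> \<le> \<bar>f z\<bar> * ((1 + K) * norm (z - x))"
        using elim(2) by (intro mult_left_mono) auto
      finally show ?case using elim(3) N by (simp add: pos_divide_le_eq mult.assoc)
    qed
  qed (auto intro!: always_eventually)
qed

text \<open>A crude linear bound that recovers the difference of two angles from the distance of
  their normals.\<close>

lemma sin_ge_quarter:
  fixes x :: real
  assumes "0 \<le> x" "x \<le> pi / 2"
  shows "x / 4 \<le> sin x"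
proof (cases "x \<le> pi / 6")
  case True
  have "sin 0 - 0 / 4 \<le> sin x - x / 4"
  proof (rule DERIV_nonneg_imp_nondecreasing[OF assms(1)])
    fix t assume t: "0 \<le> t" "t \<le> x"
    have "cos (pi / 3) \<le> cos t"
      using t True by (intro cos_monotone_0_pi_le) auto
    then have "0 \<le> cos t - 1 / 4" by (simp add: cos_60)
    moreover have "((\<lambda>x. sin x - x / 4) has_real_derivative cos t - 1 / 4) (at t)"
      by (auto intro!: derivative_eq_intros)
    ultimately show "\<exists>y. ((\<lambda>x. sin x - x / 4) has_real_derivative y) (at t) \<and> 0 \<le> y" by blast
  qed
  then show ?thesis by simp
next
  case False
  then have "sin (pi / 6) \<le> sin x"
    using assms by (intro sin_monotone_2pi_le) auto
  then show ?thesis using assms pi_less_4 by (simp add: sin_30)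
qed

context smooth_constant_width
begin

text \<open>The differential of the Gauss map up to sign, division by the radius of curvature.
  \<open>G\<close> is stationary in the angle, and \<open>bd_lower_lipschitz\<close> turns an error
  small against the angle into one small against the distance of boundary points.\<close>

lemma inner_normal_has_derivative:
  "(inner_normal \<Omega> has_derivative (\<lambda>h. - (1 / rad a) *\<^sub>R h)) (at (bd a) within frontier \<Omega>)"
  unfolding has_derivative_within_alt
proof (intro conjI allI impI)
  show "bounded_linear (\<lambda>h::real^2. - (1 / rad a) *\<^sub>R h)"
    by (rule bounded_linear_scaleR_right)
  fix e :: real assume e: "e > 0"
  define G where "G = (\<lambda>t. - nrm t + (1 / rad a) *\<^sub>R bd t)"
  have "(G has_vector_derivative - tng a + (1 / rad a) *\<^sub>R (rad a *\<^sub>R tng a)) (at a)"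
    unfolding G_def
    by (intro has_vector_derivative_add has_vector_derivative_minus nrm_has_vector_derivative
        bounded_linear.has_vector_derivative[OF bounded_linear_scaleR_right] bd_has_vector_derivative)
  then have G: "(G has_vector_derivative 0) (at a)"
    using rad_pos[of a] by simp
  have e': "e * rmin / 4 > 0" using e rmin_pos by simp
  then obtain d where d: "d > 0" "\<And>t. norm (t - a) < d \<Longrightarrow> norm (G t - G a) \<le> e * rmin / 4 * norm (t - a)"
  proof -
    have "\<forall>e>0. \<exists>d>0. \<forall>t. norm (t - a) < d \<longrightarrow> norm (G t - G a - (t - a) *\<^sub>R 0) \<le> e * norm (t - a)"
      using G unfolding has_vector_derivative_def has_derivative_at_alt by blast
    with e' have "\<exists>d>0. \<forall>t. norm (t - a) < d \<longrightarrow> norm (G t - G a - (t - a) *\<^sub>R 0) \<le> e * rmin / 4 * norm (t - a)"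
      by blast
    then show thesis using that by auto
  qed
  show "\<exists>d>0. \<forall>y\<in>frontier \<Omega>. norm (y - bd a) < d \<longrightarrow>
      norm (inner_normal \<Omega> y - inner_normal \<Omega> (bd a) - - (1 / rad a) *\<^sub>R (y - bd a)) \<le> e * norm (y - bd a)"
  proof (intro exI[of _ "d * rmin / 4"] conjI ballI impI)
    show "d * rmin / 4 > 0" using d rmin_pos by simp
    fix y assume y: "y \<in> frontier \<Omega>" "norm (y - bd a) < d * rmin / 4"
    obtain s where s: "y = bd s" using y(1) range_bd by blast
    \<comment> \<open>A representative of the angle within \<open>pi\<close> of \<open>a\<close>,
      where half the difference stays in the range of \<open>sin_ge_quarter\<close>.\<close>
    obtain t where t: "nrm t = nrm s" "\<bar>t - a\<bar> \<le> pi"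
    proof -
      obtain \<psi> k where \<psi>: "\<psi> \<in> {0..<2 * pi}" "s - a = \<psi> + of_int k * (2 * pi)"
        using angle_reduction by blast
      then have "s = (a + \<psi>) + of_int k * (2 * pi)" by simp
      then have 1: "nrm s = nrm (a + \<psi>)" using periodic_int[of nrm "a + \<psi>" k] by simp
      show thesis
      proof (cases "\<psi> \<le> pi")
        case True
        then show thesis using \<psi> 1 that[of "a + \<psi>"] by simp
      next
        case False
        have "nrm (a + \<psi> - 2 * pi) = nrm (a + \<psi>)" using frame_add_2pi(1)[of "a + \<psi> - 2 * pi"] by simp
        then show thesis using False \<psi> 1 that[of "a + \<psi> - 2 * pi"] by simp
      qed
    qed
    have yt: "y = bd t" unfolding s by (rule bd_nrm_cong[OF t(1)[symmetric]])
    have "\<bar>t - a\<bar> / 2 / 4 \<le> sin (\<bar>t - a\<bar> / 2)" using t(2) by (intro sin_ge_quarter) auto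
    also have "\<dots> \<le> \<bar>sin ((t - a) / 2)\<bar>"
    proof -
      have "sin \<bar>x\<bar> \<le> \<bar>sin x\<bar>" for x :: real by (auto simp: abs_if)
      from this[of "(t - a) / 2"] show ?thesis by simp
    qed
    finally have "\<bar>t - a\<bar> / 4 \<le> norm (nrm t - nrm a)" by (simp add: norm_nrm_diff)
    then have "rmin * (\<bar>t - a\<bar> / 4) \<le> rmin * norm (nrm t - nrm a)" using rmin_pos by (intro mult_left_mono) auto
    also have "\<dots> \<le> norm (y - bd a)" unfolding yt by (rule bd_lower_lipschitz)
    finally have le: "rmin * \<bar>t - a\<bar> / 4 \<le> norm (y - bd a)" by simp
    with y(2) have "rmin * \<bar>t - a\<bar> < rmin * d" by (simp add: mult.commute)
    then have "norm (t - a) < d" using rmin_pos by simp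
    from d(2)[OF this] have "norm (G t - G a) \<le> e * (rmin * \<bar>t - a\<bar> / 4)" by simp
    also have "\<dots> \<le> e * norm (y - bd a)" using le e by (intro mult_left_mono) auto
    finally show "norm (inner_normal \<Omega> y - inner_normal \<Omega> (bd a) - - (1 / rad a) *\<^sub>R (y - bd a)) \<le> e * norm (y - bd a)"
      unfolding yt by (simp add: inner_normal_bd G_def algebra_simps)
  qed
qed

lemma inner_normal_continuous:
  "continuous (at (bd a) within frontier \<Omega>) (inner_normal \<Omega>)"
  using inner_normal_has_derivative has_derivative_continuous by blast

lemma direction_eq:
  "direction \<Omega> z = snd z + sqrt (1 - snd z \<bullet> snd z) *\<^sub>R inner_normal \<Omega> (fst z)"
  by (cases z) (simp add: power2_norm_eq_inner)

lemma fst_coball: "fst ` coball_bundle \<Omega> \<subseteq> frontier \<Omega>"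
  by (auto simp: coball_bundle_def)

lemma direction_has_derivative:
  "(direction \<Omega> has_derivative (\<lambda>h. snd h - (1 / rad a) *\<^sub>R fst h)) (at (bd a, 0) within coball_bundle \<Omega>)"
proof -
  have "((\<lambda>z. inner_normal \<Omega> (fst z)) has_derivative (\<lambda>h. - (1 / rad a) *\<^sub>R fst h)) (at (bd a, 0) within coball_bundle \<Omega>)"
    by (rule has_derivative_in_compose[OF has_derivative_fst[OF has_derivative_ident]])
      (use has_derivative_subset[OF inner_normal_has_derivative fst_coball, of a] in simp)
  \<comment> \<open>The square root is even in the covector, hence stationary at the zero
    covector.\<close>
  moreover have "((\<lambda>z :: (real^2) \<times> (real^2). sqrt (1 - snd z \<bullet> snd z)) has_derivative (\<lambda>h. 0)) (at (bd a, 0) within coball_bundle \<Omega>)"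
    by (auto intro!: derivative_eq_intros)
  ultimately show ?thesis
    unfolding direction_eq[abs_def]
    by (auto intro!: derivative_eq_intros)
qed

text \<open>No chord is longer than \<open>W\<close>. Conversely, a point of the normal chord before
  its end is interior, and by openness the corresponding points of nearby rays are interior too, so
  those rays hit later.\<close>

lemma segment_length_tendsto:
  "(segment_length \<Omega> \<longlongrightarrow> W) (at (bd a, 0) within coball_bundle \<Omega>)"
proof (rule order_tendstoI)
  have ev: "\<forall>\<^sub>F z in at (bd a, 0) within coball_bundle \<Omega>. z \<in> coball_bundle \<Omega>"
    by (simp add: eventually_at_filter)
  have le: "segment_length \<Omega> z \<le> W" if z: "z \<in> coball_bundle \<Omega>" for z
  proof -
    obtain t where t: "fst z = bd t" "snd z \<bullet> nrm t = 0" "norm (snd z) < 1"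
      using z coball_iff by blast
    have "dist (fst z) (fst z + segment_length \<Omega> z *\<^sub>R direction \<Omega> z) \<le> W"
      using segment_length_props(2)[OF z] bd_closure[of t] t(1) by (intro dist_le_width) (auto simp: frontier_eq)
    then show ?thesis
      using direction_props(1)[OF t] segment_length_props(1)[OF z] by (simp add: dist_norm)
  qed
  show "\<forall>\<^sub>F z in at (bd a, 0) within coball_bundle \<Omega>. segment_length \<Omega> z < u" if "W < u" for u
    using ev by (rule eventually_mono) (rule order_le_less_trans[OF le that])
  show "\<forall>\<^sub>F z in at (bd a, 0) within coball_bundle \<Omega>. s < segment_length \<Omega> z" if "s < W" for s
  proof -
    define s' where "s' = max s (W / 2)"
    have s': "0 < s'" "s' < W" "s \<le> s'" using that width_pos by (auto simp: s'_def)
    have "bd a + s' *\<^sub>R - nrm a \<in> \<Omega>"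
      by (rule ray_interior[of _ _ _ W]) (use s' bd_closure[of "a + pi"] in \<open>auto simp: bd_add_pi\<close>)
    moreover have "((\<lambda>z. fst z + s' *\<^sub>R direction \<Omega> z) \<longlongrightarrow> fst (bd a, 0 :: real^2) + s' *\<^sub>R direction \<Omega> (bd a, 0)) (at (bd a, 0) within coball_bundle \<Omega>)"
      by (intro tendsto_intros has_derivative_continuous[OF direction_has_derivative, unfolded continuous_within])
    ultimately have "\<forall>\<^sub>F z in at (bd a, 0) within coball_bundle \<Omega>. fst z + s' *\<^sub>R direction \<Omega> z \<in> \<Omega>"
      using topological_tendstoD open_dom unfolding normal_chord(2) fst_conv by blast
    with ev show ?thesis
    proof eventually_elim
      case (elim z)
      obtain t where t: "fst z = bd t" "snd z \<bullet> nrm t = 0" "norm (snd z) < 1"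
        using elim(1) coball_iff by blast
      let ?l = "segment_length \<Omega> z"
      have fr: "bd t + ?l *\<^sub>R direction \<Omega> z \<notin> \<Omega>"
        using segment_length_props(2)[OF elim(1)] by (simp add: frontier_eq t(1))
      have cl: "bd t + s' *\<^sub>R direction \<Omega> z \<in> closure \<Omega>"
        using subsetD[OF closure_subset elim(2)] t(1) by simp
      have "s' < ?l"
      proof (rule ccontr)
        assume "\<not> s' < ?l"
        then consider "?l = s'" | "?l < s'" by linarith
        then show False
          using ray_interior[OF direction_props(1,3)[OF t] segment_length_props(1)[OF elim(1)] _ cl] fr elim(2) t(1)
          by cases auto
      qed
      then show ?case using s'(3) by simp
    qed
  qed
qed

lemma fst_billiard_map: "fst (billiard_map \<Omega> z) = fst z + segment_length \<Omega> z *\<^sub>R direction \<Omega> z"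
  by (simp add: billiard_map_def Let_def)

text \<open>The tangential part of the hitting point is that of \<open>y\<close> up to \<open>o(z - z0)\<close> since
  \<open>segment_length\<close> tends to \<open>W\<close>; the normal part is quadratic in the displacement.\<close>

lemma hitting_point_has_derivative:
  "((\<lambda>z. fst (billiard_map \<Omega> z)) has_derivative
      (\<lambda>h. ((fst h + W *\<^sub>R (snd h - (1 / rad a) *\<^sub>R fst h)) \<bullet> tng a) *\<^sub>R tng a))
    (at (bd a, 0) within coball_bundle \<Omega>)"
proof -
  let ?F = "at (bd a, 0 :: real^2) within coball_bundle \<Omega>"
  let ?q = "bd (a + pi)"
  define Q where "Q = (\<lambda>z. fst (billiard_map \<Omega> z))"
  define y where "y = (\<lambda>z. fst z + W *\<^sub>R direction \<Omega> z)"
  define y' where "y' = (\<lambda>h :: (real^2) \<times> (real^2). fst h + W *\<^sub>R (snd h - (1 / rad a) *\<^sub>R fst h))"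
  define r where "r = (\<lambda>z. (segment_length \<Omega> z - W) * (direction \<Omega> z \<bullet> tng a))"
  have Q0: "Q (bd a, 0) = ?q" by (simp add: Q_def normal_chord)
  have ev: "\<forall>\<^sub>F z in ?F. z \<in> coball_bundle \<Omega>" by (simp add: eventually_at_filter)
  have y: "(y has_derivative y') ?F"
    unfolding y_def y'_def by (intro derivative_intros direction_has_derivative)
  have y0: "y (bd a, 0) = ?q" by (simp only: y_def fst_conv normal_chord(2)) (simp add: bd_add_pi)
  have l0: "((\<lambda>z. segment_length \<Omega> z - W) \<longlongrightarrow> 0) ?F"
    using segment_length_tendsto by (simp add: LIM_zero_iff)
  have r: "(r has_derivative (\<lambda>_. 0)) ?F"
  proof (rule has_derivative_zero_squeeze)
    show "((\<lambda>z. direction \<Omega> z \<bullet> tng a) has_derivative (\<lambda>h. (snd h - (1 / rad a) *\<^sub>R fst h) \<bullet> tng a)) ?F"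
      by (intro derivative_intros direction_has_derivative)
    show "direction \<Omega> (bd a, 0) \<bullet> tng a = 0" "r (bd a, 0) = 0" unfolding r_def normal_chord(2) by simp_all
    show "\<forall>\<^sub>F z in ?F. norm (r z) \<le> \<bar>segment_length \<Omega> z - W\<bar> * norm (direction \<Omega> z \<bullet> tng a)"
      by (simp add: r_def abs_mult)
    show "((\<lambda>z. \<bar>segment_length \<Omega> z - W\<bar>) \<longlongrightarrow> 0) ?F" using tendsto_rabs[OF l0] by simp
  qed
  define T where "T = (\<lambda>z. (Q z - ?q) \<bullet> tng a)"
  define N where "N = (\<lambda>z. (Q z - ?q) \<bullet> nrm a)"
  have Q_y: "Q z - ?q = (y z - ?q) + (segment_length \<Omega> z - W) *\<^sub>R direction \<Omega> z" for z
    by (simp add: Q_def y_def fst_billiard_map algebra_simps)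
  have T_eq: "T = (\<lambda>z. (y z - ?q) \<bullet> tng a + r z)"
    by (rule ext) (simp add: T_def Q_y inner_add_left r_def)
  have T: "(T has_derivative (\<lambda>h. y' h \<bullet> tng a)) ?F"
    unfolding T_eq by (auto intro!: derivative_eq_intros y r)
  have "((\<lambda>z. y z - ?q + (segment_length \<Omega> z - W) *\<^sub>R direction \<Omega> z) \<longlongrightarrow> y (bd a, 0) - ?q + 0 *\<^sub>R direction \<Omega> (bd a, 0)) ?F"
    by (intro tendsto_intros l0 has_derivative_continuous[OF direction_has_derivative, unfolded continuous_within]
        has_derivative_continuous[OF y, unfolded continuous_within])
  then have Q_lim: "((\<lambda>z. Q z - ?q) \<longlongrightarrow> 0) ?F"
    unfolding Q_y y0 by simp
  have N: "(N has_derivative (\<lambda>_. 0)) ?F"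
  proof (rule has_derivative_zero_squeeze[OF T])
    show "T (bd a, 0) = 0" "N (bd a, 0) = 0" by (simp_all add: T_def N_def Q0)
    \<comment> \<open>Near \<open>?q\<close> the square of \<open>N z\<close> in the inner disc
      inequality can be absorbed into the left-hand side.\<close>
    have small: "\<forall>\<^sub>F z in ?F. norm (Q z - ?q) < rmin"
      using Q_lim rmin_pos by (simp add: tendsto_iff)
    show "\<forall>\<^sub>F z in ?F. norm (N z) \<le> (2 / rmin * \<bar>T z\<bar>) * norm (T z)"
      using ev small
    proof eventually_elim
      case (elim z)
      obtain b where b: "Q z = bd b" using billiard_map_bd[OF elim(1)] unfolding Q_def by blast
      let ?d = "norm (Q z - ?q)"
      have N1: "2 * rmin * N z \<le> ?d\<^sup>2"
        using inner_disc[of "a + pi" b] unfolding b[symmetric] by (simp add: N_def inner_diff_left)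
      have N0: "0 \<le> N z"
        using bd_max[OF bd_closure, of b "a + pi"] unfolding b[symmetric] by (simp add: N_def inner_diff_left)
      have d: "?d\<^sup>2 = (N z)\<^sup>2 + (T z)\<^sup>2" unfolding N_def T_def by (rule frame_norm)
      have "N z \<le> ?d"
        using Cauchy_Schwarz_ineq2[of "Q z - ?q" "nrm a"] by (simp add: N_def)
      then have "N z * N z \<le> rmin * N z" using N0 elim(2) by (intro mult_right_mono) auto
      then have "rmin * N z \<le> (T z)\<^sup>2" using N1 d by (simp add: power2_eq_square)
      then have "N z \<le> (T z)\<^sup>2 / rmin" using rmin_pos by (simp add: field_simps)
      also have "\<dots> \<le> 2 / rmin * \<bar>T z\<bar> * norm (T z)"
        using rmin_pos by (simp add: power2_eq_square mult.assoc divide_le_cancel)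
      finally show ?case using N0 by simp
    qed
    have "((\<lambda>z. 2 / rmin * norm ((Q z - ?q) \<bullet> tng a)) \<longlongrightarrow> 2 / rmin * norm ((0 :: real^2) \<bullet> tng a)) ?F"
      by (intro tendsto_intros Q_lim)
    then show "((\<lambda>z. 2 / rmin * \<bar>T z\<bar>) \<longlongrightarrow> 0) ?F" by (simp add: T_def)
  qed
  have "Q = (\<lambda>z. ?q + (N z *\<^sub>R nrm a + T z *\<^sub>R tng a))"
    unfolding N_def T_def using frame_expansion[of "Q _ - ?q" a] by (auto simp: algebra_simps)
  moreover have "((\<lambda>z. ?q + (N z *\<^sub>R nrm a + T z *\<^sub>R tng a)) has_derivative (\<lambda>h. (y' h \<bullet> tng a) *\<^sub>R tng a)) ?F"
    by (auto intro!: derivative_eq_intros N T)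
  ultimately show ?thesis by (simp add: Q_def y'_def)
qed

text \<open>The formula is given on tangential arguments, where the differential does not depend on
  an extension off the boundary. \<open>W - rad a\<close> is the radius of curvature at the point of
  arrival.\<close>

lemma billiard_has_derivative:
  obtains D where "(billiard_map \<Omega> has_derivative D) (at (bd a, 0) within coball_bundle \<Omega>)"
    "\<And>w e. D (w *\<^sub>R tng a, e *\<^sub>R tng a) =
      ((w + W * (e - w / rad a)) *\<^sub>R tng a,
       (e - w / rad a - (w + W * (e - w / rad a)) / (W - rad a)) *\<^sub>R tng a)"
proof -
  let ?F = "at (bd a, 0 :: real^2) within coball_bundle \<Omega>"
  define v' where "v' = (\<lambda>h :: (real^2) \<times> (real^2). snd h - (1 / rad a) *\<^sub>R fst h)"
  define q' where "q' = (\<lambda>h :: (real^2) \<times> (real^2). ((fst h + W *\<^sub>R v' h) \<bullet> tng a) *\<^sub>R tng a)"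
  define n' where "n' = (\<lambda>h :: (real^2) \<times> (real^2). - (1 / (W - rad a)) *\<^sub>R q' h)"
  define \<nu> where "\<nu> = (\<lambda>z. inner_normal \<Omega> (fst (billiard_map \<Omega> z)))"
  have v: "(direction \<Omega> has_derivative v') ?F" unfolding v'_def by (rule direction_has_derivative)
  have q: "((\<lambda>z. fst (billiard_map \<Omega> z)) has_derivative q') ?F"
    unfolding q'_def v'_def by (rule hitting_point_has_derivative)
  have \<nu>: "(\<nu> has_derivative n') ?F"
    unfolding \<nu>_def n'_def
  proof (rule has_derivative_in_compose[OF q, where g' = "\<lambda>x. - (1 / (W - rad a)) *\<^sub>R x"])
    have "(\<lambda>z. fst (billiard_map \<Omega> z)) ` coball_bundle \<Omega> \<subseteq> frontier \<Omega>"
      using billiard_map_coball fst_coball by blast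
    then show "(inner_normal \<Omega> has_derivative (\<lambda>x. - (1 / (W - rad a)) *\<^sub>R x))
        (at (fst (billiard_map \<Omega> (bd a, 0))) within (\<lambda>z. fst (billiard_map \<Omega> z)) ` coball_bundle \<Omega>)"
      using has_derivative_subset[OF inner_normal_has_derivative[of "a + pi"]]
      by (simp add: normal_chord(4) rad_add_pi)
  qed
  have \<nu>0: "\<nu> (bd a, 0) = nrm a" by (simp add: \<nu>_def normal_chord(4) inner_normal_bd)
  have eq: "billiard_map \<Omega> = (\<lambda>z. (fst (billiard_map \<Omega> z), direction \<Omega> z - (direction \<Omega> z \<bullet> \<nu> z) *\<^sub>R \<nu> z))"
    by (rule ext) (simp add: billiard_map_def Let_def \<nu>_def)
  define D where "D = (\<lambda>h. (q' h, v' h - ((direction \<Omega> (bd a, 0) \<bullet> \<nu> (bd a, 0)) *\<^sub>R n' h +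
      (direction \<Omega> (bd a, 0) \<bullet> n' h + v' h \<bullet> \<nu> (bd a, 0)) *\<^sub>R \<nu> (bd a, 0))))"
  have "(billiard_map \<Omega> has_derivative D) ?F"
    unfolding D_def by (subst eq) (intro has_derivative_Pair q derivative_intros v \<nu>)
  moreover have "D (w *\<^sub>R tng a, e *\<^sub>R tng a) =
      ((w + W * (e - w / rad a)) *\<^sub>R tng a,
       (e - w / rad a - (w + W * (e - w / rad a)) / (W - rad a)) *\<^sub>R tng a)" for w e
  proof -
    let ?h = "(w *\<^sub>R tng a, e *\<^sub>R tng a)"
    have v1: "v' ?h = (e - w / rad a) *\<^sub>R tng a" by (simp add: v'_def scaleR_diff_left)
    have q1: "q' ?h = (w + W * (e - w / rad a)) *\<^sub>R tng a"
      unfolding q'_def v1 by (simp add: inner_add_left)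
    have n1: "n' ?h = - (((w + W * (e - w / rad a)) / (W - rad a)) *\<^sub>R tng a)"
      unfolding n'_def q1 by simp
    have "X *\<^sub>R tng a - ((- nrm a \<bullet> nrm a) *\<^sub>R - (Y *\<^sub>R tng a) +
        (- nrm a \<bullet> - (Y *\<^sub>R tng a) + (X *\<^sub>R tng a) \<bullet> nrm a) *\<^sub>R nrm a) = (X - Y) *\<^sub>R tng a" for X Y
      by (simp add: scaleR_diff_left)
    then show ?thesis
      unfolding D_def v1 q1 n1 \<nu>0 normal_chord(2) by (simp only:)
  qed
  ultimately show thesis by (rule that)
qed

end

section \<open>The admissible family\<close>

lemma smooth_on_bounded_linear:
  assumes "bounded_linear f" "smooth_on I c"
  shows "smooth_on I (\<lambda>t. f (c t))"
proof -
  obtain D where "D 0 = c" "\<And>n t. t \<in> I \<Longrightarrow> (D n has_vector_derivative D (Suc n) t) (at t)"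
    using assms(2) by (auto simp: smooth_on_def)
  then show ?thesis
    unfolding smooth_on_def
    by (intro exI[of _ "\<lambda>n t. f (D n t)"]) (auto intro: bounded_linear.has_vector_derivative[OF assms(1)])
qed

lemma tangent_space_bounded_linear:
  assumes f: "bounded_linear f" "f ` A \<subseteq> B" and v: "v \<in> tangent_space A x"
  shows "f v \<in> tangent_space B (f x)"
proof -
  obtain c e where c: "0 < e" "smooth_on {-e<..<e} c" "c ` {-e<..<e} \<subseteq> A" "c 0 = x"
      "(c has_vector_derivative v) (at 0)"
    using v by (auto simp: tangent_space_def)
  then show ?thesis
    unfolding tangent_space_def using f(2)
    by (intro CollectI exI[of _ "\<lambda>t. f (c t)"] exI[of _ e])
      (auto intro: smooth_on_bounded_linear[OF f(1)] bounded_linear.has_vector_derivative[OF f(1)])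
qed

lemma tangent_space_mono: "A \<subseteq> B \<Longrightarrow> tangent_space A x \<subseteq> tangent_space B x"
  using tangent_space_bounded_linear[OF bounded_linear_ident, of A B] by auto

context smooth_constant_width
begin

definition normal_family :: "((real^2) \<times> (real^2)) set" where
  "normal_family = (\<lambda>q. (q, 0)) ` frontier \<Omega>"

lemma normal_family_eq: "normal_family = range (\<lambda>t. (bd t, 0))"
  unfolding normal_family_def range_bd[symmetric] by (simp add: image_image)

lemma normal_family_coball: "normal_family \<subseteq> coball_bundle \<Omega>"
  unfolding normal_family_eq using normal_chord(1) by blast

section \<open>Tangent spaces of the family and of the bundle\<close>

lemma tangent_space_normal_family:
  "tangent_space normal_family (bd a, 0) = {v. fst v \<bullet> nrm a = 0 \<and> snd v = 0}"
proof (intro subset_antisym subsetI)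
  fix v assume v: "v \<in> tangent_space normal_family (bd a, 0)"
  have "fst v \<in> tangent_space (frontier \<Omega>) (fst (bd a, 0 :: real^2))"
    by (rule tangent_space_bounded_linear[OF bounded_linear_fst _ v]) (auto simp: normal_family_def)
  moreover have "snd v \<in> tangent_space {0} (snd (bd a, 0 :: real^2))"
    by (rule tangent_space_bounded_linear[OF bounded_linear_snd _ v]) (auto simp: normal_family_def)
  then have "snd v = 0"
  proof -
    obtain c e where c: "0 < e" "c ` {-e<..<e} \<subseteq> {0}" "(c has_vector_derivative snd v) (at 0)"
      using \<open>snd v \<in> _\<close> by (auto simp: tangent_space_def)
    have "((\<lambda>_. 0) has_vector_derivative snd v) (at (0::real))"
      by (rule has_vector_derivative_transform_within_open[OF c(3), of "{-e<..<e}"]) (use c(1,2) in \<open>auto simp: image_subset_iff\<close>)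
    then show ?thesis
      using vector_derivative_unique_at has_vector_derivative_const by blast
  qed
  ultimately show "v \<in> {v. fst v \<bullet> nrm a = 0 \<and> snd v = 0}"
    by (simp add: tangent_space_frontier)
next
  fix v :: "(real^2) \<times> (real^2)" assume "v \<in> {v. fst v \<bullet> nrm a = 0 \<and> snd v = 0}"
  then have "fst v \<in> tangent_space (frontier \<Omega>) (bd a)" "v = (fst v, 0)"
    by (auto simp: tangent_space_frontier prod_eq_iff)
  moreover have "bounded_linear (\<lambda>q :: real^2. (q, 0 :: real^2))"
    by (intro bounded_linear_Pair bounded_linear_ident bounded_linear_zero)
  ultimately show "v \<in> tangent_space normal_family (bd a, 0)"
    using tangent_space_bounded_linear[of "\<lambda>q. (q, 0)" "frontier \<Omega>" normal_family "fst v" "bd a"]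
    by (auto simp: normal_family_def)
qed

text \<open>Along a curve in the bundle the covector is orthogonal to the moving normal. Its
  component along the fixed \<open>nrm a\<close> is thus bounded by the change of the normal, which
  tends to zero, times the covector, which is at most linear.\<close>

lemma tangent_space_coball:
  assumes v: "v \<in> tangent_space (coball_bundle \<Omega>) (bd a, 0)"
  shows "fst v \<bullet> nrm a = 0" "snd v \<bullet> nrm a = 0"
proof -
  have "fst v \<in> tangent_space (frontier \<Omega>) (fst (bd a, 0 :: real^2))"
    by (rule tangent_space_bounded_linear[OF bounded_linear_fst fst_coball v])
  then show "fst v \<bullet> nrm a = 0" by (simp add: tangent_space_frontier)
  obtain c e where c: "0 < e" "c ` {-e<..<e} \<subseteq> coball_bundle \<Omega>" "c 0 = (bd a, 0)"
      "(c has_vector_derivative v) (at 0)"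
    using v by (auto simp: tangent_space_def)
  let ?F = "at (0::real) within {-e<..<e}"
  have c': "(c has_vector_derivative v) ?F" using c(4) by (rule has_vector_derivative_at_within)
  have snd_c: "((\<lambda>t. snd (c t)) has_vector_derivative snd v) ?F"
    by (rule bounded_linear.has_vector_derivative[OF bounded_linear_snd c'])
  have fst_cont: "continuous ?F (\<lambda>t. fst (c t))"
    using bounded_linear.has_vector_derivative[OF bounded_linear_fst c'] has_vector_derivative_continuous by blast
  have "continuous ?F (\<lambda>t. inner_normal \<Omega> (fst (c t)))"
  proof (rule continuous_within_compose2[OF fst_cont])
    have "(\<lambda>t. fst (c t)) ` {-e<..<e} \<subseteq> frontier \<Omega>" using c(2) fst_coball by blast
    then show "continuous (at (fst (c 0)) within (\<lambda>t. fst (c t)) ` {-e<..<e}) (inner_normal \<Omega>)"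
      using continuous_within_subset[OF inner_normal_continuous] by (simp add: c(3))
  qed
  then have lim: "((\<lambda>t. norm (inner_normal \<Omega> (fst (c t)) - inner_normal \<Omega> (bd a))) \<longlongrightarrow> 0) ?F"
    by (simp add: continuous_within c(3) LIM_zero_iff tendsto_norm_zero)
  have "((\<lambda>t. snd (c t) \<bullet> nrm a) has_derivative (\<lambda>_. 0)) ?F"
  proof (rule has_derivative_zero_squeeze[OF snd_c[unfolded has_vector_derivative_def] _ _ _ lim])
    show "\<forall>\<^sub>F t in ?F. norm (snd (c t) \<bullet> nrm a) \<le> norm (inner_normal \<Omega> (fst (c t)) - inner_normal \<Omega> (bd a)) * norm (snd (c t))"
      unfolding eventually_at_filter
    proof (intro always_eventually allI impI)
      fix t assume "t \<in> {-e<..<e}"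
      then have "c t \<in> coball_bundle \<Omega>" using c(2) by blast
      then obtain b where b: "fst (c t) = bd b" "snd (c t) \<bullet> nrm b = 0" unfolding coball_iff by blast
      have "snd (c t) \<bullet> nrm a = snd (c t) \<bullet> (inner_normal \<Omega> (fst (c t)) - inner_normal \<Omega> (bd a))"
        using b(2) by (simp add: b(1) inner_normal_bd inner_diff_right inner_add_right)
      then show "norm (snd (c t) \<bullet> nrm a) \<le> norm (inner_normal \<Omega> (fst (c t)) - inner_normal \<Omega> (bd a)) * norm (snd (c t))"
        using Cauchy_Schwarz_ineq2 by (simp add: mult.commute)
    qed
  qed (simp_all add: c(3))
  moreover have "((\<lambda>t. snd (c t) \<bullet> nrm a) has_derivative (\<lambda>t. (t *\<^sub>R snd v) \<bullet> nrm a)) ?F"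
    using snd_c unfolding has_vector_derivative_def by (intro derivative_intros)
  moreover have "?F = at 0" using c(1) by (intro at_within_open) auto
  ultimately have "(\<lambda>t. (t *\<^sub>R snd v) \<bullet> nrm a) = (\<lambda>_. 0)"
    using has_derivative_unique by metis
  from fun_cong[OF this, of 1] show "snd v \<bullet> nrm a = 0" by simp
qed

lemma billiard_square: "(billiard_map \<Omega> ^^ 2) (bd a, 0) = (bd a, 0)"
proof -
  have "(billiard_map \<Omega> ^^ 2) (bd a, 0) = billiard_map \<Omega> (billiard_map \<Omega> (bd a, 0))"
    by (simp add: numeral_2_eq_2)
  then show ?thesis
    unfolding normal_chord(4) unfolding bd_add_pi by simp
qed

text \<open>In the frame at \<open>bd a\<close> the differential of the square is the shear
  \<open>(w, e) \<mapsto> (w - 2 * W * (rad a / rad (a + pi)) * e, e)\<close>.\<close>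

lemma clean_normal_family: "clean_fixed_set (billiard_map \<Omega> ^^ 2) (coball_bundle \<Omega>) normal_family"
  unfolding clean_fixed_set_def
proof (intro conjI ballI normal_family_coball)
  fix z assume "z \<in> normal_family"
  then obtain a where z: "z = (bd a, 0)" unfolding normal_family_eq by blast
  show "(billiard_map \<Omega> ^^ 2) z = z" unfolding z by (rule billiard_square)
  let ?F = "at (bd a, 0 :: real^2) within coball_bundle \<Omega>"
  define r where "r = rad a"
  define s where "s = rad (a + pi)"
  have rs: "r > 0" "s > 0" "W = r + s" using rad_pos[of a] rad_pos[of "a + pi"] by (simp_all add: r_def s_def rad_add_pi)
  have Ws: "W - r = s" "W - s = r" using rs(3) by simp_all
  obtain D1 where D1: "(billiard_map \<Omega> has_derivative D1) ?F" "\<And>w e. D1 (w *\<^sub>R tng a, e *\<^sub>R tng a) =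
      ((w + W * (e - w / r)) *\<^sub>R tng a, (e - w / r - (w + W * (e - w / r)) / s) *\<^sub>R tng a)"
    by (rule billiard_has_derivative[of a, folded r_def, unfolded Ws]) (rule that)
  obtain D2 where D2: "(billiard_map \<Omega> has_derivative D2) (at (bd (a + pi), 0) within coball_bundle \<Omega>)"
      "\<And>w e. D2 (w *\<^sub>R tng (a + pi), e *\<^sub>R tng (a + pi)) =
      ((w + W * (e - w / s)) *\<^sub>R tng (a + pi), (e - w / s - (w + W * (e - w / s)) / r) *\<^sub>R tng (a + pi))"
    by (rule billiard_has_derivative[of "a + pi", folded s_def, unfolded Ws]) (rule that)
  \<comment> \<open>Both coordinates change sign between the frames at \<open>a\<close> and
    \<open>a + pi\<close>, so the formula reads the same in the frame at \<open>a\<close>.\<close>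
  have D2': "D2 (w *\<^sub>R tng a, e *\<^sub>R tng a) =
      ((w + W * (e - w / s)) *\<^sub>R tng a, (e - w / s - (w + W * (e - w / s)) / r) *\<^sub>R tng a)" for w e
  proof -
    have 1: "- w + W * (- e - - w / s) = - (w + W * (e - w / s))"
      by (simp add: algebra_simps)
    have 2: "- e - - w / s - - x / r = - (e - w / s - x / r)" for x
      by simp
    have "D2 (w *\<^sub>R tng a, e *\<^sub>R tng a) = D2 ((- w) *\<^sub>R tng (a + pi), (- e) *\<^sub>R tng (a + pi))"
      by simp
    then show ?thesis
      unfolding D2(2) 1 2 by (simp only: frame_add_pi scaleR_minus_left scaleR_minus_right minus_minus)
  qed
  have "billiard_map \<Omega> ` coball_bundle \<Omega> \<subseteq> coball_bundle \<Omega>" using billiard_map_coball by blast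
  then have "((\<lambda>z. billiard_map \<Omega> (billiard_map \<Omega> z)) has_derivative (\<lambda>h. D2 (D1 h))) ?F"
    by (intro has_derivative_in_compose[OF D1(1)]) (use has_derivative_subset[OF D2(1)] in \<open>simp add: normal_chord(4)\<close>)
  then have D: "(billiard_map \<Omega> ^^ 2 has_derivative (\<lambda>h. D2 (D1 h))) ?F"
    by (simp add: numeral_2_eq_2 o_def)
  have shear: "D2 (D1 (w *\<^sub>R tng a, e *\<^sub>R tng a)) = ((w - 2 * W * (r / s) * e) *\<^sub>R tng a, e *\<^sub>R tng a)" for w e
  proof -
    define q where "q = w + W * (e - w / r)"
    define x where "x = e - w / r - q / s"
    have q: "q = W * e - w * s / r" unfolding q_def rs(3) using rs(1,2) by (simp add: field_simps)
    have x: "x = - (r / s) * e" unfolding x_def q rs(3) using rs(1,2) by (simp add: field_simps)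
    have q2: "q + W * (x - q / s) = w - 2 * W * (r / s) * e"
      unfolding x q rs(3) using rs(1,2) by (simp add: field_simps)
    have "x - q / s - (w - 2 * W * (r / s) * e) / r = e"
      unfolding x q rs(3) using rs(1,2) by (simp add: field_simps)
    then show ?thesis
      unfolding D1(2) q_def[symmetric] x_def[symmetric] D2' q2 by simp
  qed
  have "{v \<in> tangent_space (coball_bundle \<Omega>) z. D2 (D1 v) - v = 0} = tangent_space normal_family z"
  proof (intro subset_antisym subsetI)
    fix v assume "v \<in> {v \<in> tangent_space (coball_bundle \<Omega>) z. D2 (D1 v) - v = 0}"
    then have v: "v \<in> tangent_space (coball_bundle \<Omega>) (bd a, 0)" "D2 (D1 v) = v" by (simp_all add: z)
    define w where "w = fst v \<bullet> tng a"
    define e where "e = snd v \<bullet> tng a"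
    have v_eq: "v = (w *\<^sub>R tng a, e *\<^sub>R tng a)"
      using frame_expansion[of "fst v" a] frame_expansion[of "snd v" a] tangent_space_coball[OF v(1)]
      by (intro prod_eqI) (simp_all add: w_def e_def)
    have "(w - 2 * W * (r / s) * e) *\<^sub>R tng a = w *\<^sub>R tng a"
      using v(2) unfolding v_eq shear by simp
    then have "2 * W * (r / s) * e = 0" by (simp add: scaleR_diff_left)
    \<comment> \<open>Positivity of both curvature radii makes the coefficient of the shear
      nonzero.\<close>
    then have "e = 0" using rs width_pos by simp
    then show "v \<in> tangent_space normal_family z"
      unfolding z tangent_space_normal_family v_eq by simp
  next
    fix v assume v: "v \<in> tangent_space normal_family z"
    then have "fst v = (fst v \<bullet> tng a) *\<^sub>R tng a" "snd v = 0 *\<^sub>R tng a"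
      using frame_expansion[of "fst v" a] unfolding z tangent_space_normal_family by simp_all
    then have v_eq: "v = ((fst v \<bullet> tng a) *\<^sub>R tng a, 0 *\<^sub>R tng a)" by (metis prod.collapse)
    have "D2 (D1 ((fst v \<bullet> tng a) *\<^sub>R tng a, 0 *\<^sub>R tng a)) = ((fst v \<bullet> tng a) *\<^sub>R tng a, 0 *\<^sub>R tng a)"
      by (subst shear) simp
    then have "D2 (D1 v) = v" unfolding v_eq[symmetric] .
    moreover have "v \<in> tangent_space (coball_bundle \<Omega>) z"
      using v tangent_space_mono[OF normal_family_coball] by blast
    ultimately show "v \<in> {v \<in> tangent_space (coball_bundle \<Omega>) z. D2 (D1 v) - v = 0}" by simp
  qed
  with D show "\<exists>D. (billiard_map \<Omega> ^^ 2 has_derivative D) (at z within coball_bundle \<Omega>) \<and>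
      {v \<in> tangent_space (coball_bundle \<Omega>) z. D v - v = 0} = tangent_space normal_family z"
    unfolding z by blast
qed

lemma smooth_circle_normal_family: "smooth_circle normal_family"
proof -
  have "smooth_on UNIV (\<lambda>t. (bd t, 0 :: real^2))"
  proof (rule smooth_on_bounded_linear[of "\<lambda>q. (q, 0)"])
    show "bounded_linear (\<lambda>q :: real^2. (q, 0 :: real^2))"
      by (intro bounded_linear_Pair bounded_linear_ident bounded_linear_zero)
    show "smooth_on UNIV bd" by (simp add: smooth_on_iff_Ck Ck_bd)
  qed
  moreover have "inj_on (\<lambda>t. (bd t, 0 :: real^2)) {0..<2 * pi}"
    by (rule inj_onI) (use nrm_inj bd_eq_iff in auto)
  moreover have "vector_derivative (\<lambda>t. (bd t, 0 :: real^2)) (at t) \<noteq> 0" for t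
  proof -
    have "((\<lambda>t. (bd t, 0 :: real^2)) has_vector_derivative (rad t *\<^sub>R tng t, 0)) (at t)"
      by (intro has_vector_derivative_Pair bd_has_vector_derivative has_vector_derivative_const)
    from vector_derivative_at[OF this] show ?thesis using rad_neq_0[of t] by (simp add: zero_prod_def)
  qed
  ultimately show ?thesis
    unfolding smooth_circle_def normal_family_eq
    by (intro exI[of _ "\<lambda>t. (bd t, 0)"]) simp
qed

lemma admissible_normal_family: "admissible_family \<Omega> 2 normal_family (2 * W)"
  unfolding admissible_family_def
proof (intro conjI smooth_circle_normal_family normal_family_coball clean_normal_family ballI)
  show "billiard_map \<Omega> ` normal_family = normal_family"
  proof (intro subset_antisym subsetI)
    fix z assume "z \<in> normal_family"
    then obtain a where "z = (bd a, 0)" unfolding normal_family_eq by blast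
    then have "z = billiard_map \<Omega> (bd (a - pi), 0)" by (simp add: normal_chord(4))
    then show "z \<in> billiard_map \<Omega> ` normal_family" unfolding normal_family_eq by blast
  qed (auto simp: normal_family_eq normal_chord(4))
next
  fix z assume "z \<in> normal_family"
  then obtain a where z: "z = (bd a, 0)" unfolding normal_family_eq by blast
  show "(billiard_map \<Omega> ^^ 2) z = z" unfolding z by (rule billiard_square)
  show "period_length \<Omega> 2 z = 2 * W"
    unfolding z period_length_def by (simp add: numeral_2_eq_2 normal_chord(3,4))
next
  obtain \<epsilon> where \<epsilon>: "\<epsilon> > 0" "\<And>m z. billiard_periodic \<Omega> m z \<Longrightarrow> period_length \<Omega> m z \<le> 2 * W + \<epsilon> \<Longrightarrow>
      m = 2 \<and> (\<exists>t. z = (bd t, 0))"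
    using periodic_trajectory_gap by metis
  show "\<exists>\<epsilon>>0. \<forall>m z. billiard_periodic \<Omega> m z \<and> period_length \<Omega> m z \<in> {2 * W - \<epsilon>..2 * W + \<epsilon>} \<longrightarrow>
      trajectory \<Omega> m z \<in> trajectory_family \<Omega> 2 normal_family \<union>
        reverse_trajectory ` trajectory_family \<Omega> 2 normal_family"
  proof (intro exI[of _ \<epsilon>] conjI \<epsilon>(1) allI impI)
    fix m z assume "billiard_periodic \<Omega> m z \<and> period_length \<Omega> m z \<in> {2 * W - \<epsilon>..2 * W + \<epsilon>}"
    then have "m = 2" "z \<in> normal_family"
      using \<epsilon>(2)[of m z] unfolding normal_family_eq by auto
    then show "trajectory \<Omega> m z \<in> trajectory_family \<Omega> 2 normal_family \<union>
        reverse_trajectory ` trajectory_family \<Omega> 2 normal_family"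
      by (simp add: trajectory_family_def)
  qed
  show "\<exists>r<1. \<forall>(q, \<xi>)\<in>normal_family. norm \<xi> \<le> r"
    by (intro exI[of _ 0]) (auto simp: normal_family_def)
qed simp

end

theorem proposition7p2p1:
  fixes \<Omega> :: "(real^2) set" and W :: real
  assumes "constant_width_domain \<Omega> W" and "smooth_boundary \<Omega>"
  shows "planar_domain \<Omega> \<and> bounded \<Omega> \<and> starlike \<Omega> \<and> smooth_boundary \<Omega> \<and>
         (\<exists>k \<Lambda> T. admissible_family \<Omega> k \<Lambda> T)"
proof -
  interpret smooth_constant_width \<Omega> W
    using assms by unfold_locales
  have "starlike \<Omega>"
    using convex_dom nonempty_dom by (rule convex_imp_starlike)
  then show ?thesis
    using assms admissible_normal_family unfolding constant_width_domain_def by blast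
qed

end
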